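(* Let $n$ be a positive integer and let $a_1, \dots, a_n$ be square-free integers $\geq 2$ that are pairwise coprime and all of whose prime factors are congruent to $1$ modulo $4$. Then $$\dim_{\mathbb{F}_2} \mathrm{Cl}^{+}(\mathbb{Q}(\sqrt{a_1}, \dots, \sqrt{a_n}))[2] \leq \omega(a_1 \cdots a_n) \cdot 2^{n-1} - 2^n + 1.$$
   Context: For a number field $K$, $\mathrm{Cl}^{+}(K)$ denotes the narrow class group of $K$ and $\mathrm{Cl}^{+}(K)[2]$ its $2$-torsion subgroup. For a positive integer $m$, $\omega(m)$ denotes the number of distinct prime factors of $m$. *)

theory Defs
  imports Complex_Main "HOL-Computational_Algebra.Computational_Algebra"
begin

text \<open>Number fields are realised concretely as subfields of the complex numbers.\<close>

definition is_subfield :: "complex set \<Rightarrow> bool" where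
  "is_subfield F \<longleftrightarrow> 0 \<in> F \<and> 1 \<in> F \<and>
     (\<forall>x\<in>F. \<forall>y\<in>F. x + y \<in> F \<and> x - y \<in> F \<and> x * y \<in> F) \<and>
     (\<forall>x\<in>F. x \<noteq> 0 \<longrightarrow> inverse x \<in> F)"

definition field_generated :: "complex set \<Rightarrow> complex set" where
  "field_generated S = \<Inter>{F. is_subfield F \<and> S \<subseteq> F}"

definition multiquadratic_field :: "nat \<Rightarrow> (nat \<Rightarrow> int) \<Rightarrow> complex set" where
  "multiquadratic_field n a = field_generated ((\<lambda>i. csqrt (of_int (a i))) ` {1..n})"

definition ring_of_integers :: "complex set \<Rightarrow> complex set" where
  "ring_of_integers K = {x \<in> K. algebraic_int x}"

text \<open>Nonzero fractional ideals of K: nonzero O_K-submodules of K with bounded denominators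
  (these are automatically finitely generated since O_K is Noetherian).\<close>
definition fractional_ideal :: "complex set \<Rightarrow> complex set \<Rightarrow> bool" where
  "fractional_ideal K I \<longleftrightarrow> I \<subseteq> K \<and> 0 \<in> I \<and> I \<noteq> {0} \<and>
     (\<forall>x\<in>I. \<forall>y\<in>I. x + y \<in> I) \<and>
     (\<forall>r\<in>ring_of_integers K. \<forall>x\<in>I. r * x \<in> I) \<and>
     (\<exists>d\<in>ring_of_integers K. d \<noteq> 0 \<and> (\<forall>x\<in>I. d * x \<in> ring_of_integers K))"

definition frac_ideal_prod :: "complex set \<Rightarrow> complex set \<Rightarrow> complex set" where
  "frac_ideal_prod I J = {x. \<exists>(k::nat) f g. (\<forall>i<k. f i \<in> I \<and> g i \<in> J) \<and> x = (\<Sum>i<k. f i * g i)}"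

definition field_embedding :: "complex set \<Rightarrow> (complex \<Rightarrow> complex) \<Rightarrow> bool" where
  "field_embedding K \<sigma> \<longleftrightarrow> \<sigma> 1 = 1 \<and>
     (\<forall>x\<in>K. \<forall>y\<in>K. \<sigma> (x + y) = \<sigma> x + \<sigma> y \<and> \<sigma> (x * y) = \<sigma> x * \<sigma> y)"

definition totally_positive :: "complex set \<Rightarrow> complex \<Rightarrow> bool" where
  "totally_positive K \<alpha> \<longleftrightarrow> \<alpha> \<in> K \<and> \<alpha> \<noteq> 0 \<and>
     (\<forall>\<sigma>. field_embedding K \<sigma> \<and> \<sigma> ` K \<subseteq> \<real> \<longrightarrow> Re (\<sigma> \<alpha>) > 0)"

definition narrow_equiv :: "complex set \<Rightarrow> complex set \<Rightarrow> complex set \<Rightarrow> bool" where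
  "narrow_equiv K I J \<longleftrightarrow> (\<exists>\<alpha>. totally_positive K \<alpha> \<and> I = (\<lambda>x. \<alpha> * x) ` J)"

definition narrow_rel :: "complex set \<Rightarrow> (complex set \<times> complex set) set" where
  "narrow_rel K = {(I, J). fractional_ideal K I \<and> fractional_ideal K J \<and> narrow_equiv K I J}"

definition narrow_class_group :: "complex set \<Rightarrow> complex set set set" where
  "narrow_class_group K = {I. fractional_ideal K I} // narrow_rel K"

definition narrow_class_group_2tors :: "complex set \<Rightarrow> complex set set set" where
  "narrow_class_group_2tors K =
     {I. fractional_ideal K I \<and> narrow_equiv K (frac_ideal_prod I I) (ring_of_integers K)} // narrow_rel K"

text \<open>The F_2-dimension of the elementary abelian 2-group Cl^+(K)[2]: its order is 2^dim.\<close>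
definition narrow_2rank :: "complex set \<Rightarrow> nat" where
  "narrow_2rank K = (THE d. card (narrow_class_group_2tors K) = 2 ^ d)"

end

theory Submission
  imports Defs "HOL-Analysis.Kronecker_Approximation_Theorem" "Jordan_Normal_Form.Char_Poly"
begin

text \<open>
  For a totally real field \<open>K\<close> let \<open>V(K)\<close> be the group of totally positive elements generating the
  square of an ideal, modulo squares of totally positive elements. Mapping a generator to the class
  of the root ideal gives an exact sequence
  \<open>1 \<longrightarrow> E\<^sup>+ / (E\<^sup>+)\<^sup>2 \<longrightarrow> V(K) \<longrightarrow> Cl\<^sup>+(K)[2] \<longrightarrow> 1\<close> with \<open>E\<^sup>+\<close> the totally positive units.

  Upper bound for \<open>V\<close>: let \<open>L = K(\<surd>a)\<close> with \<open>a \<equiv> 1 mod 4\<close>. The norm maps \<open>V(L)\<close> to \<open>V(K)\<close>, and by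
  Hilbert 90 its kernel consists of classes of elements of \<open>K\<close>. Sending such an element to the set of
  primes above \<open>a\<close> at which it has odd order has fibres that embed into \<open>V(K)\<close>. As a rational prime
  has at most \<open>2\<^sup>k\<close> primes above it in the \<open>k\<close>-th field of the tower and \<open>V\<close> of the rationals is
  trivial, \<open>dim V \<le> \<omega>(a\<^sub>1 \<cdots> a\<^sub>n) 2\<^bsup>n - 1\<^esup>\<close> for the multiquadratic field.

  Lower bound for units: Pell units of the \<open>2\<^sup>n - 1\<close> quadratic subfields are eigenvectors for distinct
  characters of the Galois group, and the corresponding logarithms are discrete, so
  \<open>dim E\<^sup>+ / (E\<^sup>+)\<^sup>2 \<ge> 2\<^sup>n - 1\<close>.
\<close>

section \<open>Algebraic integers\<close>

text \<open>Ideals are never factored. Being the square of an ideal is tested prime by prime through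
  integrality of \<open>x\<^sup>2 / \<alpha>\<close>, so the prime ideal theory needed reduces to
  lying over and a count of primes. Likewise \<open>V(K)\<close> is not built as a quotient: a
  finite set of representatives bounds its size, and a dimension is read off at the very end from
  the order of the 2-torsion. Total positivity keeps \<open>1 + \<theta>\<close> nonzero in Hilbert
  90 and makes the resulting factor in K totally positive, so signs survive the descent. The
  congruence \<open>a \<equiv> 1 mod 4\<close> makes L/K unramified outside a, in particular at 2;
  hence odd orders occur only above a. If e bounds dim V of the k-th field and w is the number of
  primes dividing the next a, then norm image and kernel contribute e and
  \<open>w * 2^k + e\<close>. The recursion \<open>e' = 2 * e + w * 2^k\<close> from 0 produces the
  exponent \<open>n - 1\<close> of 2 in the bound. The number \<open>2^n - 1\<close> counts the
  nontrivial characters. Pell units only show that each character occurs; they may themselves be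
  squares, so the independent units are chosen by minimality.\<close>

lemma algebraic_int_of_eigenvector:
  fixes A :: "nat \<Rightarrow> nat \<Rightarrow> int" and v :: "nat \<Rightarrow> complex"
  assumes eq: "\<And>i. i < n \<Longrightarrow> x * v i = (\<Sum>j<n. of_int (A i j) * v j)"
    and nz: "k < n" "v k \<noteq> 0"
  shows "algebraic_int x"
proof -
  define B where "B = mat n n (\<lambda>(i, j). A i j)"
  define C where "C = map_mat (of_int :: int \<Rightarrow> complex) B"
  have B: "B \<in> carrier_mat n n" and C: "C \<in> carrier_mat n n"
    by (auto simp: B_def C_def)
  have "C *\<^sub>v vec n v = x \<cdot>\<^sub>v vec n v"
    by (rule eq_vecI)
      (auto simp: C_def B_def eq scalar_prod_def atLeast0LessThan)
  moreover have "vec n v \<noteq> 0\<^sub>v n"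
    using nz by (metis index_vec index_zero_vec(1))
  ultimately have "eigenvalue C x"
    unfolding eigenvalue_def eigenvector_def using C by (intro exI[of _ "vec n v"]) auto
  then have root: "poly (char_poly C) x = 0"
    using eigenvalue_root_char_poly[OF C] by simp
  interpret of_int_hom: comm_ring_hom "of_int :: int \<Rightarrow> complex"
    by unfold_locales auto
  have "char_poly C = map_poly of_int (char_poly B)"
    unfolding C_def by (rule of_int_hom.char_poly_hom[OF B])
  then show ?thesis
    using root degree_monic_char_poly[OF B] unfolding algebraic_int_altdef_ipoly by fastforce
qed

text \<open>The determinant trick in a form free of indices: enumerating \<open>B\<close> turns the
  relations into an integer matrix with eigenvalue x, and the nonzero element b keeps the
  eigenvector from vanishing.\<close>

lemma algebraic_int_of_stable_span:
  fixes B :: "complex set"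
  assumes "finite B" and "b \<in> B" "b \<noteq> 0"
    and stable: "\<And>b. b \<in> B \<Longrightarrow> \<exists>c. x * b = (\<Sum>b'\<in>B. of_int (c b') * b')"
  shows "algebraic_int x"
proof -
  obtain v where v: "bij_betw v {..<card B} B"
    using ex_bij_betw_nat_finite[OF \<open>finite B\<close>] by (auto simp: atLeast0LessThan)
  obtain c where c: "\<And>b. b \<in> B \<Longrightarrow> x * b = (\<Sum>b'\<in>B. of_int (c b b') * b')"
    using stable by metis
  obtain k where k: "k < card B" "v k = b"
    using v \<open>b \<in> B\<close> unfolding bij_betw_def by (metis imageE lessThan_iff)
  show ?thesis
  proof (rule algebraic_int_of_eigenvector[where v = v])
    fix i assume "i < card B"
    then have "v i \<in> B"
      using v by (auto simp: bij_betw_def)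
    then have "x * v i = (\<Sum>b'\<in>B. of_int (c (v i) b') * b')"
      by (rule c)
    also have "\<dots> = (\<Sum>j<card B. of_int (c (v i) (v j)) * v j)"
      using sum.reindex_bij_betw[OF v, of "\<lambda>b'. of_int (c (v i) b') * b'"] by simp
    finally show "x * v i = (\<Sum>j<card B. of_int (c (v i) (v j)) * v j)" .
  next
    show "k < card B" "v k \<noteq> 0"
      using \<open>b \<noteq> 0\<close> k by auto
  qed
qed

definition int_span :: "complex set \<Rightarrow> complex set" where
  "int_span B = {z. \<exists>c :: complex \<Rightarrow> int. z = (\<Sum>b\<in>B. of_int (c b) * b)}"

lemma int_span_0: "0 \<in> int_span B"
  unfolding int_span_def by (auto intro!: exI[of _ "\<lambda>_. 0"])

lemma int_span_base:
  assumes "finite B" "b \<in> B" shows "b \<in> int_span B"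
proof -
  have "(\<Sum>b'\<in>B. of_int (if b' = b then 1 else 0) * b') = (\<Sum>b'\<in>B. if b' = b then b' else 0)"
    by (intro sum.cong) auto
  also have "\<dots> = b"
    using assms by simp
  finally show ?thesis
    unfolding int_span_def by (auto intro!: exI[of _ "\<lambda>b'. if b' = b then 1 else 0"])
qed

lemma int_span_add:
  assumes "u \<in> int_span B" "w \<in> int_span B" shows "u + w \<in> int_span B"
proof -
  obtain c d where "u = (\<Sum>b\<in>B. of_int (c b) * b)" "w = (\<Sum>b\<in>B. of_int (d b) * b)"
    using assms by (auto simp: int_span_def)
  then have "u + w = (\<Sum>b\<in>B. of_int (c b + d b) * b)"
    by (simp add: sum.distrib algebra_simps)
  then show ?thesis
    unfolding int_span_def by (auto intro!: exI[of _ "\<lambda>b. c b + d b"])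
qed

lemma int_span_scale:
  assumes "u \<in> int_span B" shows "of_int k * u \<in> int_span B"
proof -
  obtain c where "u = (\<Sum>b\<in>B. of_int (c b) * b)"
    using assms by (auto simp: int_span_def)
  then have "of_int k * u = (\<Sum>b\<in>B. of_int (k * c b) * b)"
    by (simp add: sum_distrib_left algebra_simps)
  then show ?thesis
    unfolding int_span_def by (auto intro!: exI[of _ "\<lambda>b. k * c b"])
qed

lemma int_span_sum:
  assumes "\<And>i. i \<in> I \<Longrightarrow> f i \<in> int_span B" shows "sum f I \<in> int_span B"
  using assms by (induction I rule: infinite_finite_induct) (auto intro: int_span_add int_span_0)

lemma int_span_mult_stable:
  assumes "\<And>b. b \<in> B \<Longrightarrow> x * b \<in> int_span B" "u \<in> int_span B"
  shows "x * u \<in> int_span B"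
proof -
  obtain c where "u = (\<Sum>b\<in>B. of_int (c b) * b)"
    using assms(2) by (auto simp: int_span_def)
  then have "x * u = (\<Sum>b\<in>B. of_int (c b) * (x * b))"
    by (simp add: sum_distrib_left algebra_simps)
  then show ?thesis
    using assms(1) by (auto intro!: int_span_sum int_span_scale)
qed

lemma power_monic_root_reduce:
  assumes p: "poly (map_poly of_int p) (x :: complex) = 0" "lead_coeff p = 1"
  shows "x ^ degree p = (\<Sum>i<degree p. of_int (- coeff p i) * x ^ i)"
proof -
  have "0 = (\<Sum>i\<le>degree p. of_int (coeff p i) * x ^ i)"
    using p(1) by (simp add: poly_altdef)
  also have "\<dots> = (\<Sum>i<degree p. of_int (coeff p i) * x ^ i) + x ^ degree p"
    using p(2) by (simp add: lessThan_Suc_atMost[symmetric])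
  finally have "x ^ degree p = - (\<Sum>i<degree p. of_int (coeff p i) * x ^ i)"
    by (simp add: add_eq_0_iff2 add.commute)
  then show ?thesis
    by (simp add: sum_negf)
qed

text \<open>The monomials \<open>x ^ i * y ^ j\<close> below the two degrees work: multiplication by
  x or y raises an exponent, or at the border is rewritten by the monic equation. One lattice serves
  both numbers, hence also their sum and product. Coincidences between monomials do no harm, as
  \<open>B\<close> is just a spanning set.\<close>

lemma algebraic_int_common_module:
  assumes "algebraic_int (x :: complex)" "algebraic_int y"
  obtains B where "finite B" "1 \<in> B" "\<And>b. b \<in> B \<Longrightarrow> x * b \<in> int_span B"
    "\<And>b. b \<in> B \<Longrightarrow> y * b \<in> int_span B"
proof -
  obtain p where p: "poly (map_poly of_int p) x = 0" "lead_coeff p = 1"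
    using assms(1) unfolding algebraic_int_altdef_ipoly by auto
  obtain q where q: "poly (map_poly of_int q) y = 0" "lead_coeff q = 1"
    using assms(2) unfolding algebraic_int_altdef_ipoly by auto
  define B where "B = (\<lambda>(i, j). x ^ i * y ^ j) ` ({..<degree p} \<times> {..<degree q})"
  have fin: "finite B"
    by (simp add: B_def)
  \<comment> \<open>Positive degrees put the exponent pair (0, 0) in range, so that 1 lies in
    \<open>B\<close>.\<close>
  have nz: "degree r > 0" if "poly (map_poly of_int r) (z :: complex) = 0" "lead_coeff r = 1"
    for r z
  proof (rule ccontr)
    assume "\<not> degree r > 0"
    then obtain c where "r = [:c:]"
      by (meson degree_eq_zeroE neq0_conv)
    with that show False by simp
  qed
  have memB: "x ^ i * y ^ j \<in> int_span B" if "i < degree p" "j < degree q" for i j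
    using that by (intro int_span_base fin) (auto simp: B_def)
  show ?thesis
  proof (rule that[OF fin])
    show "1 \<in> B"
      unfolding B_def using nz[OF p] nz[OF q] by (intro image_eqI[of _ _ "(0, 0)"]) auto
  next
    fix b assume "b \<in> B"
    then obtain i j where ij: "b = x ^ i * y ^ j" "i < degree p" "j < degree q"
      by (auto simp: B_def)
    show "x * b \<in> int_span B"
    proof (cases "Suc i < degree p")
      case True
      then show ?thesis using memB[of "Suc i" j] ij by (simp add: algebra_simps)
    next
      case False
      then have "Suc i = degree p" using ij by simp
      then have "x * b = x ^ degree p * y ^ j"
        using ij(1) by (metis mult.assoc power_Suc)
      also have "\<dots> = (\<Sum>k<degree p. of_int (- coeff p k) * (x ^ k * y ^ j))"
        unfolding power_monic_root_reduce[OF p] by (simp add: sum_distrib_right sum_distrib_left algebra_simps)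
      also have "\<dots> \<in> int_span B"
        using ij by (intro int_span_sum int_span_scale memB) auto
      finally show ?thesis .
    qed
    show "y * b \<in> int_span B"
    proof (cases "Suc j < degree q")
      case True
      then show ?thesis using memB[of i "Suc j"] ij by (simp add: algebra_simps)
    next
      case False
      then have "Suc j = degree q" using ij by simp
      then have "y * b = y ^ degree q * x ^ i"
        using ij(1) by (metis mult.assoc mult.commute power_Suc)
      also have "\<dots> = (\<Sum>k<degree q. of_int (- coeff q k) * (x ^ i * y ^ k))"
        unfolding power_monic_root_reduce[OF q] by (simp add: sum_distrib_right sum_distrib_left algebra_simps)
      also have "\<dots> \<in> int_span B"
        using ij by (intro int_span_sum int_span_scale memB) auto
      finally show ?thesis .
    qed
  qed
qed

lemma algebraic_int_add_mult:
  assumes "algebraic_int (x :: complex)" "algebraic_int y"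
  shows "algebraic_int (x + y)" "algebraic_int (x * y)"
proof -
  obtain B where B: "finite B" "1 \<in> B" "\<And>b. b \<in> B \<Longrightarrow> x * b \<in> int_span B"
    "\<And>b. b \<in> B \<Longrightarrow> y * b \<in> int_span B"
    using algebraic_int_common_module[OF assms] by blast
  have *: "algebraic_int z" if "\<And>b. b \<in> B \<Longrightarrow> z * b \<in> int_span B" for z
    using that by (intro algebraic_int_of_stable_span[OF B(1,2)]) (auto simp: int_span_def)
  have "(x + y) * b \<in> int_span B" if "b \<in> B" for b
    using B(3,4)[OF that] by (simp add: distrib_right int_span_add)
  then show "algebraic_int (x + y)"
    by (rule *)
  have "x * (y * b) \<in> int_span B" if "b \<in> B" for b
    using B(3) B(4)[OF that] by (rule int_span_mult_stable)
  then show "algebraic_int (x * y)"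
    by (intro *) (simp add: mult.assoc)
qed

lemma algebraic_int_prod:
  "(\<And>i. i \<in> I \<Longrightarrow> algebraic_int (f i :: complex)) \<Longrightarrow> algebraic_int (prod f I)"
  by (induction I rule: infinite_finite_induct) (auto intro: algebraic_int_add_mult)

section \<open>Subfields, embeddings and prime ideals\<close>

lemma subfieldD:
  assumes "is_subfield F"
  shows "0 \<in> F" "1 \<in> F"
    "\<And>x y. x \<in> F \<Longrightarrow> y \<in> F \<Longrightarrow> x + y \<in> F"
    "\<And>x y. x \<in> F \<Longrightarrow> y \<in> F \<Longrightarrow> x - y \<in> F"
    "\<And>x y. x \<in> F \<Longrightarrow> y \<in> F \<Longrightarrow> x * y \<in> F"
    "\<And>x. x \<in> F \<Longrightarrow> - x \<in> F"
    "\<And>x. x \<in> F \<Longrightarrow> inverse x \<in> F"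
    "\<And>x y. x \<in> F \<Longrightarrow> y \<in> F \<Longrightarrow> x / y \<in> F"
    "\<And>x k. x \<in> F \<Longrightarrow> x ^ k \<in> F"
proof -
  show 0: "0 \<in> F" and 1: "1 \<in> F"
    and "\<And>x y. x \<in> F \<Longrightarrow> y \<in> F \<Longrightarrow> x + y \<in> F"
    and diff: "\<And>x y. x \<in> F \<Longrightarrow> y \<in> F \<Longrightarrow> x - y \<in> F"
    and mult: "\<And>x y. x \<in> F \<Longrightarrow> y \<in> F \<Longrightarrow> x * y \<in> F"
    using assms by (auto simp: is_subfield_def)
  show "\<And>x. x \<in> F \<Longrightarrow> - x \<in> F"
    using diff[OF 0] by simp
  show inv: "\<And>x. x \<in> F \<Longrightarrow> inverse x \<in> F"
    using assms 0 unfolding is_subfield_def by (metis inverse_zero)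
  show "\<And>x y. x \<in> F \<Longrightarrow> y \<in> F \<Longrightarrow> x / y \<in> F"
    using inv mult by (simp add: divide_inverse)
  show "x ^ k \<in> F" if "x \<in> F" for x k
    using that by (induction k) (auto intro: mult 1)
qed

lemma subfield_of_nat: "is_subfield F \<Longrightarrow> of_nat k \<in> F"
  by (induction k) (auto intro: subfieldD)

lemma subfield_of_int: "is_subfield F \<Longrightarrow> of_int k \<in> F"
  by (cases k rule: int_cases2) (auto intro: subfieldD subfield_of_nat)

lemma subfield_numeral: "is_subfield F \<Longrightarrow> numeral k \<in> F"
  using subfield_of_nat[of F "numeral k"] by simp

lemma subfield_prod:
  "is_subfield F \<Longrightarrow> (\<And>i. i \<in> I \<Longrightarrow> f i \<in> F) \<Longrightarrow> prod f I \<in> F"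
  by (induction I rule: infinite_finite_induct) (auto intro: subfieldD)

lemma embeddingD:
  assumes "is_subfield F" "field_embedding F \<tau>"
  shows "\<tau> 0 = 0" "\<tau> 1 = 1"
    "\<And>x y. x \<in> F \<Longrightarrow> y \<in> F \<Longrightarrow> \<tau> (x + y) = \<tau> x + \<tau> y"
    "\<And>x y. x \<in> F \<Longrightarrow> y \<in> F \<Longrightarrow> \<tau> (x * y) = \<tau> x * \<tau> y"
    "\<And>x. x \<in> F \<Longrightarrow> \<tau> (- x) = - \<tau> x"
    "\<And>x y. x \<in> F \<Longrightarrow> y \<in> F \<Longrightarrow> \<tau> (x - y) = \<tau> x - \<tau> y"
    "\<And>x. x \<in> F \<Longrightarrow> \<tau> (inverse x) = inverse (\<tau> x)"
    "\<And>x y. x \<in> F \<Longrightarrow> y \<in> F \<Longrightarrow> \<tau> (x / y) = \<tau> x / \<tau> y"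
    "\<And>x k. x \<in> F \<Longrightarrow> \<tau> (x ^ k) = \<tau> x ^ k"
    "\<And>x. x \<in> F \<Longrightarrow> \<tau> x = 0 \<longleftrightarrow> x = 0"
proof -
  note F = subfieldD[OF assms(1)]
  show 1: "\<tau> 1 = 1"
    and add: "\<And>x y. x \<in> F \<Longrightarrow> y \<in> F \<Longrightarrow> \<tau> (x + y) = \<tau> x + \<tau> y"
    and mult: "\<And>x y. x \<in> F \<Longrightarrow> y \<in> F \<Longrightarrow> \<tau> (x * y) = \<tau> x * \<tau> y"
    using assms(2) by (auto simp: field_embedding_def)
  show 0: "\<tau> 0 = 0"
    using add[OF F(1) F(1)] by simp
  show minus: "\<tau> (- x) = - \<tau> x" if "x \<in> F" for x
    using add[OF that F(6)[OF that]] 0 by (simp add: minus_unique)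
  show "\<tau> (x - y) = \<tau> x - \<tau> y" if "x \<in> F" "y \<in> F" for x y
    using add[OF that(1) F(6)[OF that(2)]] minus[OF that(2)] by simp
  have inv: "\<tau> x * \<tau> (inverse x) = 1" if "x \<in> F" "x \<noteq> 0" for x
    using mult[OF that(1) F(7)[OF that(1)]] that 1 by simp
  show zero: "\<tau> x = 0 \<longleftrightarrow> x = 0" if "x \<in> F" for x
    using inv[OF that] 0 by (cases "x = 0") auto
  show inverse: "\<tau> (inverse x) = inverse (\<tau> x)" if "x \<in> F" for x
    using inv[OF that] 0 by (cases "x = 0") (auto simp: inverse_unique)
  show "\<tau> (x / y) = \<tau> x / \<tau> y" if "x \<in> F" "y \<in> F" for x y
    using mult[OF that(1) F(7)[OF that(2)]] inverse[OF that(2)] by (simp add: divide_inverse)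
  show "\<tau> (x ^ k) = \<tau> x ^ k" if "x \<in> F" for x k
    using that by (induction k) (auto simp: 1 mult F)
qed

lemma embedding_of_nat:
  "is_subfield F \<Longrightarrow> field_embedding F \<tau> \<Longrightarrow> \<tau> (of_nat k) = of_nat k"
  by (induction k) (auto simp: embeddingD subfieldD subfield_of_nat)

lemma embedding_of_int:
  "is_subfield F \<Longrightarrow> field_embedding F \<tau> \<Longrightarrow> \<tau> (of_int k) = of_int k"
  by (cases k rule: int_cases2) (auto simp: embeddingD embedding_of_nat subfield_of_nat)

lemma embedding_sum:
  assumes "is_subfield F" "field_embedding F \<tau>" "\<And>i. i \<in> I \<Longrightarrow> f i \<in> F"
  shows "\<tau> (sum f I) = (\<Sum>i\<in>I. \<tau> (f i)) \<and> sum f I \<in> F"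
  using assms(3)
  by (induction I rule: infinite_finite_induct)
    (auto simp: embeddingD[OF assms(1,2)] subfieldD[OF assms(1)])

lemma embedding_prod:
  assumes "is_subfield F" "field_embedding F \<tau>" "\<And>i. i \<in> I \<Longrightarrow> f i \<in> F"
  shows "\<tau> (prod f I) = (\<Prod>i\<in>I. \<tau> (f i)) \<and> prod f I \<in> F"
  using assms(3)
  by (induction I rule: infinite_finite_induct)
    (auto simp: embeddingD[OF assms(1,2)] subfieldD[OF assms(1)])

lemma embedding_algebraic_int:
  assumes F: "is_subfield F" "field_embedding F \<tau>" and x: "x \<in> F" "algebraic_int x"
  shows "algebraic_int (\<tau> x)"
proof -
  obtain p where p: "poly (map_poly of_int p) x = 0" "lead_coeff p = 1"
    using x(2) unfolding algebraic_int_altdef_ipoly by auto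
  have mem: "of_int (coeff p i) * x ^ i \<in> F" for i
    using x F(1) by (intro subfieldD subfield_of_int) auto
  have "0 = \<tau> (\<Sum>i\<le>degree p. of_int (coeff p i) * x ^ i)"
    using p(1) embeddingD(1)[OF F] by (simp add: poly_altdef)
  also have "\<dots> = (\<Sum>i\<le>degree p. of_int (coeff p i) * \<tau> x ^ i)"
    using embedding_sum[OF F, of "{..degree p}" "\<lambda>i. of_int (coeff p i) * x ^ i"] mem x F
    by (simp add: embeddingD[OF F] subfield_of_int subfieldD embedding_of_int)
  finally have "poly (map_poly of_int p) (\<tau> x) = 0"
    by (simp add: poly_altdef)
  then show ?thesis
    unfolding algebraic_int_altdef_ipoly using p(2) by auto
qed

section \<open>Ideals and prime ideals of subrings\<close>

definition is_subring :: "complex set \<Rightarrow> bool" where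
  "is_subring R \<longleftrightarrow> 1 \<in> R \<and> (\<forall>x\<in>R. \<forall>y\<in>R. x + y \<in> R \<and> x * y \<in> R) \<and> (\<forall>x\<in>R. - x \<in> R)"

definition is_ideal :: "complex set \<Rightarrow> complex set \<Rightarrow> bool" where
  "is_ideal R I \<longleftrightarrow> I \<subseteq> R \<and> 0 \<in> I \<and> (\<forall>x\<in>I. \<forall>y\<in>I. x + y \<in> I) \<and> (\<forall>r\<in>R. \<forall>x\<in>I. r * x \<in> I)"

definition is_prime_ideal :: "complex set \<Rightarrow> complex set \<Rightarrow> bool" where
  "is_prime_ideal R P \<longleftrightarrow> is_ideal R P \<and> 1 \<notin> P \<and>
     (\<forall>x\<in>R. \<forall>y\<in>R. x * y \<in> P \<longrightarrow> x \<in> P \<or> y \<in> P)"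

lemma subringD:
  assumes "is_subring R"
  shows "0 \<in> R" "1 \<in> R"
    "\<And>x y. x \<in> R \<Longrightarrow> y \<in> R \<Longrightarrow> x + y \<in> R"
    "\<And>x y. x \<in> R \<Longrightarrow> y \<in> R \<Longrightarrow> x * y \<in> R"
    "\<And>x. x \<in> R \<Longrightarrow> - x \<in> R"
proof -
  show 1: "1 \<in> R"
    and add: "\<And>x y. x \<in> R \<Longrightarrow> y \<in> R \<Longrightarrow> x + y \<in> R"
    and "\<And>x y. x \<in> R \<Longrightarrow> y \<in> R \<Longrightarrow> x * y \<in> R"
    and minus: "\<And>x. x \<in> R \<Longrightarrow> - x \<in> R"
    using assms by (auto simp: is_subring_def)
  show "0 \<in> R"
    using add[OF 1 minus[OF 1]] by simp
qed

lemma idealD: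
  assumes "is_ideal R I"
  shows "\<And>x. x \<in> I \<Longrightarrow> x \<in> R" "0 \<in> I" "\<And>x y. x \<in> I \<Longrightarrow> y \<in> I \<Longrightarrow> x + y \<in> I"
    "\<And>r x. r \<in> R \<Longrightarrow> x \<in> I \<Longrightarrow> r * x \<in> I"
    "\<And>r x. r \<in> R \<Longrightarrow> x \<in> I \<Longrightarrow> x * r \<in> I"
  using assms by (auto simp: is_ideal_def mult.commute[of _ "_ :: complex"])

lemma prime_idealD:
  assumes "is_prime_ideal R P"
  shows "is_ideal R P" "1 \<notin> P"
    "\<And>x y. x \<in> R \<Longrightarrow> y \<in> R \<Longrightarrow> x * y \<in> P \<Longrightarrow> x \<in> P \<or> y \<in> P"
    "\<And>x. x \<in> R \<Longrightarrow> x\<^sup>2 \<in> P \<Longrightarrow> x \<in> P"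
  using assms by (auto simp: is_prime_ideal_def power2_eq_square)

lemma ideal_sum: "is_ideal R I \<Longrightarrow> (\<And>i. i \<in> A \<Longrightarrow> f i \<in> I) \<Longrightarrow> sum f A \<in> I"
  by (induction A rule: infinite_finite_induct) (auto intro: idealD)

lemma subring_sum: "is_subring R \<Longrightarrow> (\<And>i. i \<in> A \<Longrightarrow> f i \<in> R) \<Longrightarrow> sum f A \<in> R"
  by (induction A rule: infinite_finite_induct) (auto intro: subringD)

lemma ideal_adjoin:
  assumes R: "is_subring R" and I: "is_ideal R I" and x: "x \<in> R"
  shows "is_ideal R {m + r * x | m r. m \<in> I \<and> r \<in> R}" (is "is_ideal R ?J")
  unfolding is_ideal_def
proof (intro conjI ballI)
  note R = subringD[OF R] and I = idealD[OF I]
  show "?J \<subseteq> R"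
    using x R I by auto
  show "0 \<in> ?J"
    using I(2) R(1) by force
  show "u + w \<in> ?J" if uw: "u \<in> ?J" "w \<in> ?J" for u w
  proof -
    obtain m r where "u = m + r * x" "m \<in> I" "r \<in> R"
      using uw(1) by auto
    moreover obtain m' r' where "w = m' + r' * x" "m' \<in> I" "r' \<in> R"
      using uw(2) by auto
    ultimately have "u + w = (m + m') + (r + r') * x" "m + m' \<in> I" "r + r' \<in> R"
      using I R by (auto simp: algebra_simps)
    then show ?thesis by blast
  qed
  show "t * u \<in> ?J" if tu: "t \<in> R" "u \<in> ?J" for t u
  proof -
    obtain m r where "u = m + r * x" "m \<in> I" "r \<in> R"
      using tu by auto
    then have "t * u = t * m + (t * r) * x" "t * m \<in> I" "t * r \<in> R"
      using I(4) R(4) tu(1) by (simp_all add: distrib_left mult.assoc)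
    then show ?thesis by blast
  qed
qed

lemma ideal_chain_Union:
  assumes "C \<noteq> {}" "subset.chain A C" "\<And>J. J \<in> A \<Longrightarrow> is_ideal R J"
  shows "is_ideal R (\<Union>C)"
proof -
  have ideal: "is_ideal R J" if "J \<in> C" for J
    using assms that by (auto simp: subset.chain_def)
  have "x + y \<in> \<Union>C" if "x \<in> J" "y \<in> J'" "J \<in> C" "J' \<in> C" for x y J J'
  proof -
    have "J \<subseteq> J' \<or> J' \<subseteq> J"
      using assms(2) that by (auto simp: subset.chain_def)
    then show ?thesis
      using that ideal idealD(3) by (metis UnionI subsetD)
  qed
  moreover have "r * x \<in> \<Union>C" if "r \<in> R" "x \<in> J" "J \<in> C" for r x J
    using idealD(4)[OF ideal] that by blast
  moreover have "\<Union>C \<subseteq> R" "0 \<in> \<Union>C"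
    using ideal idealD(1,2) assms(1) by blast+
  ultimately show ?thesis
    unfolding is_ideal_def by blast
qed

text \<open>Krull's argument: an ideal maximal among those avoiding a multiplicative set is prime.
  It is applied with the complement of a prime of the smaller ring, to get lying over, and with
  \<open>{1}\<close>, to put a proper ideal inside a prime.\<close>

lemma ex_prime_ideal_disjoint:
  assumes R: "is_subring R" and I: "is_ideal R I"
    and S: "1 \<in> S" "\<And>x y. x \<in> S \<Longrightarrow> y \<in> S \<Longrightarrow> x * y \<in> S" and disj: "I \<inter> S = {}"
  obtains P where "is_prime_ideal R P" "I \<subseteq> P" "P \<inter> S = {}"
proof -
  define A where "A = {J. is_ideal R J \<and> I \<subseteq> J \<and> J \<inter> S = {}}"
  have "A \<noteq> {}"
    using I disj by (auto simp: A_def)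
  moreover have "\<Union>C \<in> A" if "C \<noteq> {}" "subset.chain A C" for C
  proof -
    have "is_ideal R (\<Union>C)"
      using that by (rule ideal_chain_Union) (auto simp: A_def)
    moreover have "C \<subseteq> A"
      using that(2) by (auto simp: subset.chain_def)
    ultimately show ?thesis
      using that(1) by (auto simp: A_def)
  qed
  ultimately obtain M where M: "M \<in> A" and max: "\<And>X. X \<in> A \<Longrightarrow> M \<subseteq> X \<Longrightarrow> X = M"
    using subset_Zorn_nonempty[of A] by metis
  have M': "is_ideal R M" "I \<subseteq> M" "M \<inter> S = {}"
    using M by (auto simp: A_def)
  note MD = idealD[OF M'(1)] and RD = subringD[OF R]
  \<comment> \<open>By maximality, enlarging \<open>M\<close> by any outside element must hit
    \<open>S\<close>. If x and y were both outside, the product of the two hits would be in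
    \<open>S\<close>, and in \<open>M\<close> as soon as \<open>x * y\<close> is.\<close>
  have meets: "\<exists>m r. m \<in> M \<and> r \<in> R \<and> m + r * x \<in> S" if "x \<in> R" "x \<notin> M" for x
  proof (rule ccontr)
    assume neg: "\<not> ?thesis"
    define J where "J = {m + r * x | m r. m \<in> M \<and> r \<in> R}"
    have "is_ideal R J"
      unfolding J_def by (rule ideal_adjoin[OF R M'(1) that(1)])
    moreover have sub: "M \<subseteq> J"
      unfolding J_def using RD(1) by force
    ultimately have "J \<in> A"
      using neg M'(2) by (auto simp: A_def J_def)
    then have "J = M"
      using max sub by blast
    moreover have "0 + 1 * x \<in> J"
      unfolding J_def using RD(2) MD(2) by blast
    ultimately show False
      using that(2) by simp
  qed
  have "x \<in> M \<or> y \<in> M" if xy: "x \<in> R" "y \<in> R" "x * y \<in> M" for x y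
  proof (rule ccontr)
    assume neg: "\<not> ?thesis"
    obtain m r where 1: "m \<in> M" "r \<in> R" "m + r * x \<in> S"
      using meets[of x] neg xy by blast
    obtain m' r' where 2: "m' \<in> M" "r' \<in> R" "m' + r' * y \<in> S"
      using meets[of y] neg xy by blast
    note * = 1 2
    have A: "m' + r' * y \<in> R" and B: "r * x \<in> R" and C: "r * r' \<in> R"
      using * xy by (simp_all add: RD(3,4) MD(1))
    have "(m + r * x) * (m' + r' * y) = (m' + r' * y) * m + (r * x) * m' + (r * r') * (x * y)"
      by (simp add: algebra_simps)
    also have "\<dots> \<in> M"
      using MD(4)[OF A *(1)] MD(4)[OF B *(4)] MD(4)[OF C xy(3)] by (intro MD(3))
    finally show False
      using S(2)[OF *(3,6)] M'(3) by blast
  qed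
  then have "is_prime_ideal R M"
    unfolding is_prime_ideal_def using M' S(1) by blast
  then show thesis
    using that M' by blast
qed

lemma ring_of_integers_subring:
  assumes "is_subfield K"
  shows "is_subring (ring_of_integers K)"
proof -
  have "algebraic_int (1 :: complex)"
    by (rule int_imp_algebraic_int) auto
  then show ?thesis
    unfolding is_subring_def ring_of_integers_def
    using subfieldD[OF assms] by (auto intro: algebraic_int_add_mult)
qed

lemma of_int_in_ring_of_integers: "is_subfield K \<Longrightarrow> of_int k \<in> ring_of_integers K"
  unfolding ring_of_integers_def by (auto intro: subfield_of_int int_imp_algebraic_int)

lemma algebraic_int_sqrt_of_power2:
  assumes "algebraic_int ((x :: complex)\<^sup>2)" shows "algebraic_int x"
proof -
  have "x = csqrt (x\<^sup>2) \<or> x = - csqrt (x\<^sup>2)"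
    by (metis power2_csqrt power2_eq_iff)
  then show ?thesis
    using algebraic_int_csqrt[OF assms] algebraic_int_minus by metis
qed

section \<open>Totally positive elements\<close>

lemma tposD:
  assumes "totally_positive F x"
  shows "x \<in> F" "x \<noteq> 0" "\<And>\<tau>. field_embedding F \<tau> \<Longrightarrow> \<tau> ` F \<subseteq> \<real> \<Longrightarrow> Re (\<tau> x) > 0"
  using assms by (auto simp: totally_positive_def)

lemma embedding_real_mult:
  assumes "is_subfield F" "field_embedding F \<tau>" "\<tau> ` F \<subseteq> \<real>" "x \<in> F" "y \<in> F"
  shows "Re (\<tau> (x * y)) = Re (\<tau> x) * Re (\<tau> y)"
proof -
  have "\<tau> x \<in> \<real>" "\<tau> y \<in> \<real>"
    using assms(3-5) by auto
  then have "Im (\<tau> x) = 0" "Im (\<tau> y) = 0"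
    by (auto simp: complex_is_Real_iff)
  then show ?thesis
    using embeddingD(4)[OF assms(1,2,4,5)] by simp
qed

lemma totally_positive_mult:
  assumes "is_subfield F" "totally_positive F x" "totally_positive F y"
  shows "totally_positive F (x * y)"
proof -
  note x = tposD[OF assms(2)] and y = tposD[OF assms(3)]
  have "Re (\<tau> (x * y)) > 0" if "field_embedding F \<tau>" "\<tau> ` F \<subseteq> \<real>" for \<tau>
    using x(3)[OF that] y(3)[OF that] embedding_real_mult[OF assms(1) that x(1) y(1)] by simp
  then show ?thesis
    unfolding totally_positive_def using x(1,2) y(1,2) subfieldD(5)[OF assms(1)] by simp
qed

text \<open>A real embedding must exist: without one, total positivity means no more than being
  nonzero, which sums do not preserve. Here the inclusion is that embedding and keeps
  \<open>x + y\<close> from vanishing.\<close>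

lemma totally_positive_add:
  assumes "is_subfield F" "field_embedding F id" "id ` F \<subseteq> \<real>"
    "totally_positive F x" "totally_positive F y"
  shows "totally_positive F (x + y)"
proof -
  note x = tposD[OF assms(4)] and y = tposD[OF assms(5)]
  have "Re (\<tau> (x + y)) > 0" if "field_embedding F \<tau>" "\<tau> ` F \<subseteq> \<real>" for \<tau>
    using x(3)[OF that] y(3)[OF that] embeddingD(3)[OF assms(1) that(1) x(1) y(1)] by simp
  moreover from this[OF assms(2,3)] have "x + y \<noteq> 0"
    by (auto simp: complex_eq_iff)
  ultimately show ?thesis
    unfolding totally_positive_def using subfieldD(3)[OF assms(1) x(1) y(1)] by simp
qed

lemma totally_positive_1: "is_subfield F \<Longrightarrow> totally_positive F 1"
  unfolding totally_positive_def using embeddingD(2) subfieldD(2) by fastforce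

lemma totally_positive_inverse:
  assumes "is_subfield F" "totally_positive F x"
  shows "totally_positive F (inverse x)"
proof -
  note x = tposD[OF assms(2)]
  have "Re (\<tau> (inverse x)) > 0" if "field_embedding F \<tau>" "\<tau> ` F \<subseteq> \<real>" for \<tau>
  proof -
    have "Re (\<tau> x) * Re (\<tau> (inverse x)) = 1"
      using embedding_real_mult[OF assms(1) that x(1) subfieldD(7)[OF assms(1) x(1)]] x(2)
        embeddingD(2)[OF assms(1) that(1)] by simp
    then have "0 < Re (\<tau> x) * Re (\<tau> (inverse x))"
      by simp
    then show ?thesis
      using x(3)[OF that] by (rule zero_less_mult_pos)
  qed
  then show ?thesis
    unfolding totally_positive_def using x(2) subfieldD(7)[OF assms(1) x(1)] by simp
qed

lemma totally_positive_divide: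
  "is_subfield F \<Longrightarrow> totally_positive F x \<Longrightarrow> totally_positive F y \<Longrightarrow> totally_positive F (x / y)"
  unfolding divide_inverse by (intro totally_positive_mult totally_positive_inverse)

lemma totally_positive_mono:
  assumes "totally_positive F x" "F \<subseteq> F'"
  shows "totally_positive F' x"
proof -
  have "field_embedding F \<tau>" "\<tau> ` F \<subseteq> \<real>" if "field_embedding F' \<tau>" "\<tau> ` F' \<subseteq> \<real>" for \<tau>
    using that assms(2) unfolding field_embedding_def by blast+
  then show ?thesis
    using assms unfolding totally_positive_def by blast
qed

text \<open>For nonzero \<open>\<alpha>\<close> this says that \<open>\<alpha>\<close> generates the square of a fractional ideal, namely of
  the module of all \<open>x\<close> with \<open>x\<^sup>2 / \<alpha>\<close> integral.\<close>

definition locally_square :: "complex set \<Rightarrow> complex \<Rightarrow> bool" where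
  "locally_square K \<alpha> \<longleftrightarrow> (\<forall>P. is_prime_ideal (ring_of_integers K) P \<longrightarrow>
     (\<exists>x\<in>K. x\<^sup>2 / \<alpha> \<in> ring_of_integers K - P))"

section \<open>Arithmetic of the root module of \<alpha>\<close>

text \<open>The square of \<open>x * y / \<alpha>\<close> is a product of two integers. This makes
  the cross terms in \<open>(x + y)\<^sup>2 / \<alpha>\<close> integral, so the elements with
  integral \<open>x\<^sup>2 / \<alpha>\<close> are closed under addition.\<close>

lemma algebraic_int_mult_over:
  assumes "algebraic_int (x\<^sup>2 / \<alpha> :: complex)" "algebraic_int (y\<^sup>2 / \<alpha>)"
  shows "algebraic_int (x * y / \<alpha>)"
proof -
  have "(x * y / \<alpha>)\<^sup>2 = (x\<^sup>2 / \<alpha>) * (y\<^sup>2 / \<alpha>)"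
    by (simp add: power2_eq_square)
  then show ?thesis
    using algebraic_int_add_mult(2)[OF assms] by (metis algebraic_int_sqrt_of_power2)
qed

lemma power2_add_over: "(x + y)\<^sup>2 / \<alpha> = x\<^sup>2 / \<alpha> + (x * y / \<alpha> + x * y / \<alpha>) + y\<^sup>2 / (\<alpha> :: complex)"
  by (simp add: power2_sum add_divide_distrib)

lemma algebraic_int_add_over:
  assumes "algebraic_int (x\<^sup>2 / \<alpha> :: complex)" "algebraic_int (y\<^sup>2 / \<alpha>)"
  shows "algebraic_int ((x + y)\<^sup>2 / \<alpha>)"
  unfolding power2_add_over
  using assms algebraic_int_mult_over[OF assms] by (intro algebraic_int_add_mult)

text \<open>The same squaring trick modulo P, using that P contains an integer once it contains its
  square. It follows that the x with \<open>x\<^sup>2 / \<alpha>\<close> in P form a submodule of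
  the root module, so group arguments apply to them.\<close>

lemma prime_ideal_mult_over:
  assumes "is_subfield K" "is_prime_ideal (ring_of_integers K) P" "x \<in> K" "y \<in> K" "\<alpha> \<in> K"
    "x\<^sup>2 / \<alpha> \<in> P" "y\<^sup>2 / \<alpha> \<in> ring_of_integers K"
  shows "x * y / \<alpha> \<in> P"
proof -
  note P = prime_idealD[OF assms(2)]
  have x: "algebraic_int (x\<^sup>2 / \<alpha>)" and y: "algebraic_int (y\<^sup>2 / \<alpha>)"
    using idealD(1)[OF P(1)] assms(6,7) by (auto simp: ring_of_integers_def)
  have "x * y / \<alpha> \<in> ring_of_integers K"
    using algebraic_int_mult_over[OF x y] assms subfieldD by (auto simp: ring_of_integers_def)
  moreover have "(x * y / \<alpha>)\<^sup>2 = (y\<^sup>2 / \<alpha>) * (x\<^sup>2 / \<alpha>)"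
    by (simp add: power2_eq_square)
  then have "(x * y / \<alpha>)\<^sup>2 \<in> P"
    using idealD(4)[OF P(1) assms(7,6)] by simp
  ultimately show ?thesis
    using P(4) by blast
qed

lemma prime_ideal_add_over:
  assumes "is_subfield K" "is_prime_ideal (ring_of_integers K) P" "x \<in> K" "y \<in> K" "\<alpha> \<in> K"
    "x\<^sup>2 / \<alpha> \<in> P" "y\<^sup>2 / \<alpha> \<in> P"
  shows "(x + y)\<^sup>2 / \<alpha> \<in> P"
proof -
  note I = idealD[OF prime_idealD(1)[OF assms(2)]]
  have "x * y / \<alpha> \<in> P"
    using prime_ideal_mult_over[OF assms(1-6)] I(1)[OF assms(7)] by blast
  then show ?thesis
    unfolding power2_add_over using assms(6,7) by (intro I(3))
qed

lemma prime_ideal_scale_over: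
  assumes "is_subfield K" "is_prime_ideal (ring_of_integers K) P"
    "x\<^sup>2 / \<alpha> \<in> P" "r \<in> ring_of_integers K"
  shows "(r * x)\<^sup>2 / \<alpha> \<in> P"
proof -
  note I = idealD[OF prime_idealD(1)[OF assms(2)]]
  have "r\<^sup>2 * (x\<^sup>2 / \<alpha>) \<in> P"
    using subringD(4)[OF ring_of_integers_subring[OF assms(1)] assms(4,4)] assms(3)
    by (intro I(4)) (auto simp: power2_eq_square)
  then show ?thesis
    by (simp add: power_mult_distrib)
qed

lemma locally_square_mult:
  assumes K: "is_subfield K" and \<alpha>: "locally_square K \<alpha>" and \<beta>: "locally_square K \<beta>"
  shows "locally_square K (\<alpha> * \<beta>)"
  unfolding locally_square_def
proof (intro allI impI)
  fix P assume P: "is_prime_ideal (ring_of_integers K) P"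
  obtain x y where xy: "x \<in> K" "y \<in> K" "x\<^sup>2 / \<alpha> \<in> ring_of_integers K - P" "y\<^sup>2 / \<beta> \<in> ring_of_integers K - P"
    using \<alpha> \<beta> P unfolding locally_square_def by blast
  have "(x\<^sup>2 / \<alpha>) * (y\<^sup>2 / \<beta>) \<in> ring_of_integers K - P"
    using xy(3,4) subringD(4)[OF ring_of_integers_subring[OF K]] prime_idealD(3)[OF P] by blast
  then have "(x * y)\<^sup>2 / (\<alpha> * \<beta>) \<in> ring_of_integers K - P"
    by (simp add: power_mult_distrib)
  then show "\<exists>x\<in>K. x\<^sup>2 / (\<alpha> * \<beta>) \<in> ring_of_integers K - P"
    using subfieldD(5)[OF K xy(1,2)] by blast
qed

lemma locally_square_power2:
  assumes K: "is_subfield K" and \<gamma>: "\<gamma> \<in> K" "\<gamma> \<noteq> 0"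
  shows "locally_square K (\<gamma>\<^sup>2)"
  unfolding locally_square_def
proof (intro allI impI bexI[OF _ \<gamma>(1)])
  fix P assume "is_prime_ideal (ring_of_integers K) P"
  then show "\<gamma>\<^sup>2 / \<gamma>\<^sup>2 \<in> ring_of_integers K - P"
    using \<gamma> prime_idealD(2) subringD(2)[OF ring_of_integers_subring[OF K]] by auto
qed

lemma embedding_id: "field_embedding F id"
  by (simp add: field_embedding_def)

text \<open>Prime avoidance for two ideals; a group is not the union of two proper subgroups, so
  primality plays no part yet.\<close>

lemma ideal_subset_union:
  assumes "is_ideal R A" "is_ideal R B" "is_ideal R Q" "is_subring R" "Q \<subseteq> A \<union> B"
  shows "Q \<subseteq> A \<or> Q \<subseteq> B"
proof (rule ccontr)
  assume "\<not> ?thesis"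
  then obtain x y where xy: "x \<in> Q" "x \<notin> A" "y \<in> Q" "y \<notin> B"
    by blast
  then have "x \<in> B" "y \<in> A" "x + y \<in> A \<union> B"
    using assms idealD(3)[OF assms(3)] by blast+
  moreover have "- 1 \<in> R"
    using assms(4) subringD by blast
  then have "- x \<in> B" "- y \<in> A"
    using idealD(4)[OF assms(2), of "-1" x] idealD(4)[OF assms(1), of "-1" y] calculation by auto
  ultimately show False
    using idealD(3)[OF assms(1), of "x + y" "- y"] idealD(3)[OF assms(2), of "x + y" "- x"] xy by auto
qed

section \<open>Quadratic extensions\<close>

definition quadratic_adjoin :: "complex set \<Rightarrow> complex \<Rightarrow> complex set" where
  "quadratic_adjoin K s = {x + y * s | x y. x \<in> K \<and> y \<in> K}"

text \<open>The extension of \<tau> to the quadratic extension that sends s to t. The coordinates of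
  z are picked by choice; they are unique once s lies outside K. With the identity and
  \<open>- s\<close> this is conjugation over K.\<close>

definition extend_embedding ::
    "complex set \<Rightarrow> complex \<Rightarrow> (complex \<Rightarrow> complex) \<Rightarrow> complex \<Rightarrow> complex \<Rightarrow> complex" where
  "extend_embedding K s \<tau> t z =
     (let p = (SOME p. fst p \<in> K \<and> snd p \<in> K \<and> z = fst p + snd p * s) in \<tau> (fst p) + \<tau> (snd p) * t)"

locale quadratic_extension =
  fixes K :: "complex set" and s :: complex and a :: int
  assumes subfield: "is_subfield K" and notin: "s \<notin> K" and square: "s\<^sup>2 = of_int a"
begin

abbreviation "L \<equiv> quadratic_adjoin K s"
abbreviation "OK \<equiv> ring_of_integers K"
abbreviation "OL \<equiv> ring_of_integers L"
abbreviation "cj \<equiv> extend_embedding K s id (- s)"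

lemmas K_closed = subfieldD[OF subfield] subfield_of_int[OF subfield]

lemma L_E:
  assumes "z \<in> L" obtains x y where "z = x + y * s" "x \<in> K" "y \<in> K"
  using assms by (auto simp: quadratic_adjoin_def)

lemma L_I: "x \<in> K \<Longrightarrow> y \<in> K \<Longrightarrow> x + y * s \<in> L"
  by (auto simp: quadratic_adjoin_def)

lemma s_in_L: "s \<in> L"
  using L_I[OF K_closed(1,2)] by simp

lemma K_sub_L: "K \<subseteq> L"
proof
  fix x assume "x \<in> K" then show "x \<in> L" using L_I[of x 0] K_closed(1) by simp
qed

lemma coords_unique:
  assumes "x + y * s = x' + y' * s" "x \<in> K" "y \<in> K" "x' \<in> K" "y' \<in> K"
  shows "x = x'" "y = y'"
proof -
  show "y = y'"
  proof (rule ccontr)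
    assume "y \<noteq> y'"
    then have "s = (x - x') / (y' - y)"
      using assms(1) by (simp add: field_simps)
    moreover have "(x - x') / (y' - y) \<in> K"
      using assms(2-5) by (intro K_closed)
    ultimately show False
      using notin by simp
  qed
  then show "x = x'"
    using assms(1) by simp
qed

lemma extend_eq:
  assumes "x \<in> K" "y \<in> K"
  shows "extend_embedding K s \<tau> t (x + y * s) = \<tau> x + \<tau> y * t"
proof -
  define p where "p = (SOME p. fst p \<in> K \<and> snd p \<in> K \<and> x + y * s = fst p + snd p * s)"
  have "fst p \<in> K \<and> snd p \<in> K \<and> x + y * s = fst p + snd p * s"
    unfolding p_def by (rule someI[of _ "(x, y)"]) (use assms in auto)
  then have "fst p = x" "snd p = y"
    using coords_unique assms by metis+
  then show ?thesis
    by (simp add: extend_embedding_def p_def[symmetric])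
qed

lemma extend_on_K:
  assumes "x \<in> K" "\<tau> 0 = 0" shows "extend_embedding K s \<tau> t x = \<tau> x"
  using extend_eq[of x 0 \<tau> t] assms K_closed(1) by simp

lemma extend_s: "\<tau> 0 = 0 \<Longrightarrow> \<tau> 1 = 1 \<Longrightarrow> extend_embedding K s \<tau> t s = t"
  using extend_eq[of 0 1 \<tau> t] K_closed by simp

lemma mult_coords: "(x + y * s) * (x' + y' * s) = (x * x' + of_int a * (y * y')) + (x * y' + y * x') * s"
  using square by (simp add: algebra_simps power2_eq_square)

lemma subfield_L: "is_subfield L"
proof -
  have add: "u + w \<in> L" "u - w \<in> L" "u * w \<in> L" if uw: "u \<in> L" "w \<in> L" for u w
  proof -
    obtain x y where u: "u = x + y * s" "x \<in> K" "y \<in> K"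
      using uw(1) by (rule L_E)
    obtain x' y' where w: "w = x' + y' * s" "x' \<in> K" "y' \<in> K"
      using uw(2) by (rule L_E)
    note * = u(1) w(1) u(2,3) w(2,3)
    have "u + w = (x + x') + (y + y') * s" "u - w = (x - x') + (y - y') * s"
      using * by (auto simp: algebra_simps)
    then show "u + w \<in> L" "u - w \<in> L"
      using *(3-) by (auto intro!: L_I K_closed(3,4))
    show "u * w \<in> L"
      unfolding * mult_coords using * K_closed by (intro L_I) auto
  qed
  have "inverse u \<in> L" if u: "u \<in> L" "u \<noteq> 0" for u
  proof -
    obtain x y where *: "u = x + y * s" "x \<in> K" "y \<in> K"
      using u(1) by (rule L_E)
    define n where "n = x\<^sup>2 - of_int a * y\<^sup>2"
    have n: "n = u * (x - y * s)" "n \<in> K"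
      unfolding n_def square[symmetric] *(1)
      using *(2,3) by (simp add: algebra_simps power2_eq_square, simp add: square K_closed)
    have "x - y * s \<noteq> 0"
    proof
      assume "x - y * s = 0"
      then have "x + 0 * s = 0 + y * s" by simp
      from coords_unique[OF this] * K_closed(1) have "x = 0" "y = 0" by auto
      then show False using * u(2) by simp
    qed
    then have "n \<noteq> 0"
      using n(1) u(2) by simp
    then have "inverse u = x / n + (- y / n) * s"
      using n(1) u(2) by (simp add: divide_simps)
    then show ?thesis
      using * n(2) K_closed by (simp only:) (intro L_I; auto)
  qed
  then show ?thesis
    unfolding is_subfield_def using add subsetD[OF K_sub_L] K_closed(1,2) by simp
qed

lemmas L_closed = subfieldD[OF subfield_L] subfield_of_int[OF subfield_L]

lemma embedding_extend:
  assumes "field_embedding K \<tau>" "t\<^sup>2 = of_int a"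
  shows "field_embedding L (extend_embedding K s \<tau> t)" (is "field_embedding L ?e")
proof -
  note \<tau> = embeddingD[OF subfield assms(1)] embedding_of_int[OF subfield assms(1)]
  have "?e (u + w) = ?e u + ?e w \<and> ?e (u * w) = ?e u * ?e w" if uw: "u \<in> L" "w \<in> L" for u w
  proof -
    obtain x y where u: "u = x + y * s" "x \<in> K" "y \<in> K"
      using uw(1) by (rule L_E)
    obtain x' y' where w: "w = x' + y' * s" "x' \<in> K" "y' \<in> K"
      using uw(2) by (rule L_E)
    note * = u(1) w(1) u(2,3) w(2,3)
    have e: "?e u = \<tau> x + \<tau> y * t" "?e w = \<tau> x' + \<tau> y' * t"
      unfolding * using * by (auto intro: extend_eq)
    have "u + w = (x + x') + (y + y') * s"
      using * by (auto simp: algebra_simps)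
    then have "?e (u + w) = \<tau> (x + x') + \<tau> (y + y') * t"
      using * K_closed by (simp only:) (intro extend_eq; auto)
    also have "\<dots> = ?e u + ?e w"
      unfolding e using * by (simp add: \<tau> algebra_simps)
    finally have 1: "?e (u + w) = ?e u + ?e w" .
    have "?e (u * w) = \<tau> (x * x' + of_int a * (y * y')) + \<tau> (x * y' + y * x') * t"
      unfolding * mult_coords using * K_closed by (intro extend_eq) auto
    also have "\<dots> = (\<tau> x * \<tau> x' + of_int a * (\<tau> y * \<tau> y')) + (\<tau> x * \<tau> y' + \<tau> y * \<tau> x') * t"
      using *(3-) by (simp add: \<tau> K_closed)
    also have "\<dots> = ?e u * ?e w"
      unfolding e assms(2)[symmetric] by (simp add: algebra_simps power2_eq_square)
    finally show ?thesis using 1 by blast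
  qed
  moreover have "?e 1 = 1"
    using extend_on_K[OF K_closed(2)] \<tau>(1,2) by simp
  ultimately show ?thesis
    unfolding field_embedding_def by blast
qed

lemma embedding_cj: "field_embedding L cj"
  using embedding_extend[OF embedding_id, of "- s"] square by simp

lemmas cj_simps = embeddingD[OF subfield_L embedding_cj] embedding_of_int[OF subfield_L embedding_cj]

lemma cj_eq: "x \<in> K \<Longrightarrow> y \<in> K \<Longrightarrow> cj (x + y * s) = x - y * s"
  by (simp add: extend_eq)

lemma cj_K: "x \<in> K \<Longrightarrow> cj x = x"
  by (simp add: extend_on_K)

lemma cj_s: "cj s = - s"
  by (simp add: extend_s)

lemma cj_L: "z \<in> L \<Longrightarrow> cj z \<in> L"
  using L_I[of _ "- _"] K_closed(6) by (elim L_E) (simp add: cj_eq)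

lemma cj_cj: "z \<in> L \<Longrightarrow> cj (cj z) = z"
  using cj_eq[of _ "- _"] K_closed(6) by (elim L_E) (simp add: cj_eq)

lemma trace_in_K: "z \<in> L \<Longrightarrow> z + cj z \<in> K"
  by (elim L_E) (simp add: cj_eq K_closed subfield_numeral[OF subfield])

lemma norm_in_K: "z \<in> L \<Longrightarrow> z * cj z \<in> K"
  using mult_coords[of _ _ _ "- _"] K_closed by (elim L_E) (simp add: cj_eq)

lemma cj_OL: "z \<in> OL \<Longrightarrow> cj z \<in> OL"
  unfolding ring_of_integers_def
  using cj_L embedding_algebraic_int[OF subfield_L embedding_cj] by blast

lemma OK_sub_OL: "OK \<subseteq> OL"
  using K_sub_L by (auto simp: ring_of_integers_def)

lemma OL_in_K: "z \<in> OL \<Longrightarrow> z \<in> K \<Longrightarrow> z \<in> OK"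
  by (simp add: ring_of_integers_def)

lemmas OK_subring = ring_of_integers_subring[OF subfield]
lemmas OL_subring = ring_of_integers_subring[OF subfield_L]

lemma OL_L: "z \<in> OL \<Longrightarrow> z \<in> L"
  by (simp add: ring_of_integers_def)

lemma norm_in_OK: "z \<in> OL \<Longrightarrow> z * cj z \<in> OK"
  using norm_in_K OL_L cj_OL subringD(4)[OF OL_subring] by (intro OL_in_K) auto

lemma trace_in_OK: "z \<in> OL \<Longrightarrow> z + cj z \<in> OK"
  using trace_in_K OL_L cj_OL subringD(3)[OF OL_subring] by (intro OL_in_K) auto

lemma totally_positive_cj:
  assumes "totally_positive L x" shows "totally_positive L (cj x)"
proof -
  note x = tposD[OF assms]
  have "Re (\<tau> (cj x)) > 0" if \<tau>: "field_embedding L \<tau>" "\<tau> ` L \<subseteq> \<real>" for \<tau>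
  proof -
    have "field_embedding L (\<tau> \<circ> cj)"
      using \<tau>(1) embedding_cj cj_L unfolding field_embedding_def by simp
    moreover have "(\<tau> \<circ> cj) ` L \<subseteq> \<real>"
      using \<tau>(2) cj_L by auto
    ultimately show ?thesis
      using x(3) by fastforce
  qed
  then show ?thesis
    unfolding totally_positive_def using cj_L x(1,2) cj_simps(10) by auto
qed

text \<open>As a is positive it has a real square root, so every real embedding of K extends to a
  real embedding of L, where positivity is known.\<close>

lemma totally_positive_restrict:
  assumes "a > 0" "x \<in> K" "totally_positive L x" shows "totally_positive K x"
proof -
  have "Re (\<tau> x) > 0" if \<tau>: "field_embedding K \<tau>" "\<tau> ` K \<subseteq> \<real>" for \<tau>
  proof -
    define t where "t = complex_of_real (sqrt (of_int a))"
    have "t\<^sup>2 = of_int a"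
      using assms(1) by (simp add: t_def flip: of_real_power)
    then have "field_embedding L (extend_embedding K s \<tau> t)"
      by (rule embedding_extend[OF \<tau>(1)])
    moreover have "extend_embedding K s \<tau> t z \<in> \<real>" if "z \<in> L" for z
    proof -
      obtain u w where "z = u + w * s" "u \<in> K" "w \<in> K"
        using \<open>z \<in> L\<close> by (rule L_E)
      then show ?thesis
        using \<tau>(2) by (auto simp: extend_eq t_def intro!: Reals_add Reals_mult)
    qed
    ultimately have "Re (extend_embedding K s \<tau> t x) > 0"
      using tposD(3)[OF assms(3)] by blast
    then show ?thesis
      using extend_on_K[OF assms(2)] embeddingD(1)[OF subfield \<tau>(1)] by simp
  qed
  then show ?thesis
    using assms tposD(2) unfolding totally_positive_def by blast
qed

lemma totally_positive_norm:
  assumes "a > 0" "totally_positive L x" shows "totally_positive K (x * cj x)"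
  using assms
  by (intro totally_positive_restrict norm_in_K totally_positive_mult subfield_L totally_positive_cj)
    (auto dest: tposD(1))

section \<open>Primes in a quadratic extension\<close>

text \<open>The ideal J collects the z that satisfy \<open>z\<^sup>2 - tr z * z + N z = 0\<close>
  with norm in p and with traces of all multiples in p. The trace condition absorbs the cross term
  in the norm of a sum, which makes J additive. On K the norm is the square, so J meets
  \<open>OK\<close> in p alone, and a prime containing J and avoiding the rest of \<open>OK\<close>
  lies over p.\<close>

lemma prime_lying_over:
  assumes "is_prime_ideal OK p"
  obtains P where "is_prime_ideal OL P" "P \<inter> K = p"
proof -
  note p = prime_idealD[OF assms] and pI = idealD[OF prime_idealD(1)[OF assms]]
  note OL = subringD[OF OL_subring] and OK = subringD[OF OK_subring]
  define J where "J = {z \<in> OL. z * cj z \<in> p \<and> (\<forall>r\<in>OL. z * r + cj (z * r) \<in> p)}"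
  have J: "is_ideal OL J"
    unfolding is_ideal_def
  proof (intro conjI ballI)
    show "J \<subseteq> OL" by (auto simp: J_def)
    show "0 \<in> J"
      using OL(1) pI(2) cj_simps(1) by (simp add: J_def)
  next
    fix x y assume xy: "x \<in> J" "y \<in> J"
    have xO: "x \<in> OL" "y \<in> OL"
      using xy unfolding J_def by simp_all
    note mem = xO cj_OL[OF xO(2)] OL_L[OF xO(1)] OL_L[OF xO(2)] cj_L[OF OL_L[OF xO(2)]]
    have "(x + y) * cj (x + y) = x * cj x + y * cj y + (x * cj y + cj (x * cj y))"
      using mem(4-6) by (simp add: cj_simps cj_cj ring_distribs)
    moreover have "x * cj x \<in> p" "y * cj y \<in> p" "x * cj y + cj (x * cj y) \<in> p"
      using xy mem(3) unfolding J_def by blast+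
    ultimately have "(x + y) * cj (x + y) \<in> p"
      by (simp only: pI(3))
    moreover have "(x + y) * r + cj ((x + y) * r) \<in> p" if "r \<in> OL" for r
    proof -
      have "(x + y) * r + cj ((x + y) * r) = (x * r + cj (x * r)) + (y * r + cj (y * r))"
        using mem(4,5) OL_L[OF that] by (simp add: cj_simps L_closed(3,5) ring_distribs)
      moreover have "x * r + cj (x * r) \<in> p" "y * r + cj (y * r) \<in> p"
        using xy that unfolding J_def by blast+
      ultimately show ?thesis
        by (simp only: pI(3))
    qed
    ultimately show "x + y \<in> J"
      using OL(3)[OF mem(1,2)] unfolding J_def by blast
  next
    fix r x assume rx: "r \<in> OL" "x \<in> J"
    have xO: "x \<in> OL"
      using rx(2) unfolding J_def by simp
    note mem = xO OL_L[OF xO] OL_L[OF rx(1)]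
    have "(r * x) * cj (r * x) = (r * cj r) * (x * cj x)"
      using mem(2,3) by (simp add: cj_simps mult_ac)
    moreover have "(r * cj r) * (x * cj x) \<in> p"
      using rx pI(4)[OF norm_in_OK] unfolding J_def by blast
    ultimately have "(r * x) * cj (r * x) \<in> p"
      by (simp only:)
    moreover have "(r * x) * t + cj ((r * x) * t) \<in> p" if "t \<in> OL" for t
    proof -
      have "(r * x) * t = x * (r * t)"
        by (simp add: algebra_simps)
      moreover have "x * (r * t) + cj (x * (r * t)) \<in> p"
        using rx(2) OL(4)[OF rx(1) that] unfolding J_def by blast
      ultimately show ?thesis
        by (simp only:)
    qed
    ultimately show "r * x \<in> J"
      using OL(4)[OF rx(1) mem(1)] unfolding J_def by blast
  qed
  have S1: "1 \<in> OK - p"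
    using OK(2) p(2) by simp
  have S2: "x * y \<in> OK - p" if "x \<in> OK - p" "y \<in> OK - p" for x y
    using that OK(4)[of x y] p(3)[of x y] by auto
  have S3: "J \<inter> (OK - p) = {}"
  proof -
    have "x \<in> p" if "x \<in> J" "x \<in> OK" for x
    proof -
      have "x * cj x \<in> p" "x \<in> K"
        using that unfolding J_def ring_of_integers_def by simp_all
      then show ?thesis
        using p(4)[OF that(2)] cj_K[of x] by (simp add: power2_eq_square)
    qed
    then show ?thesis by blast
  qed
  obtain P where P: "is_prime_ideal OL P" "J \<subseteq> P" "P \<inter> (OK - p) = {}"
    by (rule ex_prime_ideal_disjoint[OF OL_subring J S1 _ S3]) (use S2 in blast)
  have "p \<subseteq> J"
  proof
    fix x assume x: "x \<in> p"
    then have "x \<in> OK"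
      by (rule pI(1))
    then have xO: "x \<in> OK" "x \<in> OL" "x \<in> K" "x \<in> L"
      using K_sub_L unfolding ring_of_integers_def by auto
    have "x * r + cj (x * r) \<in> p" if "r \<in> OL" for r
    proof -
      have "x * r + cj (x * r) = x * (r + cj r)"
        using xO(3,4) OL_L[OF that] by (simp add: cj_simps(4) cj_K distrib_left)
      then show ?thesis
        using pI(5)[OF trace_in_OK[OF that] x] by (simp only:)
    qed
    moreover have "x * cj x \<in> p"
      using pI(4)[OF xO(1) x] cj_K[OF xO(3)] by simp
    ultimately show "x \<in> J"
      using xO(2) unfolding J_def by blast
  qed
  then have "p \<subseteq> P \<inter> K"
    using P(2) idealD(1)[OF p(1)] unfolding ring_of_integers_def by auto
  moreover have "P \<inter> K \<subseteq> p"
  proof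
    fix x assume x: "x \<in> P \<inter> K"
    then have "x \<in> OK"
      using idealD(1)[OF prime_idealD(1)[OF P(1)]] OL_in_K by simp
    then show "x \<in> p"
      using P(3) x by blast
  qed
  ultimately have "p = P \<inter> K"
    by (rule subset_antisym)
  then show thesis
    by (rule that[OF P(1) sym])
qed

lemma prime_contract:
  assumes "is_prime_ideal OL P" shows "is_prime_ideal OK (P \<inter> K)"
proof -
  note P = prime_idealD[OF assms] and PI = idealD[OF prime_idealD(1)[OF assms]]
  have OK: "x \<in> K" "x \<in> OL" if "x \<in> OK" for x
    using that OK_sub_OL by (auto simp: ring_of_integers_def)
  have *: "P \<inter> K \<subseteq> OK" "0 \<in> P \<inter> K" "1 \<notin> P \<inter> K"
    using PI(1,2) OL_in_K P(2) K_closed(1) by auto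
  have "x + y \<in> P \<inter> K" if "x \<in> P \<inter> K" "y \<in> P \<inter> K" for x y
    using that PI(3) K_closed(3) by blast
  moreover have "r * x \<in> P \<inter> K" if "r \<in> OK" "x \<in> P \<inter> K" for r x
    using that PI(4) K_closed(5) OK by blast
  moreover have "x \<in> P \<inter> K \<or> y \<in> P \<inter> K" if "x \<in> OK" "y \<in> OK" "x * y \<in> P \<inter> K" for x y
    using that P(3) OK by blast
  ultimately show ?thesis
    unfolding is_prime_ideal_def is_ideal_def using * by simp
qed

lemma prime_cj:
  assumes "is_prime_ideal OL P" shows "is_prime_ideal OL {z \<in> OL. cj z \<in> P}"
proof -
  note P = prime_idealD[OF assms] and PI = idealD[OF prime_idealD(1)[OF assms]]
  note OL = subringD[OF OL_subring]
  show ?thesis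
    unfolding is_prime_ideal_def is_ideal_def
  proof (intro conjI ballI impI)
    show "1 \<notin> {z \<in> OL. cj z \<in> P}"
      using P(2) by (simp add: cj_simps)
    show "x \<in> {z \<in> OL. cj z \<in> P} \<or> y \<in> {z \<in> OL. cj z \<in> P}"
      if "x \<in> OL" "y \<in> OL" "x * y \<in> {z \<in> OL. cj z \<in> P}" for x y
      using that P(3)[of "cj x" "cj y"] cj_OL OL_L by (auto simp: cj_simps)
  qed (auto simp: cj_simps OL PI OL_L cj_OL)
qed

text \<open>For x in Q the norm lies in the common contraction, hence in P, so x or its conjugate is
  in P. Avoidance turns this choice per element into a choice for all of Q.\<close>

lemma primes_over_subset:
  assumes P: "is_prime_ideal OL P" and Q: "is_prime_ideal OL Q" and eq: "P \<inter> K = Q \<inter> K"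
  shows "Q \<subseteq> P \<or> Q \<subseteq> {z \<in> OL. cj z \<in> P}"
proof (rule ideal_subset_union)
  show "is_ideal OL P" "is_ideal OL Q" "is_ideal OL {z \<in> OL. cj z \<in> P}" "is_subring OL"
    using prime_idealD(1)[OF P] prime_idealD(1)[OF Q] prime_idealD(1)[OF prime_cj[OF P]] OL_subring .
  note PI = prime_idealD[OF P] and QI = idealD[OF prime_idealD(1)[OF Q]]
  show "Q \<subseteq> P \<union> {z \<in> OL. cj z \<in> P}"
  proof
    fix x assume x: "x \<in> Q"
    then have xO: "x \<in> OL" "cj x \<in> OL"
      using QI(1) cj_OL by auto
    have "x * cj x \<in> Q \<inter> K"
      using QI(5)[OF xO(2) x] norm_in_K[OF OL_L[OF xO(1)]] by simp
    then have "x * cj x \<in> P"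
      unfolding eq[symmetric] by simp
    then show "x \<in> P \<union> {z \<in> OL. cj z \<in> P}"
      using PI(3)[OF xO] xO(1) by simp
  qed
qed

text \<open>Equality comes from symmetry instead of incomparability of primes over p: the previous
  lemma is applied in both directions, and as conjugation is a monotone involution on ideals, each
  combination of inclusions closes up to a cycle.\<close>

lemma primes_over:
  assumes P: "is_prime_ideal OL P" and Q: "is_prime_ideal OL Q" and eq: "P \<inter> K = Q \<inter> K"
  shows "Q = P \<or> Q = {z \<in> OL. cj z \<in> P}"
proof -
  define c where "c X = {z \<in> OL. cj z \<in> X}" for X
  have sub: "P \<subseteq> OL" "Q \<subseteq> OL"
    using idealD(1)[OF prime_idealD(1)[OF P]] idealD(1)[OF prime_idealD(1)[OF Q]] by auto
  have cc: "c (c X) = X" if "X \<subseteq> OL" for X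
  proof
    show "c (c X) \<subseteq> X"
      using cj_cj OL_L by (auto simp: c_def)
    show "X \<subseteq> c (c X)"
      using that cj_cj cj_OL OL_L by (auto simp: c_def)
  qed
  have mono: "c X \<subseteq> c Y" if "X \<subseteq> Y" for X Y
    using that by (auto simp: c_def)
  have 1: "Q \<subseteq> P \<or> Q \<subseteq> c P" and 2: "P \<subseteq> Q \<or> P \<subseteq> c Q"
    unfolding c_def using primes_over_subset[OF P Q eq] primes_over_subset[OF Q P eq[symmetric]] .
  have "Q = P \<or> Q = c P"
    using 1
  proof
    assume QP: "Q \<subseteq> P"
    show ?thesis
      using 2
    proof
      assume "P \<subseteq> c Q"
      then have "P \<subseteq> c Q" "c Q \<subseteq> c P" "c P \<subseteq> Q"
        using mono[of P "c Q"] mono[OF QP] cc[OF sub(2)] by simp_all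
      then show ?thesis using QP by blast
    qed (use QP in blast)
  next
    assume QP: "Q \<subseteq> c P"
    show ?thesis
      using 2
    proof
      assume "P \<subseteq> c Q"
      then have "c P \<subseteq> Q"
        using mono[of P "c Q"] cc[OF sub(2)] by simp
      then show ?thesis using QP by blast
    next
      assume PQ: "P \<subseteq> Q"
      then have "c P \<subseteq> c Q" "c Q \<subseteq> P"
        using mono[OF PQ] mono[OF QP] cc[OF sub(1)] by simp_all
      then show ?thesis using QP PQ by blast
    qed
  qed
  then show ?thesis by (simp add: c_def)
qed

text \<open>Each prime of K has at most two primes above it, a chosen one and its conjugate.
  Contraction keeps x because x lies in K.\<close>

lemma card_primes_containing:
  assumes fin: "finite {p. is_prime_ideal OK p \<and> x \<in> p}" and x: "x \<in> K"
  shows "finite {P. is_prime_ideal OL P \<and> x \<in> P}"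
    and "card {P. is_prime_ideal OL P \<and> x \<in> P} \<le> 2 * card {p. is_prime_ideal OK p \<and> x \<in> p}"
proof -
  define A where "A = {p. is_prime_ideal OK p \<and> x \<in> p}"
  define f where "f p = (SOME P. is_prime_ideal OL P \<and> P \<inter> K = p)" for p
  have f: "is_prime_ideal OL (f p) \<and> f p \<inter> K = p" if "p \<in> A" for p
  proof -
    have "is_prime_ideal OK p"
      using \<open>p \<in> A\<close> unfolding A_def by simp
    then obtain P where "is_prime_ideal OL P" "P \<inter> K = p"
      by (rule prime_lying_over)
    then have "\<exists>P. is_prime_ideal OL P \<and> P \<inter> K = p"
      by (intro exI[of _ P] conjI)
    then show ?thesis
      unfolding f_def by (rule someI_ex)
  qed
  define B where "B = f ` A \<union> (\<lambda>p. {z \<in> OL. cj z \<in> f p}) ` A"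
  have sub: "{P. is_prime_ideal OL P \<and> x \<in> P} \<subseteq> B"
  proof
    fix P assume "P \<in> {P. is_prime_ideal OL P \<and> x \<in> P}"
    then have P: "is_prime_ideal OL P" "x \<in> P" by auto
    have PA: "P \<inter> K \<in> A"
      unfolding A_def using prime_contract[OF P(1)] x P(2) by simp
    have "P = f (P \<inter> K) \<or> P = {z \<in> OL. cj z \<in> f (P \<inter> K)}"
      using primes_over[of "f (P \<inter> K)" P] f[OF PA] P(1) by simp
    then show "P \<in> B"
      using PA unfolding B_def by blast
  qed
  have finB: "finite B"
    using fin by (auto simp: B_def A_def)
  then show "finite {P. is_prime_ideal OL P \<and> x \<in> P}"
    using sub finite_subset by blast
  have "card {P. is_prime_ideal OL P \<and> x \<in> P} \<le> card B"
    using sub finB card_mono by blast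
  also have "\<dots> \<le> card (f ` A) + card ((\<lambda>p. {z \<in> OL. cj z \<in> f p}) ` A)"
    unfolding B_def by (rule card_Un_le)
  also have "\<dots> \<le> 2 * card A"
    using card_image_le[of A f] card_image_le[of A "\<lambda>p. {z \<in> OL. cj z \<in> f p}"] fin
    by (simp add: A_def)
  finally show "card {P. is_prime_ideal OL P \<and> x \<in> P} \<le> 2 * card {p. is_prime_ideal OK p \<and> x \<in> p}"
    by (simp add: A_def)
qed

end

section \<open>Bounding V along a quadratic extension\<close>

definition square_cover :: "complex set \<Rightarrow> complex set \<Rightarrow> bool" where
  "square_cover K R \<longleftrightarrow> finite R \<and> (\<forall>\<alpha>. totally_positive K \<alpha> \<and> locally_square K \<alpha> \<longrightarrow>
     (\<exists>r\<in>R. \<exists>\<gamma>. totally_positive K \<gamma> \<and> \<alpha> = r * \<gamma>\<^sup>2))"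

lemma totally_positive_power2: "is_subfield F \<Longrightarrow> totally_positive F x \<Longrightarrow> totally_positive F (x\<^sup>2)"
  by (simp add: power2_eq_square totally_positive_mult)

context quadratic_extension
begin

text \<open>The norm of \<open>z\<^sup>2 / \<alpha>\<close> avoids p exactly when
  \<open>z\<^sup>2 / \<alpha>\<close> avoids both P and its conjugate. Local squareness gives a
  witness for each of the two primes; if neither serves both, their sum does.\<close>

lemma locally_square_norm:
  assumes \<alpha>: "\<alpha> \<in> L" "locally_square L \<alpha>"
  shows "locally_square K (\<alpha> * cj \<alpha>)"
  unfolding locally_square_def
proof (intro allI impI)
  fix p assume p: "is_prime_ideal OK p"
  obtain P where P: "is_prime_ideal OL P" "P \<inter> K = p"
    using prime_lying_over[OF p] by blast
  define P' where "P' = {z \<in> OL. cj z \<in> P}"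
  have P': "is_prime_ideal OL P'"
    unfolding P'_def by (rule prime_cj[OF P(1)])
  obtain x where x: "x \<in> L" "x\<^sup>2 / \<alpha> \<in> OL - P"
    using \<alpha>(2) P(1) unfolding locally_square_def by blast
  obtain y where y: "y \<in> L" "y\<^sup>2 / \<alpha> \<in> OL - P'"
    using \<alpha>(2) P' unfolding locally_square_def by blast
  have mx: "- x \<in> L" "- y \<in> L"
    using x y L_closed(6) by auto
  \<comment> \<open>A group is not the union of two proper subgroups.\<close>
  have "\<exists>z\<in>L. z\<^sup>2 / \<alpha> \<in> OL - P \<and> z\<^sup>2 / \<alpha> \<in> OL - P'"
  proof (cases "x\<^sup>2 / \<alpha> \<in> P' \<and> y\<^sup>2 / \<alpha> \<in> P")
    case False
    then show ?thesis using x y by blast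
  next
    case True
    have z: "x + y \<in> L" "(x + y)\<^sup>2 / \<alpha> \<in> OL"
      using x y \<alpha>(1) algebraic_int_add_over[of x \<alpha> y] L_closed by (auto simp: ring_of_integers_def)
    have "(x + y)\<^sup>2 / \<alpha> \<notin> P"
      using prime_ideal_add_over[OF subfield_L P(1) z(1) mx(2) \<alpha>(1)] True x(2) by auto
    moreover have "(x + y)\<^sup>2 / \<alpha> \<notin> P'"
      using prime_ideal_add_over[OF subfield_L P' z(1) mx(1) \<alpha>(1)] True y(2) by auto
    ultimately show ?thesis
      using z by blast
  qed
  then obtain z where z: "z \<in> L" "z\<^sup>2 / \<alpha> \<in> OL" "z\<^sup>2 / \<alpha> \<notin> P" "z\<^sup>2 / \<alpha> \<notin> P'"
    by blast
  then have "cj (z\<^sup>2 / \<alpha>) \<notin> P" "cj (z\<^sup>2 / \<alpha>) \<in> OL"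
    using cj_OL by (auto simp: P'_def)
  then have "(z\<^sup>2 / \<alpha>) * cj (z\<^sup>2 / \<alpha>) \<notin> P"
    using prime_idealD(3)[OF P(1)] z by blast
  moreover have "(z\<^sup>2 / \<alpha>) * cj (z\<^sup>2 / \<alpha>) \<in> OK"
    using norm_in_OK z(2) by blast
  moreover have "(z\<^sup>2 / \<alpha>) * cj (z\<^sup>2 / \<alpha>) = (z * cj z)\<^sup>2 / (\<alpha> * cj \<alpha>)"
    using z(1) \<alpha>(1) L_closed by (simp add: cj_simps power_mult_distrib)
  ultimately have "(z * cj z)\<^sup>2 / (\<alpha> * cj \<alpha>) \<in> OK - p"
    using P(2) by auto
  then show "\<exists>x\<in>K. x\<^sup>2 / (\<alpha> * cj \<alpha>) \<in> OK - p"
    using norm_in_K[OF z(1)] by blast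
qed

text \<open>Hilbert 90 for \<open>\<theta> = \<beta> / b\<close> in the explicit form \<open>\<theta> = (1 + \<theta>) / cj (1 + \<theta>)\<close>, which keeps
  track of signs.\<close>

lemma norm_square_representative:
  assumes a: "a > 0" and L: "L \<subseteq> \<real>" and \<beta>: "totally_positive L \<beta>" and b: "totally_positive K b"
    and norm: "\<beta> * cj \<beta> = b\<^sup>2"
  obtains c \<delta> where "totally_positive K c" "totally_positive L \<delta>" "\<beta> = c * \<delta>\<^sup>2"
proof -
  define \<gamma> where "\<gamma> = 1 + \<beta> / b"
  have bL: "totally_positive L b"
    using totally_positive_mono[OF b K_sub_L] .
  have \<gamma>: "totally_positive L \<gamma>"
    unfolding \<gamma>_def using L \<beta> bL
    by (intro totally_positive_add totally_positive_1 totally_positive_divide subfield_L embedding_id) auto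
  have nz: "b \<noteq> 0" "\<beta> \<noteq> 0" "\<gamma> \<noteq> 0" "cj \<gamma> \<noteq> 0"
    using b \<beta> \<gamma> totally_positive_cj[OF \<gamma>] tposD(2) by auto
  have mem: "b \<in> L" "\<beta> \<in> L" "b \<in> K"
    using b bL \<beta> tposD(1) by auto
  have "cj \<gamma> = 1 + cj \<beta> / b"
    using mem L_closed by (simp add: \<gamma>_def cj_simps cj_K)
  then have "\<beta> * cj \<gamma> = b * \<gamma>"
    using norm nz(1) by (simp add: \<gamma>_def field_simps power2_eq_square)
  then have "\<beta> = b * (\<gamma> * cj \<gamma>) * (inverse (cj \<gamma>))\<^sup>2"
    using nz by (simp add: field_simps power2_eq_square)
  moreover have "totally_positive K (b * (\<gamma> * cj \<gamma>))"
    using b totally_positive_norm[OF a \<gamma>] totally_positive_mult[OF subfield] by blast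
  moreover have "totally_positive L (inverse (cj \<gamma>))"
    using \<gamma> totally_positive_cj totally_positive_inverse[OF subfield_L] by blast
  ultimately show thesis
    using that by blast
qed

text \<open>If \<open>c\<close> generates the square of an ideal of \<open>L\<close>, these are the primes of \<open>K\<close> at which \<open>c\<close> has
  odd order; they are ramified in \<open>L\<close>.\<close>

definition odd_primes :: "complex \<Rightarrow> complex set set" where
  "odd_primes c = {p. is_prime_ideal OK p \<and> of_int a \<in> p \<and> (\<forall>x\<in>K. x\<^sup>2 / c \<in> OK \<longrightarrow> x\<^sup>2 / c \<in> p)}"

text \<open>With \<open>a = 4 * k + 1\<close> the number \<open>(1 + s) / 2\<close> is a root of
  \<open>X^2 - X - k\<close>. This is where the congruence modulo 4 makes the extension unramified
  at 2.\<close>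

lemma half_integer_in_OL:
  assumes "a mod 4 = 1" shows "(1 + s) / 2 \<in> OL" "(1 - s) / 2 \<in> OL"
proof -
  define k where "k = a div 4"
  have a: "a = 4 * k + 1"
    using assms by (simp add: k_def) (metis mult_div_mod_eq)
  define w where "w = (1 + s) / 2"
  have "w\<^sup>2 - w - of_int k = 0"
    using square a by (simp add: w_def field_simps power2_eq_square)
  then have "poly (map_poly of_int [:- k, -1, 1:]) w = 0"
    by (simp add: algebra_simps power2_eq_square)
  then have "algebraic_int w"
    unfolding algebraic_int_altdef_ipoly by (intro exI[of _ "[:- k, -1, 1:]"]) auto
  moreover have "w \<in> L"
    unfolding w_def using L_closed(2,3,8) s_in_L subfield_numeral[OF subfield_L] by blast
  ultimately have wO: "w \<in> OL"
    by (simp add: ring_of_integers_def)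
  then show "(1 + s) / 2 \<in> OL"
    by (simp add: w_def)
  have "cj w = (1 - s) / 2"
    using L_closed s_in_L subfield_numeral[OF subfield_L] cj_simps(11)[of 2]
    by (simp add: w_def cj_simps cj_s)
  then show "(1 - s) / 2 \<in> OL"
    using cj_OL[OF wO] by (simp only:)
qed

text \<open>Traces from the root module over L land in the root module over K; they are the
  candidates for local witnesses in K.\<close>

lemma trace_over:
  assumes "y \<in> L" "c \<in> K" "y\<^sup>2 / c \<in> OL"
  shows "y + cj y \<in> K" "(y + cj y)\<^sup>2 / c \<in> OK" "(cj y)\<^sup>2 / c \<in> OL"
proof -
  show K: "y + cj y \<in> K"
    using trace_in_K assms(1) by blast
  have "cj (y\<^sup>2 / c) = (cj y)\<^sup>2 / c"
    using assms K_sub_L L_closed by (auto simp: cj_simps cj_K)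
  then show *: "(cj y)\<^sup>2 / c \<in> OL"
    using cj_OL assms(3) by metis
  have "algebraic_int ((y + cj y)\<^sup>2 / c)"
    using assms(3) * by (intro algebraic_int_add_over) (auto simp: ring_of_integers_def)
  then show "(y + cj y)\<^sup>2 / c \<in> OK"
    using K assms(2) K_closed by (auto simp: ring_of_integers_def)
qed

text \<open>A witness over L has to be replaced by one over K. Away from a, the traces of y and of
  \<open>w * y\<close> cannot both degenerate, since they recover \<open>s * y\<close> and s is a
  unit there. Above a, c and c' have the same parity: if both are even, witnesses in K multiply; if
  both are odd, each has a witness of the form \<open>t * s\<close>, and two such factors multiply
  to \<open>t * t' * a\<close>, which is in K.\<close>

lemma locally_square_descend:
  assumes a4: "a mod 4 = 1" and mem: "c \<in> K" "c' \<in> K"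
    and c: "locally_square L c" and c': "locally_square L c'"
    and same: "odd_primes c = odd_primes c'"
  shows "locally_square K (c * c')"
  unfolding locally_square_def
proof (intro allI impI)
  fix p assume p: "is_prime_ideal OK p"
  obtain P where P: "is_prime_ideal OL P" "P \<inter> K = p"
    using prime_lying_over[OF p] by blast
  note PI = idealD[OF prime_idealD(1)[OF P(1)]]
  define e where "e = c * c'"
  have e: "e \<in> K" "e \<in> L"
    using mem K_closed(5) K_sub_L by (auto simp: e_def)
  have aO: "of_int a \<in> OK" "of_int a \<in> OL"
    using of_int_in_ring_of_integers subfield subfield_L by auto
  have not_p: "x \<in> OK - p" if "x \<in> K" "x \<in> OL - P" for x
    using that P(2) OL_in_K by auto
  show "\<exists>x\<in>K. x\<^sup>2 / (c * c') \<in> OK - p"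
  proof (cases "of_int a \<in> p")
    case False
    then have aP: "of_int a \<notin> P"
      using P(2) K_closed(10) by auto
    obtain y where y: "y \<in> L" "y\<^sup>2 / e \<in> OL - P"
      using locally_square_mult[OF subfield_L c c'] P(1) unfolding locally_square_def e_def by blast
    define w where "w = (1 + s) / 2"
    define w' where "w' = (1 - s) / 2"
    have w: "w \<in> OL" "w' \<in> OL" "w \<in> L" "w' \<in> L"
      using half_integer_in_OL[OF a4] OL_L by (auto simp: w_def w'_def)
    have cj_w: "cj w = w'"
      using L_closed s_in_L subfield_numeral[OF subfield_L] cj_simps(11)[of 2]
      by (simp add: w_def w'_def cj_simps cj_s)
    have wy: "w * y \<in> L" "(w * y)\<^sup>2 / e \<in> OL"
    proof -
      show "w * y \<in> L" using w y L_closed by blast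
      have "w\<^sup>2 * (y\<^sup>2 / e) \<in> OL"
        using subringD(4)[OF OL_subring subringD(4)[OF OL_subring w(1) w(1)]] y(2)
        unfolding power2_eq_square[of w] by blast
      then show "(w * y)\<^sup>2 / e \<in> OL"
        by (simp add: power_mult_distrib)
    qed
    define x where "x = y + cj y"
    define x' where "x' = w * y + cj (w * y)"
    have x: "x \<in> K" "x\<^sup>2 / e \<in> OK" "x' \<in> K" "x'\<^sup>2 / e \<in> OK"
      unfolding x_def x'_def using trace_over[OF y(1) e(1)] trace_over[OF wy(1) e(1) wy(2)] y by auto
    have "\<not> (x\<^sup>2 / e \<in> p \<and> x'\<^sup>2 / e \<in> p)"
    proof
      assume "x\<^sup>2 / e \<in> p \<and> x'\<^sup>2 / e \<in> p"
      then have xP: "x\<^sup>2 / e \<in> P" "(- x')\<^sup>2 / e \<in> P"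
        using P(2) by auto
      have xL: "w' * x \<in> L" "- x' \<in> L"
        using x K_sub_L w L_closed by (metis subsetD)+
      have "(w' * x)\<^sup>2 / e \<in> P"
        using prime_ideal_scale_over[OF subfield_L P(1) xP(1) w(2)] .
      then have "(w' * x + - x')\<^sup>2 / e \<in> P"
        using prime_ideal_add_over[OF subfield_L P(1) xL e(2)] xP(2) by blast
      \<comment> \<open>Conjugation swaps w and w', so the conjugate of y cancels and
        \<open>(w' - w) * y\<close> remains.\<close>
      moreover have "w' * x + - x' = - s * y"
        using y w by (simp add: x_def x'_def cj_simps cj_w) (simp add: w_def w'_def field_simps)
      ultimately have "of_int a * (y\<^sup>2 / e) \<in> P"
        by (simp add: power_mult_distrib square)
      then show False
        using prime_idealD(3)[OF P(1) aO(2)] y aP by blast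
    qed
    then show ?thesis
      using x unfolding e_def by blast
  next
    case True
    \<comment> \<open>Primes above the odd number a do not contain 2, so passing between y and its
      symmetric and antisymmetric parts loses nothing at P.\<close>
    have "2 \<notin> P"
    proof
      assume "2 \<in> P"
      define k where "k = a div 4"
      have "a = 2 * (2 * k) + 1"
        using a4 by (simp add: k_def) (metis mult_div_mod_eq)
      then have "(1 :: complex) = of_int a + of_int (- 2 * k) * 2"
        by simp
      also have "\<dots> \<in> P"
      proof (rule PI(3))
        show "of_int a \<in> P"
          using True P(2) by blast
        show "of_int (- 2 * k) * 2 \<in> P"
          by (rule PI(4)[OF of_int_in_ring_of_integers[OF subfield_L] \<open>2 \<in> P\<close>])
      qed
      finally show False
        using prime_idealD(2)[OF P(1)] by blast
    qed
    moreover have "4 = (2 :: complex) * 2" "2 \<in> OL"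
      using of_int_in_ring_of_integers[OF subfield_L, of 2] by auto
    ultimately have four: "4 \<in> OL" "4 \<notin> P"
      using prime_idealD(3)[OF P(1), of 2 2] of_int_in_ring_of_integers[OF subfield_L, of 4] by auto
    show ?thesis
    proof (cases "p \<in> odd_primes c")
      case False
      moreover have "p \<notin> odd_primes c'"
        using same False by simp
      ultimately obtain x x' where x: "x \<in> K" "x\<^sup>2 / c \<in> OK - p" "x' \<in> K" "x'\<^sup>2 / c' \<in> OK - p"
        using True p unfolding odd_primes_def by blast
      have "(x\<^sup>2 / c) * (x'\<^sup>2 / c') \<in> OK - p"
        using x(2,4) subringD(4)[OF OK_subring] prime_idealD(3)[OF p] by blast
      then have "(x * x')\<^sup>2 / (c * c') \<in> OK - p"
        by (simp add: power_mult_distrib)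
      then show ?thesis
        using x K_closed by blast
    next
      case odd: True
      \<comment> \<open>At a prime of odd exponent the square root of the ideal is generated locally by an
        anti-invariant element.\<close>
      have anti: "\<exists>t\<in>K. (t * s)\<^sup>2 / d \<in> OL - P"
        if d: "d \<in> K" "locally_square L d" "p \<in> odd_primes d" for d
      proof -
        obtain y where y: "y \<in> L" "y\<^sup>2 / d \<in> OL - P"
          using d(2) P(1) unfolding locally_square_def by blast
        note tr = trace_over[OF y(1) d(1)]
        \<comment> \<open>The trace lies in K, so odd order of d at p forces it to degenerate; the
          antisymmetric part must then carry the unit.\<close>
        have "(y + cj y)\<^sup>2 / d \<in> p"
          using d(3) tr(1,2) y(2) by (auto simp: odd_primes_def)
        then have trP: "(y + cj y)\<^sup>2 / d \<in> P"
          using P(2) by blast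
        have mem': "y - cj y \<in> L" "y + cj y \<in> L" "d \<in> L"
          using y d cj_L L_closed K_sub_L by auto
        have "(y - cj y)\<^sup>2 / d \<notin> P"
        proof
          assume "(y - cj y)\<^sup>2 / d \<in> P"
          then have "((y - cj y) + (y + cj y))\<^sup>2 / d \<in> P"
            using prime_ideal_add_over[OF subfield_L P(1) mem'] trP by blast
          then have "4 * (y\<^sup>2 / d) \<in> P"
            by (simp add: power_mult_distrib)
          then show False
            using prime_idealD(3)[OF P(1) four(1)] four(2) y(2) by blast
        qed
        moreover have "(y - cj y)\<^sup>2 / d \<in> OL"
        proof -
          have "algebraic_int ((y + - cj y)\<^sup>2 / d)"
            using y(2) tr(3) by (intro algebraic_int_add_over) (auto simp: ring_of_integers_def)
          then show ?thesis
            using mem' L_closed by (auto simp: ring_of_integers_def)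
        qed
        moreover obtain t where "t \<in> K" "y - cj y = t * s"
        proof -
          obtain u v where uv: "y = u + v * s" "u \<in> K" "v \<in> K"
            using y(1) by (rule L_E)
          then have "cj y = u - v * s"
            by (simp only: cj_eq)
          then have "y - cj y = (v + v) * s"
            using uv(1) by (simp add: distrib_right)
          then show ?thesis
            using that K_closed(3)[OF uv(3,3)] by blast
        qed
        ultimately show ?thesis by auto
      qed
      obtain t t' where t: "t \<in> K" "(t * s)\<^sup>2 / c \<in> OL - P" "t' \<in> K" "(t' * s)\<^sup>2 / c' \<in> OL - P"
        using anti[OF mem(1) c odd] anti[OF mem(2) c'] odd same by blast
      have "((t * s)\<^sup>2 / c) * ((t' * s)\<^sup>2 / c') \<in> OL - P"
        using t(2,4) subringD(4)[OF OL_subring] prime_idealD(3)[OF P(1)] by blast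
      moreover have "((t * s)\<^sup>2 / c) * ((t' * s)\<^sup>2 / c') = (t * t' * of_int a)\<^sup>2 / (c * c')"
        using square by (simp add: power2_eq_square algebra_simps)
      moreover have "t * t' * of_int a \<in> K" "(t * t' * of_int a)\<^sup>2 / (c * c') \<in> K"
        using t mem K_closed by auto
      ultimately show ?thesis
        using not_p by metis
    qed
  qed
qed

text \<open>One element is fixed for each set of odd primes that occurs. Multiplying c by the one
  with the same set gives a class of \<open>V(K)\<close>, so the fibres of the map to sets of primes
  are no larger than \<open>R\<close>, and there are at most \<open>2 ^ card A\<close> sets.\<close>

lemma square_cover_descend:
  assumes a4: "a mod 4 = 1" and fin: "finite {p. is_prime_ideal OK p \<and> of_int a \<in> p}"
    and R: "square_cover K R"
  obtains R' where "finite R'" "card R' \<le> 2 ^ card {p. is_prime_ideal OK p \<and> of_int a \<in> p} * card R"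
    "\<And>c. totally_positive K c \<Longrightarrow> locally_square L c \<Longrightarrow>
      \<exists>r\<in>R'. \<exists>\<gamma>. totally_positive K \<gamma> \<and> c = r * \<gamma>\<^sup>2"
proof -
  define A where "A = {p. is_prime_ideal OK p \<and> of_int a \<in> p}"
  define rep where "rep T = (SOME c. totally_positive K c \<and> locally_square L c \<and> odd_primes c = T)" for T
  define R' where "R' = (\<lambda>(T, r). rep T * r) ` (Pow A \<times> R)"
  have finR: "finite R"
    using R by (simp add: square_cover_def)
  show thesis
  proof (rule that)
    show "finite R'"
      using fin finR by (simp add: R'_def A_def)
    have "card R' \<le> card (Pow A \<times> R)"
      unfolding R'_def using fin finR by (intro card_image_le) (simp add: A_def)
    then show "card R' \<le> 2 ^ card {p. is_prime_ideal OK p \<and> of_int a \<in> p} * card R"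
      using fin by (simp add: card_cartesian_product card_Pow A_def)
  next
    fix c assume c: "totally_positive K c" "locally_square L c"
    define d where "d = rep (odd_primes c)"
    have "totally_positive K d \<and> locally_square L d \<and> odd_primes d = odd_primes c"
      unfolding d_def rep_def by (rule someI[of _ c]) (use c in auto)
    then have d: "totally_positive K d" "locally_square L d" "odd_primes c = odd_primes d"
      by auto
    have "locally_square K (c * d)"
      using locally_square_descend[OF a4 _ _ c(2) d(2,3)] c d tposD(1) by blast
    moreover have "totally_positive K (c * d)"
      using totally_positive_mult[OF subfield c(1) d(1)] .
    ultimately obtain r \<gamma> where r: "r \<in> R" "totally_positive K \<gamma>" "c * d = r * \<gamma>\<^sup>2"
      using R unfolding square_cover_def by blast
    have "d \<noteq> 0"
      using d(1) tposD(2) by blast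
    then have "c = (d * r) * (\<gamma> / d)\<^sup>2"
      using r(3) by (simp add: field_simps power2_eq_square)
    moreover have "d * r \<in> R'"
      unfolding R'_def d_def using r(1) by (intro image_eqI[of _ _ "(odd_primes c, r)"]) (auto simp: A_def odd_primes_def)
    moreover have "totally_positive K (\<gamma> / d)"
      using totally_positive_divide[OF subfield r(2) d(1)] .
    ultimately show "\<exists>r\<in>R'. \<exists>\<gamma>. totally_positive K \<gamma> \<and> c = r * \<gamma>\<^sup>2"
      by blast
  qed
qed

text \<open>The factor \<open>(card R)\<^sup>2\<close> counts \<open>R\<close> twice: once for the
  class of the norm and once in the descent of the kernel. Two elements with norms in the same class
  have a product whose norm is a square from K, so Hilbert 90 moves this product into K up to
  squares, where the set \<open>W\<close> from the descent applies.\<close>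

lemma square_cover_extend:
  assumes a: "a > 0" "a mod 4 = 1" and L: "L \<subseteq> \<real>"
    and fin: "finite {p. is_prime_ideal OK p \<and> of_int a \<in> p}"
    and R: "square_cover K R"
  obtains R' where "square_cover L R'"
    "card R' \<le> 2 ^ card {p. is_prime_ideal OK p \<and> of_int a \<in> p} * (card R)\<^sup>2"
proof -
  obtain W where W: "finite W" "card W \<le> 2 ^ card {p. is_prime_ideal OK p \<and> of_int a \<in> p} * card R"
    "\<And>c. totally_positive K c \<Longrightarrow> locally_square L c \<Longrightarrow>
      \<exists>r\<in>W. \<exists>\<gamma>. totally_positive K \<gamma> \<and> c = r * \<gamma>\<^sup>2"
    using square_cover_descend[OF a(2) fin R] by metis
  define has_norm where "has_norm r \<alpha> \<longleftrightarrow> totally_positive L \<alpha> \<and> locally_square L \<alpha> \<and>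
      (\<exists>\<gamma>. totally_positive K \<gamma> \<and> \<alpha> * cj \<alpha> = r * \<gamma>\<^sup>2)" for r \<alpha>
  define rep where "rep r = (SOME \<alpha>. has_norm r \<alpha>)" for r
  define R' where "R' = (\<lambda>(w, r). w * rep r) ` (W \<times> R)"
  have finR: "finite R"
    using R by (simp add: square_cover_def)
  show thesis
  proof (rule that)
    have "card R' \<le> card (W \<times> R)"
      unfolding R'_def using W(1) finR by (intro card_image_le) simp
    also have "\<dots> \<le> (2 ^ card {p. is_prime_ideal OK p \<and> of_int a \<in> p} * card R) * card R"
      using W(2) by (simp only: card_cartesian_product mult_le_mono1)
    finally show "card R' \<le> 2 ^ card {p. is_prime_ideal OK p \<and> of_int a \<in> p} * (card R)\<^sup>2"
      by (simp add: power2_eq_square algebra_simps)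
    have "\<exists>r\<in>R'. \<exists>\<gamma>. totally_positive L \<gamma> \<and> \<alpha> = r * \<gamma>\<^sup>2"
      if \<alpha>: "totally_positive L \<alpha>" "locally_square L \<alpha>" for \<alpha>
    proof -
      have "totally_positive K (\<alpha> * cj \<alpha>)" "locally_square K (\<alpha> * cj \<alpha>)"
        using totally_positive_norm[OF a(1) \<alpha>(1)] locally_square_norm \<alpha> tposD(1) by blast+
      then obtain r \<gamma> where r: "r \<in> R" "totally_positive K \<gamma>" "\<alpha> * cj \<alpha> = r * \<gamma>\<^sup>2"
        using R unfolding square_cover_def by blast
      define \<alpha>' where "\<alpha>' = rep r"
      have "has_norm r \<alpha>'"
        unfolding \<alpha>'_def rep_def by (rule someI[of _ \<alpha>]) (use \<alpha> r in \<open>auto simp: has_norm_def\<close>)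
      then obtain \<gamma>' where \<alpha>': "totally_positive L \<alpha>'" "locally_square L \<alpha>'"
          "totally_positive K \<gamma>'" "\<alpha>' * cj \<alpha>' = r * \<gamma>'\<^sup>2"
        by (auto simp: has_norm_def)
      have \<beta>: "totally_positive L (\<alpha> * \<alpha>')"
        using totally_positive_mult[OF subfield_L \<alpha>(1) \<alpha>'(1)] .
      have rK: "totally_positive K (r * \<gamma>\<^sup>2)"
        using \<open>totally_positive K (\<alpha> * cj \<alpha>)\<close> r(3) by simp
      \<comment> \<open>Membership in a cover says nothing about r itself, so positivity of this
        root is derived from the norm \<open>r * \<gamma>\<^sup>2\<close>.\<close>
      have "r * \<gamma> * \<gamma>' = (r * \<gamma>\<^sup>2) / \<gamma> * \<gamma>'"
        using tposD(2)[OF r(2)] by (simp add: power2_eq_square)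
      then have b: "totally_positive K (r * \<gamma> * \<gamma>')"
        using rK r(2) \<alpha>'(3) subfield totally_positive_mult totally_positive_divide by metis
      have "(\<alpha> * \<alpha>') * cj (\<alpha> * \<alpha>') = (\<alpha> * cj \<alpha>) * (\<alpha>' * cj \<alpha>')"
        using \<alpha>(1) \<alpha>'(1) tposD(1) by (simp add: cj_simps)
      also have "\<dots> = (r * \<gamma> * \<gamma>')\<^sup>2"
        unfolding r(3) \<alpha>'(4) by (simp add: power2_eq_square)
      finally obtain c \<delta> where c: "totally_positive K c" "totally_positive L \<delta>" "\<alpha> * \<alpha>' = c * \<delta>\<^sup>2"
        using norm_square_representative[OF a(1) L \<beta> b] by blast
      note \<delta> = tposD[OF c(2)]
      have "c = (\<alpha> * \<alpha>') * (inverse \<delta>)\<^sup>2"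
        using c(3) \<delta>(2) by (simp add: field_simps)
      moreover have "locally_square L ((\<alpha> * \<alpha>') * (inverse \<delta>)\<^sup>2)"
        using \<alpha>(2) \<alpha>'(2) \<delta> L_closed
        by (intro locally_square_mult locally_square_power2 subfield_L) auto
      ultimately obtain w \<epsilon> where w: "w \<in> W" "totally_positive K \<epsilon>" "c = w * \<epsilon>\<^sup>2"
        using W(3)[OF c(1)] by metis
      have "\<alpha>' \<noteq> 0"
        using \<alpha>'(1) tposD(2) by blast
      then have "\<alpha> = (w * \<alpha>') * (\<epsilon> * \<delta> / \<alpha>')\<^sup>2"
        using c(3) w(3) by (simp add: field_simps power2_eq_square)
      moreover have "w * \<alpha>' \<in> R'"
        unfolding R'_def \<alpha>'_def using w(1) r(1) by (intro image_eqI[of _ _ "(w, r)"]) auto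
      moreover have "totally_positive L (\<epsilon> * \<delta> / \<alpha>')"
        using totally_positive_mono[OF w(2) K_sub_L] c(2) \<alpha>'(1)
        by (intro totally_positive_divide totally_positive_mult subfield_L)
      ultimately show ?thesis by blast
    qed
    then show "square_cover L R'"
      using W(1) finR by (auto simp: square_cover_def R'_def)
  qed
qed

end

section \<open>The multiquadratic tower\<close>

lemma subfield_field_generated: "is_subfield (field_generated S)"
  unfolding field_generated_def is_subfield_def by blast

lemma generators_in_field_generated: "S \<subseteq> field_generated S"
  by (auto simp: field_generated_def)

lemma field_generated_least: "is_subfield F \<Longrightarrow> S \<subseteq> F \<Longrightarrow> field_generated S \<subseteq> F"
  by (auto simp: field_generated_def)

lemma subfield_Rats: "is_subfield \<rat>"
  unfolding is_subfield_def by auto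

lemma subfield_Reals: "is_subfield \<real>"
  unfolding is_subfield_def by auto

lemma Rats_subset_subfield:
  assumes "is_subfield F" shows "\<rat> \<subseteq> F"
proof
  fix x :: complex assume "x \<in> \<rat>"
  then obtain p q where "x = of_int p / of_int q"
    by (auto elim: Rats_cases')
  then show "x \<in> F"
    using subfieldD(8)[OF assms subfield_of_int[OF assms] subfield_of_int[OF assms]] by simp
qed

lemma subfield_multiquadratic: "is_subfield (multiquadratic_field n a)"
  unfolding multiquadratic_field_def by (rule subfield_field_generated)

lemma multiquadratic_field_0: "multiquadratic_field 0 a = \<rat>"
proof
  show "multiquadratic_field 0 a \<subseteq> \<rat>"
    unfolding multiquadratic_field_def by (rule field_generated_least[OF subfield_Rats]) auto
  show "\<rat> \<subseteq> multiquadratic_field 0 a"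
    by (rule Rats_subset_subfield[OF subfield_multiquadratic])
qed

lemma multiquadratic_field_mono:
  assumes "k \<le> m" shows "multiquadratic_field k a \<subseteq> multiquadratic_field m a"
proof -
  let ?g = "\<lambda>i. csqrt (of_int (a i))"
  have "?g ` {1..k} \<subseteq> ?g ` {1..m}"
    using assms by (intro image_mono) simp
  then have "?g ` {1..k} \<subseteq> field_generated (?g ` {1..m})"
    using generators_in_field_generated by (rule subset_trans)
  then show ?thesis
    unfolding multiquadratic_field_def by (rule field_generated_least[OF subfield_field_generated])
qed

lemma csqrt_in_multiquadratic: "i \<in> {1..n} \<Longrightarrow> csqrt (of_int (a i)) \<in> multiquadratic_field n a"
  unfolding multiquadratic_field_def by (rule subsetD[OF generators_in_field_generated imageI])

lemma multiquadratic_field_Suc: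
  assumes "csqrt (of_int (a (Suc k))) \<notin> multiquadratic_field k a"
  shows "quadratic_extension (multiquadratic_field k a) (csqrt (of_int (a (Suc k)))) (a (Suc k))"
    and "multiquadratic_field (Suc k) a =
      quadratic_adjoin (multiquadratic_field k a) (csqrt (of_int (a (Suc k))))"
proof -
  let ?F = "multiquadratic_field k a" and ?s = "csqrt (of_int (a (Suc k)))"
  show "quadratic_extension ?F ?s (a (Suc k))"
    using assms subfield_multiquadratic by unfold_locales auto
  then interpret quadratic_extension ?F ?s "a (Suc k)" .
  have "(\<lambda>i. csqrt (of_int (a i))) ` {1..Suc k} \<subseteq> L"
  proof (rule image_subsetI)
    fix i assume "i \<in> {1..Suc k}"
    then consider "i \<in> {1..k}" | "i = Suc k"
      by force
    then show "csqrt (of_int (a i)) \<in> L"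
      using csqrt_in_multiquadratic[of i k a] K_sub_L s_in_L by cases auto
  qed
  then have "multiquadratic_field (Suc k) a \<subseteq> L"
    unfolding multiquadratic_field_def[of "Suc k"] by (rule field_generated_least[OF subfield_L])
  moreover have "L \<subseteq> multiquadratic_field (Suc k) a"
  proof
    fix z assume "z \<in> L"
    then obtain x y where xy: "z = x + y * ?s" "x \<in> ?F" "y \<in> ?F"
      by (rule L_E)
    then have mem: "x \<in> multiquadratic_field (Suc k) a" "y \<in> multiquadratic_field (Suc k) a"
        "?s \<in> multiquadratic_field (Suc k) a"
      using multiquadratic_field_mono[of k "Suc k" a] csqrt_in_multiquadratic[of "Suc k" "Suc k" a] by auto
    note F = subfieldD[OF subfield_multiquadratic[of "Suc k" a]]
    show "z \<in> multiquadratic_field (Suc k) a"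
      unfolding xy(1) by (rule F(3)[OF mem(1) F(5)[OF mem(2,3)]])
  qed
  ultimately show "multiquadratic_field (Suc k) a = L"
    by (rule subset_antisym)
qed

lemma rational_square_of_int:
  assumes "q \<in> \<rat>" "of_int m = (q :: complex)\<^sup>2"
  obtains z where "m = z\<^sup>2" "q = of_int z"
proof -
  have "algebraic_int (of_int m :: complex)"
    by (rule int_imp_algebraic_int) simp
  then have "algebraic_int q"
    using assms(2) algebraic_int_sqrt_of_power2 by simp
  then have "q \<in> \<int>"
    using assms(1) rational_algebraic_int_is_int by blast
  then obtain z where z: "q = of_int z"
    by (auto elim: Ints_cases)
  then have "(of_int m :: complex) = of_int (z\<^sup>2)"
    using assms(2) by simp
  then show thesis
    using that z of_int_eq_iff by blast
qed

locale multiquadratic_tower =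
  fixes n :: nat and a :: "nat \<Rightarrow> int"
  assumes sqfree: "\<And>i. i \<in> {1..n} \<Longrightarrow> squarefree (a i)"
    and ge2: "\<And>i. i \<in> {1..n} \<Longrightarrow> a i \<ge> 2"
    and cop: "\<And>i j. i \<in> {1..n} \<Longrightarrow> j \<in> {1..n} \<Longrightarrow> i \<noteq> j \<Longrightarrow> coprime (a i) (a j)"
    and mod4: "\<And>i. i \<in> {1..n} \<Longrightarrow> a i mod 4 = 1"
begin

abbreviation "F k \<equiv> multiquadratic_field k a"
abbreviation "rt i \<equiv> csqrt (of_int (a i))"

lemma prod_ge2:
  assumes "S \<subseteq> {1..n}" "S \<noteq> {}" shows "(\<Prod>i\<in>S. a i) \<ge> 2"
proof -
  obtain j where j: "j \<in> S"
    using assms by blast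
  have fin: "finite S"
    using assms(1) finite_subset by blast
  have "(\<Prod>i\<in>S - {j}. a i) \<ge> 1"
    using ge2 assms(1) by (intro prod_ge_1) force
  then have "a j * (\<Prod>i\<in>S - {j}. a i) \<ge> 2 * 1"
    using ge2[of j] j assms(1) by (intro mult_mono) auto
  then show ?thesis
    using prod.remove[OF fin j, of a] by simp
qed

lemma prod_not_square:
  assumes "S \<subseteq> {1..n}" "S \<noteq> {}" "q \<in> \<rat>"
  shows "of_int (\<Prod>i\<in>S. a i) \<noteq> (q :: complex)\<^sup>2"
proof
  assume "of_int (\<Prod>i\<in>S. a i) = q\<^sup>2"
  then obtain z where z: "(\<Prod>i\<in>S. a i) = z\<^sup>2"
    using rational_square_of_int[OF assms(3)] by blast
  have "squarefree (\<Prod>i\<in>S. a i)"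
    by (rule squarefree_prod_coprime) (use cop sqfree assms(1) in blast)+
  then have "z dvd 1"
    by (rule squarefreeD) (simp add: z)
  then have "z\<^sup>2 = 1"
    by (auto simp: power2_eq_1_iff abs_if split: if_splits)
  then show False
    using prod_ge2[OF assms(1,2)] z by simp
qed

lemma prod_insert_not_square:
  assumes "k < n" "S \<subseteq> {1..k}" "q \<in> \<rat>"
  shows "of_int (a (Suc k)) * of_int (\<Prod>i\<in>S. a i) \<noteq> (q :: complex)\<^sup>2"
proof -
  have fin: "finite S" "Suc k \<notin> S"
    using assms(2) finite_subset by auto
  have "insert (Suc k) S \<subseteq> {1..n}"
    using assms by auto
  then have "of_int (\<Prod>i\<in>insert (Suc k) S. a i) \<noteq> q\<^sup>2"
    using assms(3) by (intro prod_not_square) auto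
  then show ?thesis
    using prod.insert[OF fin, of a] by simp
qed

text \<open>Kummer theory by hand: if \<open>(u + v * \<surd>a)\<^sup>2\<close> is rational, then
  \<open>u * v = 0\<close>. Either x already lies one level lower, or x is a multiple of the new
  root, and multiplying by that root brings it down at the price of one more index in S.\<close>

lemma square_roots_in_field:
  assumes "k \<le> n" "x \<in> F k" "x\<^sup>2 \<in> \<rat>"
  shows "\<exists>S\<subseteq>{1..k}. \<exists>q\<in>\<rat>. x\<^sup>2 * of_int (\<Prod>i\<in>S. a i) = q\<^sup>2"
  using assms
proof (induction k arbitrary: x)
  case 0
  then have "x \<in> \<rat>"
    by (simp add: multiquadratic_field_0)
  then show ?case
    by (intro exI[of _ "{}"]) auto
next
  case (Suc k)
  show ?case
  proof (cases "rt (Suc k) \<in> F k")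
    \<comment> \<open>Impossible: the induction hypothesis for this root would make a product of
      distinct \<open>a i\<close> a rational square. So the induction also establishes that each
      step has degree 2.\<close>
    case True
    have "\<exists>S\<subseteq>{1..k}. \<exists>q\<in>\<rat>. (rt (Suc k))\<^sup>2 * of_int (\<Prod>i\<in>S. a i) = q\<^sup>2"
      using Suc.prems True by (intro Suc.IH) auto
    then obtain S q where S: "S \<subseteq> {1..k}" "q \<in> \<rat>" "of_int (a (Suc k)) * of_int (\<Prod>i\<in>S. a i) = (q :: complex)\<^sup>2"
      by auto
    then show ?thesis
      using prod_insert_not_square[of k S q] Suc.prems(1) by simp
  next
    case False
    interpret quadratic_extension "F k" "rt (Suc k)" "a (Suc k)"
      by (rule multiquadratic_field_Suc(1)[OF False])
    have "x \<in> L"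
      using Suc.prems(2) multiquadratic_field_Suc(2)[OF False] by simp
    then obtain u v where uv: "x = u + v * rt (Suc k)" "u \<in> F k" "v \<in> F k"
      by (rule L_E)
    have sq: "x\<^sup>2 = (u * u + of_int (a (Suc k)) * (v * v)) + (u * v + v * u) * rt (Suc k)"
      unfolding uv(1) power2_eq_square[of "_ + _"] by (rule mult_coords)
    have "x\<^sup>2 \<in> F k"
      using Suc.prems(3) Rats_subset_subfield[OF subfield] by blast
    moreover have "x\<^sup>2 + 0 * rt (Suc k) = (u * u + of_int (a (Suc k)) * (v * v)) + (u * v + v * u) * rt (Suc k)"
      using sq by simp
    moreover have "u * u + of_int (a (Suc k)) * (v * v) \<in> F k" "u * v + v * u \<in> F k"
      using uv(2,3) by (simp_all add: K_closed subfield_numeral[OF subfield])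
    ultimately have eq: "x\<^sup>2 = u * u + of_int (a (Suc k)) * (v * v)" "0 = u * v + v * u"
      using coords_unique K_closed(1) by blast+
    then consider "v = 0" | "u = 0"
      by auto
    then show ?thesis
    proof cases
      case 1
      then have "x \<in> F k"
        using uv by simp
      then have "\<exists>S\<subseteq>{1..k}. \<exists>q\<in>\<rat>. x\<^sup>2 * of_int (\<Prod>i\<in>S. a i) = q\<^sup>2"
        using Suc.prems by (intro Suc.IH) auto
      moreover have "{1..k} \<subseteq> {1..Suc k}"
        by simp
      ultimately show ?thesis
        by (meson subset_trans)
    next
      case 2
      \<comment> \<open>With u = 0 this is x times the new root.\<close>
      define y where "y = of_int (a (Suc k)) * v"
      have y2: "y\<^sup>2 = x\<^sup>2 * of_int (a (Suc k))"
        using eq(1) 2 by (simp add: y_def power2_eq_square)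
      have "y\<^sup>2 \<in> \<rat>"
        unfolding y2 using Suc.prems(3) by auto
      moreover have "y \<in> F k"
        unfolding y_def using uv(3) K_closed(5,10) by blast
      ultimately have "\<exists>S\<subseteq>{1..k}. \<exists>q\<in>\<rat>. y\<^sup>2 * of_int (\<Prod>i\<in>S. a i) = q\<^sup>2"
        using Suc.prems by (intro Suc.IH) auto
      then obtain S q where S: "S \<subseteq> {1..k}" "q \<in> \<rat>" "y\<^sup>2 * of_int (\<Prod>i\<in>S. a i) = q\<^sup>2"
        by auto
      have fin: "finite S" "Suc k \<notin> S"
        using S(1) finite_subset by auto
      have "x\<^sup>2 * of_int (\<Prod>i\<in>insert (Suc k) S. a i) = q\<^sup>2"
        using S(3) prod.insert[OF fin, of a] y2 by (simp add: mult.assoc)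
      moreover have "insert (Suc k) S \<subseteq> {1..Suc k}"
        using S(1) by auto
      ultimately show ?thesis
        using S(2) by blast
    qed
  qed
qed

lemma rt_notin:
  assumes "k < n" shows "rt (Suc k) \<notin> F k"
proof
  assume "rt (Suc k) \<in> F k"
  then have "\<exists>S\<subseteq>{1..k}. \<exists>q\<in>\<rat>. (rt (Suc k))\<^sup>2 * of_int (\<Prod>i\<in>S. a i) = q\<^sup>2"
    using assms by (intro square_roots_in_field) auto
  then obtain S q where S: "S \<subseteq> {1..k}" "q \<in> \<rat>" "of_int (a (Suc k)) * of_int (\<Prod>i\<in>S. a i) = (q :: complex)\<^sup>2"
    by auto
  then show False
    using prod_insert_not_square[OF assms] by blast
qed

lemma extension:
  assumes "k < n"
  shows "quadratic_extension (F k) (rt (Suc k)) (a (Suc k))"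
    and "F (Suc k) = quadratic_adjoin (F k) (rt (Suc k))"
  using multiquadratic_field_Suc[OF rt_notin[OF assms]] .

lemma field_real:
  assumes "k \<le> n" shows "F k \<subseteq> \<real>"
  unfolding multiquadratic_field_def
proof (rule field_generated_least[OF subfield_Reals], rule image_subsetI)
  fix i assume "i \<in> {1..k}"
  then have "a i \<ge> 2"
    using ge2 assms by auto
  then show "rt i \<in> \<real>"
    by simp
qed

end

section \<open>The rational base case and the count over the tower\<close>

lemma ring_of_integers_Rats: "ring_of_integers \<rat> = \<int>"
  unfolding ring_of_integers_def
  using rational_algebraic_int_is_int int_imp_algebraic_int Ints_subset_Rats by blast

lemma prime_ideal_of_prime:
  fixes p :: int
  assumes "prime p"
  shows "is_prime_ideal \<int> (range (\<lambda>k. of_int (p * k)))"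
proof -
  have mem: "(of_int m :: complex) \<in> range (\<lambda>k. of_int (p * k)) \<longleftrightarrow> p dvd m" for m
    by (simp only: image_iff of_int_eq_iff dvd_def Bex_def UNIV_I simp_thms)
  have "is_ideal \<int> (range (\<lambda>k. of_int (p * k)))"
    unfolding is_ideal_def
  proof (intro conjI ballI)
    show "range (\<lambda>k. of_int (p * k)) \<subseteq> (\<int> :: complex set)"
      by auto
    show "(0 :: complex) \<in> range (\<lambda>k. of_int (p * k))"
      using mem[of 0] by simp
    show "x + y \<in> range (\<lambda>k. of_int (p * k))"
      if "x \<in> range (\<lambda>k. of_int (p * k))" "y \<in> range (\<lambda>k. of_int (p * k))" for x y :: complex
      using that by (auto simp flip: of_int_add distrib_left)
    show "r * x \<in> range (\<lambda>k. of_int (p * k))"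
      if rx: "r \<in> \<int>" "x \<in> range (\<lambda>k. of_int (p * k))" for r x :: complex
    proof -
      obtain m where "r = of_int m"
        using rx(1) by (rule Ints_cases)
      moreover obtain k where "x = of_int (p * k)"
        using rx(2) by blast
      ultimately show ?thesis
        using mem[of "m * (p * k)"] by simp
    qed
  qed
  moreover have "1 \<notin> range (\<lambda>k. of_int (p * k) :: complex)"
    using mem[of 1] assms not_prime_unit by auto
  moreover have "x \<in> range (\<lambda>k. of_int (p * k)) \<or> y \<in> range (\<lambda>k. of_int (p * k))"
    if xy: "x \<in> \<int>" "y \<in> \<int>" "x * y \<in> range (\<lambda>k. of_int (p * k))" for x y :: complex
  proof -
    obtain u where u: "x = of_int u"
      using xy(1) by (rule Ints_cases)
    obtain v where v: "y = of_int v"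
      using xy(2) by (rule Ints_cases)
    note uv = u v
    then have "p dvd u * v"
      using xy(3) mem[of "u * v"] by simp
    then show ?thesis
      using assms uv mem prime_dvd_mult_iff by metis
  qed
  ultimately show ?thesis
    unfolding is_prime_ideal_def by blast
qed

lemma prime_ideals_of_Ints_containing:
  fixes p :: int
  assumes "prime p" "is_prime_ideal \<int> P" "of_int p \<in> P"
  shows "P = range (\<lambda>k. of_int (p * k))"
proof
  note PI = prime_idealD[OF assms(2)] and I = idealD[OF prime_idealD(1)[OF assms(2)]]
  have mult: "of_int (p * k) \<in> P" for k
    using I(5)[OF _ assms(3), of "of_int k"] by simp
  then show "range (\<lambda>k. of_int (p * k)) \<subseteq> P"
    by blast
  show "P \<subseteq> range (\<lambda>k. of_int (p * k))"
  proof
    fix x assume x: "x \<in> P"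
    then obtain m where m: "x = of_int m"
      using I(1) by (auto elim: Ints_cases)
    have "p dvd m"
    proof (rule ccontr)
      assume "\<not> p dvd m"
      then have "coprime p m"
        using assms(1) prime_imp_coprime by blast
      then obtain u v where "u * p + v * m = 1"
        by (metis bezout_int coprime_iff_gcd_eq_1)
      then have "(1 :: complex) = of_int (p * u) + of_int v * of_int m"
        by (metis mult.commute of_int_1 of_int_add of_int_mult)
      also have "\<dots> \<in> P"
        using mult I(4)[OF _ x, of "of_int v"] m by (intro I(3)) auto
      finally show False
        using PI(2) by blast
    qed
    then show "x \<in> range (\<lambda>k. of_int (p * k))"
      using m by (auto simp: dvd_def)
  qed
qed

lemma prime_ideal_contains_prime_factor:
  assumes P: "is_prime_ideal (ring_of_integers K) P" "is_subfield K" and m: "m > 0" "of_int m \<in> P"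
  shows "\<exists>q\<in>prime_factors m. of_int q \<in> P"
proof -
  have "\<exists>q\<in>#M. of_int q \<in> P" if "of_int (prod_mset M) \<in> P" for M :: "int multiset"
    using that
  proof (induction M)
    case empty
    then show ?case
      using prime_idealD(2)[OF P(1)] by simp
  next
    case (add q M)
    then have "of_int q \<in> P \<or> of_int (prod_mset M) \<in> P"
      using prime_idealD(3)[OF P(1)] of_int_in_ring_of_integers[OF P(2)] by simp
    then show ?case
      using add.IH by auto
  qed
  then show ?thesis
    using m prod_mset_prime_factorization_int[OF m(1)] by metis
qed

lemma totally_positive_rational_iff:
  assumes "x \<in> \<rat>" shows "totally_positive \<rat> x \<longleftrightarrow> Re x > 0"
proof -
  obtain p q where pq: "x = of_int p / of_int q" "q > 0"
    using assms by (rule Rats_cases')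
  have 1: "\<tau> x = x" if "field_embedding \<rat> \<tau>" for \<tau>
    unfolding pq(1)
    using embeddingD(8)[OF subfield_Rats that subfield_of_int[OF subfield_Rats] subfield_of_int[OF subfield_Rats]]
      embedding_of_int[OF subfield_Rats that] by simp
  have 2: "field_embedding \<rat> id" "id ` \<rat> \<subseteq> (\<real> :: complex set)"
    using Rats_subset_subfield[OF subfield_Reals] by (auto simp: field_embedding_def)
  show ?thesis
  proof
    assume "totally_positive \<rat> x"
    from tposD(3)[OF this 2] show "Re x > 0"
      by simp
  next
    assume pos: "Re x > 0"
    have "Re (\<tau> x) > 0" if "field_embedding \<rat> \<tau>" for \<tau>
      using 1[OF that] pos by simp
    then show "totally_positive \<rat> x"
      unfolding totally_positive_def using assms pos by auto
  qed
qed

text \<open>At a prime p dividing m the order of m is 1, whereas a local witness would make it even: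
  \<open>m * j\<close> is a square with j prime to p, which forces \<open>p\<^sup>2\<close> to
  divide m.\<close>

lemma locally_square_squarefree:
  fixes m :: int
  assumes "squarefree m" "m > 0" "locally_square \<rat> (of_int m)"
  shows "m = 1"
proof (rule ccontr)
  assume "m \<noteq> 1"
  then obtain p where p: "prime p" "p dvd m"
    using assms(2) prime_divisor_exists[of m] by auto
  obtain m' where m': "m = p * m'"
    using p(2) by (auto simp: dvd_def)
  define P where "P = range (\<lambda>k. of_int (p * k) :: complex)"
  obtain x where x: "x \<in> \<rat>" "x\<^sup>2 / of_int m \<in> \<int> - P"
    using assms(3) prime_ideal_of_prime[OF p(1)] unfolding locally_square_def ring_of_integers_Rats P_def by blast
  then obtain j where j: "x\<^sup>2 / of_int m = of_int j"
    by (auto elim: Ints_cases)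
  then have "of_int (m * j) = x\<^sup>2"
    using assms(2) by (simp add: field_simps)
  then obtain z where z: "m * j = z\<^sup>2"
    using rational_square_of_int[OF x(1)] by metis
  have nj: "\<not> p dvd j"
    using x(2) j unfolding P_def by (auto simp: dvd_def)
  have "p dvd z\<^sup>2"
    using z m' by (metis dvd_mult2 dvd_triv_left)
  then have "p dvd z"
    using p(1) prime_dvd_power by blast
  then obtain z' where "z = p * z'"
    by (auto simp: dvd_def)
  then have "m' * j = p * z'\<^sup>2"
    using z m' p(1) by (auto simp: power2_eq_square)
  then have "p dvd m'"
    using nj p(1) prime_dvd_mult_iff by (metis dvd_triv_left)
  then have "p\<^sup>2 dvd m"
    using m' by (simp add: power2_eq_square)
  then show False
    using assms(1) p(1) not_prime_unit squarefreeD by blast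
qed

text \<open>Modulo squares \<open>p / q\<close> equals \<open>p * q\<close>, hence its squarefree
  part, which must be 1. Thus V of the rationals is trivial and the recursion starts at exponent
  0.\<close>

lemma square_cover_Rats: "square_cover \<rat> {1}"
  unfolding square_cover_def
proof (intro conjI allI impI)
  fix \<alpha> assume "totally_positive \<rat> \<alpha> \<and> locally_square \<rat> \<alpha>"
  then have tp: "totally_positive \<rat> \<alpha>" and ls: "locally_square \<rat> \<alpha>"
    by auto
  have "\<alpha> \<in> \<rat>" and pos: "Re \<alpha> > 0"
    using tp tposD(1) totally_positive_rational_iff by blast+
  then obtain p q where pq: "q > 0" "\<alpha> = of_int p / of_int q"
    using Rats_cases' by metis
  have "Re \<alpha> = real_of_int p / real_of_int q"
    unfolding pq(2) by (metis Re_complex_of_real of_real_divide of_real_of_int_eq)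
  then have "p > 0"
    using pos pq(1) by (simp add: zero_less_divide_iff)
  define m where "m = squarefree_part (p * q)"
  define f where "f = square_part (p * q)"
  have eq: "p * q = m * f\<^sup>2"
    unfolding m_def f_def by (rule squarefree_decompose)
  have "p * q > 0"
    using \<open>p > 0\<close> pq(1) by simp
  then have f: "f \<noteq> 0" and m: "m > 0"
    using eq by (auto simp: zero_less_mult_iff)
  have "of_int m * (of_int f)\<^sup>2 = (of_int p * of_int q :: complex)"
    using eq by (metis of_int_mult of_int_power)
  then have "of_int m = \<alpha> * (of_int q / of_int f :: complex)\<^sup>2"
    using f pq by (simp add: field_simps power2_eq_square)
  moreover have "locally_square \<rat> (\<alpha> * (of_int q / of_int f)\<^sup>2)"
    using f pq(1) by (intro locally_square_mult locally_square_power2 subfield_Rats ls) auto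
  ultimately have "m = 1"
    using locally_square_squarefree[OF _ m] by (simp add: m_def)
  \<comment> \<open>The absolute value is taken because the root has to be totally positive.\<close>
  moreover have "(of_int \<bar>f\<bar> :: complex)\<^sup>2 = (of_int f)\<^sup>2"
    by (metis of_int_power power2_abs)
  ultimately have "(of_int \<bar>f\<bar> :: complex)\<^sup>2 = of_int p * of_int q"
    using \<open>of_int m * (of_int f)\<^sup>2 = (of_int p * of_int q :: complex)\<close> by simp
  then have "\<alpha> = 1 * (of_int \<bar>f\<bar> / of_int q)\<^sup>2"
    using pq by (simp add: power_divide power2_eq_square)
  moreover have "totally_positive \<rat> (of_int \<bar>f\<bar> / of_int q)"
  proof -
    have "(of_int \<bar>f\<bar> / of_int q :: complex) = of_real (real_of_int \<bar>f\<bar> / real_of_int q)"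
      by (simp only: of_real_divide of_real_of_int_eq)
    then have "Re (of_int \<bar>f\<bar> / of_int q) = real_of_int \<bar>f\<bar> / real_of_int q"
      by (metis Re_complex_of_real)
    then show ?thesis
      using f pq(1) by (subst totally_positive_rational_iff) auto
  qed
  ultimately show "\<exists>r\<in>{1}. \<exists>\<gamma>. totally_positive \<rat> \<gamma> \<and> \<alpha> = r * \<gamma>\<^sup>2"
    by blast
qed simp

context multiquadratic_tower
begin

lemma card_primes_over:
  fixes p :: int
  assumes "prime p" "k \<le> n"
  shows "finite {P. is_prime_ideal (ring_of_integers (F k)) P \<and> of_int p \<in> P} \<and>
    card {P. is_prime_ideal (ring_of_integers (F k)) P \<and> of_int p \<in> P} \<le> 2 ^ k"
  using assms(2)
proof (induction k)
  case 0
  have "{P. is_prime_ideal (ring_of_integers (F 0)) P \<and> of_int p \<in> P} \<subseteq> {range (\<lambda>k. of_int (p * k))}"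
    using prime_ideals_of_Ints_containing[OF assms(1)]
    by (auto simp: multiquadratic_field_0 ring_of_integers_Rats)
  from finite_subset[OF this] card_mono[OF _ this] show ?case
    by simp
next
  case (Suc k)
  interpret quadratic_extension "F k" "rt (Suc k)" "a (Suc k)"
    using extension(1) Suc.prems by simp
  have L: "F (Suc k) = L"
    using extension(2) Suc.prems by simp
  have IH: "finite {P. is_prime_ideal OK P \<and> of_int p \<in> P}" "card {P. is_prime_ideal OK P \<and> of_int p \<in> P} \<le> 2 ^ k"
    using Suc by auto
  show ?case
    unfolding L using card_primes_containing[OF IH(1) K_closed(10)] IH(2) by auto
qed

lemma card_primes_over_int:
  assumes "m > 0" "k \<le> n"
  shows "finite {P. is_prime_ideal (ring_of_integers (F k)) P \<and> of_int m \<in> P}"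
    and "card {P. is_prime_ideal (ring_of_integers (F k)) P \<and> of_int m \<in> P}
      \<le> card (prime_factors m) * 2 ^ k"
proof -
  define A where "A q = {P. is_prime_ideal (ring_of_integers (F k)) P \<and> of_int q \<in> P}" for q :: int
  have sub: "A m \<subseteq> (\<Union>q\<in>prime_factors m. A q)"
    using prime_ideal_contains_prime_factor[OF _ subfield_multiquadratic assms(1)] unfolding A_def by blast
  have A: "finite (A q) \<and> card (A q) \<le> 2 ^ k" if "q \<in> prime_factors m" for q
    unfolding A_def using that assms(2) by (intro card_primes_over) auto
  have fin: "finite (\<Union>q\<in>prime_factors m. A q)"
    using A by blast
  show "finite {P. is_prime_ideal (ring_of_integers (F k)) P \<and> of_int m \<in> P}"
    using finite_subset[OF sub fin] by (simp add: A_def)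
  have "card (A m) \<le> card (\<Union>q\<in>prime_factors m. A q)"
    by (rule card_mono[OF fin sub])
  also have "\<dots> \<le> (\<Sum>q\<in>prime_factors m. card (A q))"
    by (rule card_UN_le) simp
  also have "\<dots> \<le> (\<Sum>q\<in>prime_factors m. 2 ^ k)"
    using A by (intro sum_mono) auto
  finally show "card {P. is_prime_ideal (ring_of_integers (F k)) P \<and> of_int m \<in> P}
      \<le> card (prime_factors m) * 2 ^ k"
    by (simp add: A_def)
qed

text \<open>The recursion \<open>e' = w * 2^k + 2 * e\<close> is solved in doubled form, since the
  exponent \<open>k - 1\<close> of 2 would not make sense at k = 0.\<close>

lemma square_cover_multiquadratic:
  assumes "k \<le> n"
  shows "\<exists>R e. square_cover (F k) R \<and> card R \<le> 2 ^ e \<and>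
    2 * e = 2 ^ k * (\<Sum>i\<in>{1..k}. card (prime_factors (a i)))"
  using assms
proof (induction k)
  case 0
  show ?case
    using square_cover_Rats by (intro exI[of _ "{1}"] exI[of _ 0]) (simp add: multiquadratic_field_0)
next
  case (Suc k)
  define w where "w = card (prime_factors (a (Suc k)))"
  obtain R e where R: "square_cover (F k) R" "card R \<le> 2 ^ e"
    "2 * e = 2 ^ k * (\<Sum>i\<in>{1..k}. card (prime_factors (a i)))"
    using Suc by auto
  interpret quadratic_extension "F k" "rt (Suc k)" "a (Suc k)"
    using extension(1) Suc.prems by simp
  have L: "F (Suc k) = L"
    using extension(2) Suc.prems by simp
  have i: "Suc k \<in> {1..n}" "k \<le> n"
    using Suc.prems by auto
  have pos: "a (Suc k) > 0"
    using ge2[OF i(1)] by simp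
  note fin = card_primes_over_int[OF pos i(2)]
  have "L \<subseteq> \<real>"
    using field_real[of "Suc k"] Suc.prems L by simp
  then obtain R' where R': "square_cover L R'"
    "card R' \<le> 2 ^ card {p. is_prime_ideal OK p \<and> of_int (a (Suc k)) \<in> p} * (card R)\<^sup>2"
    using square_cover_extend[OF pos mod4[OF i(1)] _ fin(1) R(1)] by blast
  note R'(2)
  also have "\<dots> \<le> 2 ^ (w * 2 ^ k) * (2 ^ e)\<^sup>2"
    using fin(2) R(2) by (intro mult_mono power_mono power_increasing) (auto simp: w_def)
  also have "\<dots> = 2 ^ (w * 2 ^ k + 2 * e)"
    by (simp add: power_add mult.commute flip: power_mult)
  finally have "card R' \<le> 2 ^ (w * 2 ^ k + 2 * e)" .
  moreover have "2 * (w * 2 ^ k + 2 * e) = 2 ^ Suc k * (\<Sum>i\<in>{1..Suc k}. card (prime_factors (a i)))"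
    using R(3) by (simp add: w_def algebra_simps)
  ultimately show ?case
    using R'(1) unfolding L by (intro exI[of _ R'] exI[of _ "w * 2 ^ k + 2 * e"] conjI)
qed

end

section \<open>Totally positive units\<close>

text \<open>Dirichlet's two pigeonholes: infinitely many good approximations h/k of
  \<open>\<theta>\<close> have bounded norm \<open>h\<^sup>2 - D * k\<^sup>2\<close>, so infinitely
  many share one norm m, and two of these agree modulo m. Their quotient is then integral of norm
  1.\<close>

lemma pell_equation_solvable:
  fixes D :: int
  assumes "D > 0" and nonsquare: "\<And>z. D \<noteq> z\<^sup>2"
  obtains x y :: int where "x > 0" "y > 0" "x\<^sup>2 - D * y\<^sup>2 = 1"
proof -
  define \<theta> where "\<theta> = sqrt (real_of_int D)"
  have \<theta>: "\<theta>\<^sup>2 = real_of_int D" "\<theta> \<ge> 0"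
    using assms(1) by (auto simp: \<theta>_def)
  have "\<theta> \<notin> \<rat>"
  proof
    assume rat: "\<theta> \<in> \<rat>"
    have "algebraic_int \<theta>"
      unfolding \<theta>_def by (intro algebraic_int_sqrt int_imp_algebraic_int) simp
    from rational_algebraic_int_is_int[OF this rat] obtain z where "\<theta> = of_int z"
      by (rule Ints_cases)
    then have "real_of_int (z\<^sup>2) = real_of_int D"
      using \<theta>(1) by simp
    then have "z\<^sup>2 = D"
      by (simp only: of_int_eq_iff)
    then show False
      using nonsquare[of z] by simp
  qed
  then have inf: "infinite (approx_set \<theta>)"
    using rational_iff_finite_approx_set by blast
  define N where "N = (\<lambda>(h, k). h\<^sup>2 - D * k\<^sup>2 :: int)"
  \<comment> \<open>With \<open>\<bar>h - k * \<theta>\<bar> \<le> 1 / k\<close>, the norm is at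
    most \<open>(1 / k) * (1 / k + 2 * k * \<theta>)\<close> in absolute value, hence at most
    \<open>1 + 2 * \<theta>\<close>.\<close>
  define B where "B = \<lceil>1 + 2 * \<theta>\<rceil>"
  have bound: "N hk \<in> {- B..B}" if hk: "hk \<in> approx_set \<theta>" for hk
  proof -
    obtain h k where *: "hk = (h, k)" "k > 0" "\<bar>\<theta> - of_int h / of_int k\<bar> < 1 / (of_int k)\<^sup>2"
      using hk by (auto simp: approx_set_def)
    define r where "r = real_of_int k"
    have r: "r \<ge> 1"
      using *(2) by (simp add: r_def)
    have "\<bar>of_int h - r * \<theta>\<bar> = r * \<bar>\<theta> - of_int h / r\<bar>"
      using r by (simp add: abs_mult_pos' abs_minus_commute right_diff_distrib flip: abs_mult_pos)
    also have "\<dots> \<le> r * (1 / r\<^sup>2)"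
      using *(3) r by (intro mult_left_mono) (auto simp: r_def)
    finally have 1: "\<bar>of_int h - r * \<theta>\<bar> \<le> 1 / r"
      using r by (simp add: power2_eq_square)
    have "r * \<theta> \<ge> 0"
      using \<theta>(2) r by simp
    then have "\<bar>of_int h + r * \<theta>\<bar> \<le> \<bar>of_int h - r * \<theta>\<bar> + 2 * r * \<theta>"
      by linarith
    also have "\<dots> \<le> 1 / r + 2 * r * \<theta>"
      using 1 by simp
    finally have 2: "\<bar>of_int h + r * \<theta>\<bar> \<le> 1 / r + 2 * r * \<theta>" .
    have "real_of_int (N hk) = (of_int h - r * \<theta>) * (of_int h + r * \<theta>)"
      using \<theta>(1) by (simp add: N_def *(1) r_def power2_eq_square algebra_simps)
    then have "\<bar>real_of_int (N hk)\<bar> = \<bar>of_int h - r * \<theta>\<bar> * \<bar>of_int h + r * \<theta>\<bar>"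
      by (simp add: abs_mult)
    also have "\<dots> \<le> (1 / r) * (1 / r + 2 * r * \<theta>)"
      using 1 2 r by (intro mult_mono) auto
    also have "\<dots> = 1 / r\<^sup>2 + 2 * \<theta>"
      using r by (simp add: field_simps power2_eq_square)
    also have "\<dots> \<le> 1 + 2 * \<theta>"
      using r by (simp add: divide_le_eq_1)
    also have "\<dots> \<le> of_int B"
      by (simp add: B_def)
    finally have "\<bar>N hk\<bar> \<le> B"
      by linarith
    then show ?thesis
      by auto
  qed
  have "N ` approx_set \<theta> \<subseteq> {- B..B}"
    using bound by (rule image_subsetI)
  then have "finite (N ` approx_set \<theta>)"
    by (rule finite_subset) simp
  then obtain p0 where p0: "p0 \<in> approx_set \<theta>" "infinite {p \<in> approx_set \<theta>. N p = N p0}"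
    using pigeonhole_infinite[OF inf, of N] by blast
  define m where "m = N p0"
  define A where "A = {p \<in> approx_set \<theta>. N p = m}"
  have m: "m \<noteq> 0"
  proof
    assume "m = 0"
    moreover obtain h k where hk: "p0 = (h, k)" "k > 0"
      using p0(1) by (auto simp: approx_set_def)
    ultimately have "h\<^sup>2 = D * k\<^sup>2"
      by (simp add: m_def N_def)
    then have "real_of_int D = (of_int h / of_int k)\<^sup>2"
      using hk(2) by (simp add: field_simps flip: of_int_power of_int_mult)
    then have "\<theta> = \<bar>of_int h / of_int k\<bar>"
      by (simp add: \<theta>_def)
    then show False
      using \<open>\<theta> \<notin> \<rat>\<close> by auto
  qed
  define g where "g = (\<lambda>(h :: int, k :: int). (h mod m, k mod m))"
  have "finite (g ` A)"
  proof (rule finite_subset)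
    show "g ` A \<subseteq> {- \<bar>m\<bar>..\<bar>m\<bar>} \<times> {- \<bar>m\<bar>..\<bar>m\<bar>}"
    proof
      fix z assume "z \<in> g ` A"
      then obtain h k where z: "z = (h mod m, k mod m)"
        by (auto simp: g_def)
      have "\<bar>h mod m\<bar> \<le> \<bar>m\<bar>" "\<bar>k mod m\<bar> \<le> \<bar>m\<bar>"
        using abs_mod_less[OF m, of h] abs_mod_less[OF m, of k] by auto
      then show "z \<in> {- \<bar>m\<bar>..\<bar>m\<bar>} \<times> {- \<bar>m\<bar>..\<bar>m\<bar>}"
        using z by auto
    qed
  qed simp
  moreover have "infinite A"
    using p0(2) by (simp add: A_def m_def)
  ultimately obtain q0 where "q0 \<in> A" "infinite {p \<in> A. g p = g q0}"
    using pigeonhole_infinite[of A g] by blast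
  then have "infinite ({p \<in> A. g p = g q0} - {q0})"
    by simp
  then obtain q1 where "q1 \<in> {p \<in> A. g p = g q0} - {q0}"
    using infinite_imp_nonempty by blast
  then have q1: "q1 \<in> A" "g q1 = g q0" "q1 \<noteq> q0"
    by auto
  obtain h k where hk: "q0 = (h, k)" "k > 0" "h\<^sup>2 - D * k\<^sup>2 = m"
    using \<open>q0 \<in> A\<close> by (auto simp: A_def approx_set_def N_def)
  obtain h' k' where hk': "q1 = (h', k')" "k' > 0" "h'\<^sup>2 - D * k'\<^sup>2 = m"
    using q1(1) by (auto simp: A_def approx_set_def N_def)
  have cong: "m dvd h' - h" "m dvd k' - k"
    using q1(2) by (auto simp: g_def hk(1) hk'(1) mod_eq_dvd_iff)
  \<comment> \<open>The integers x and y found here are the coordinates of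
    \<open>(h' + k' * \<theta>) / (h + k * \<theta>)\<close>, computed as
    \<open>(h' + k' * \<theta>) * (h - k * \<theta>) / m\<close>. The congruences modulo m make both
    divisible.\<close>
  have "m dvd h * k' - h' * k"
  proof -
    have "h * k' - h' * k = h * (k' - k) - (h' - h) * k"
      by (simp add: algebra_simps)
    then show ?thesis
      using cong by simp
  qed
  then obtain y where y: "h * k' - h' * k = m * y"
    by (auto simp: dvd_def)
  have "m dvd h * h' - D * (k * k')"
  proof -
    have "h * h' - D * (k * k') = m + (h * (h' - h) - D * (k * (k' - k)))"
      using hk(3) by (simp add: algebra_simps power2_eq_square)
    then show ?thesis
      using cong by simp
  qed
  then obtain x where x: "h * h' - D * (k * k') = m * x"
    by (auto simp: dvd_def)
  have "m\<^sup>2 * (x\<^sup>2 - D * y\<^sup>2) = (m * x)\<^sup>2 - D * (m * y)\<^sup>2"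
    by (simp add: algebra_simps power2_eq_square)
  also have "\<dots> = (h\<^sup>2 - D * k\<^sup>2) * (h'\<^sup>2 - D * k'\<^sup>2)"
    unfolding x[symmetric] y[symmetric] by (simp add: algebra_simps power2_eq_square)
  also have "\<dots> = m\<^sup>2"
    unfolding hk(3) hk'(3) by (simp add: power2_eq_square)
  finally have one: "x\<^sup>2 - D * y\<^sup>2 = 1"
    using m by simp
  have "y \<noteq> 0"
  proof
    assume "y = 0"
    then have e: "h * k' = h' * k"
      using y by simp
    have "m * k'\<^sup>2 = (h * k')\<^sup>2 - D * (k * k')\<^sup>2"
      unfolding hk(3)[symmetric] by (simp add: algebra_simps power2_eq_square)
    also have "\<dots> = m * k\<^sup>2"
      unfolding hk'(3)[symmetric] e by (simp add: algebra_simps power2_eq_square)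
    finally have "k' = k"
      using m hk(2) hk'(2) by (simp add: power2_eq_iff)
    then show False
      using e hk hk' q1(3) by simp
  qed
  moreover have "x \<noteq> 0"
  proof
    assume "x = 0"
    then have "D * y\<^sup>2 = - 1"
      using one by simp
    moreover have "D * y\<^sup>2 \<ge> 0"
      using assms(1) by simp
    ultimately show False
      by simp
  qed
  ultimately show thesis
    using that[of "\<bar>x\<bar>" "\<bar>y\<bar>"] one by simp
qed

text \<open>Take \<open>m i\<close> with minimal positive value of \<open>f i\<close> among the elements killed by all \<open>f j\<close>, \<open>j < i\<close>.
  If a product of some \<open>m i\<close> were a square, then its root would have half the minimal value at the
  first index involved.\<close>

lemma independent_mod_squares:
  fixes E :: "complex set" and f :: "nat \<Rightarrow> complex \<Rightarrow> real" and h :: "nat \<Rightarrow> complex \<Rightarrow> nat"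
  assumes E: "1 \<in> E" "\<And>x y. x \<in> E \<Longrightarrow> y \<in> E \<Longrightarrow> x * y \<in> E" "\<And>x. x \<in> E \<Longrightarrow> inverse x \<in> E" "0 \<notin> E"
    and f: "\<And>i x y. x \<in> E \<Longrightarrow> y \<in> E \<Longrightarrow> f i (x * y) = f i x + f i y"
    and h: "\<And>i x y. i < N \<Longrightarrow> x \<in> E \<Longrightarrow> y \<in> E \<Longrightarrow> 0 < f i x \<Longrightarrow> f i x < f i y \<Longrightarrow> h i x < h i y"
    and ex: "\<And>i. i < N \<Longrightarrow> \<exists>e\<in>E. f i e > 0 \<and> (\<forall>j<i. f j e = 0)"
  obtains m where "\<And>i. i < N \<Longrightarrow> m i \<in> E"
    "\<And>A B \<gamma>. A \<subseteq> {..<N} \<Longrightarrow> B \<subseteq> {..<N} \<Longrightarrow> \<gamma> \<in> E \<Longrightarrow> (\<Prod>i\<in>A. m i) = (\<Prod>i\<in>B. m i) * \<gamma>\<^sup>2 \<Longrightarrow> A = B"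
proof -
  define good where "good i e \<longleftrightarrow> e \<in> E \<and> f i e > 0 \<and> (\<forall>j<i. f j e = 0)" for i e
  \<comment> \<open>A set of positive reals need not attain its infimum, so the natural number
    \<open>h i\<close>, increasing along positive values of \<open>f i\<close>, is minimised
    instead.\<close>
  define m where "m i = (ARG_MIN (h i) e. good i e)" for i
  have m: "good i (m i)" "\<And>e. good i e \<Longrightarrow> h i (m i) \<le> h i e" if i: "i < N" for i
  proof -
    obtain e where e: "good i e"
      using ex[OF i] by (auto simp: good_def)
    show "good i (m i)"
      unfolding m_def by (rule arg_min_natI[of "good i", OF e])
    show "\<And>e. good i e \<Longrightarrow> h i (m i) \<le> h i e"
      unfolding m_def by (rule arg_min_nat_le)
  qed
  have mE: "m i \<in> E" if "i < N" for i
    using m(1)[OF that] by (simp add: good_def)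
  have f1: "f i 1 = 0" for i
    using f[OF E(1) E(1), of i] by simp
  have prodE: "(\<Prod>i\<in>A. m i) \<in> E \<and> f j (\<Prod>i\<in>A. m i) = (\<Sum>i\<in>A. f j (m i))" if "A \<subseteq> {..<N}" for A j
  proof -
    have "finite A"
      using that finite_subset by blast
    then show ?thesis
      using that by (induction A) (auto simp: E(1) f1 E(2) f mE)
  qed
  have key: False
    if AB: "A \<subseteq> {..<N}" "B \<subseteq> {..<N}" "\<gamma> \<in> E" "(\<Prod>i\<in>A. m i) = (\<Prod>i\<in>B. m i) * \<gamma>\<^sup>2"
      and i: "i \<in> A" "i \<notin> B" and below: "\<And>j. j < i \<Longrightarrow> j \<in> A \<longleftrightarrow> j \<in> B" for A B \<gamma> i
  proof -
    have fin: "finite A" "finite B"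
      using AB finite_subset by blast+
    have iN: "i < N"
      using AB(1) i(1) by auto
    have eq: "2 * f j \<gamma> = (\<Sum>l\<in>A. f j (m l)) - (\<Sum>l\<in>B. f j (m l))" for j
    proof -
      have "(\<Sum>l\<in>A. f j (m l)) = f j ((\<Prod>i\<in>B. m i) * (\<gamma> * \<gamma>))"
        using prodE[OF AB(1)] AB(4) by (metis power2_eq_square)
      also have "\<dots> = (\<Sum>l\<in>B. f j (m l)) + (f j \<gamma> + f j \<gamma>)"
        using prodE[OF AB(2)] AB(3) by (simp add: f E(2))
      finally show ?thesis by simp
    qed
    \<comment> \<open>The system is triangular: \<open>f j (m l)\<close> vanishes for j < l. Up to
      i, the sums over A and B therefore differ by the single term at i.\<close>
    have split: "(\<Sum>l\<in>X. f j (m l)) = (\<Sum>l\<in>X \<inter> {..<i}. f j (m l)) + (if j = i \<and> i \<in> X then f i (m i) else 0)"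
      if X: "X \<subseteq> {..<N}" "j \<le> i" for X j
    proof -
      have finX: "finite X"
        using X(1) finite_subset by blast
      have zero: "f j (m l) = 0" if "l \<in> X" "j < l" for l
        using m(1)[of l] X(1) that by (auto simp: good_def)
      have "(\<Sum>l\<in>X. f j (m l)) = (\<Sum>l\<in>X \<inter> {..<i}. f j (m l)) + (\<Sum>l\<in>X - {..<i}. f j (m l))"
        by (rule sum.Int_Diff[OF finX])
      also have "(\<Sum>l\<in>X - {..<i}. f j (m l)) = (\<Sum>l\<in>X - {..<i}. if l = i \<and> j = i then f i (m i) else 0)"
        using zero X(2) by (intro sum.cong) auto
      also have "\<dots> = (if j = i \<and> i \<in> X then f i (m i) else 0)"
      proof (cases "j = i")
        case True
        then show ?thesis
          using finX by simp
      qed simp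
      finally show ?thesis .
    qed
    have same: "A \<inter> {..<i} = B \<inter> {..<i}"
      using below by auto
    have "f j \<gamma> = 0" if "j < i" for j
      using eq[of j] split[OF AB(1), of j] split[OF AB(2), of j] that by (simp add: same)
    moreover have half: "2 * f i \<gamma> = f i (m i)"
      using eq[of i] split[OF AB(1), of i] split[OF AB(2), of i] i by (simp add: same)
    moreover have pos: "f i (m i) > 0"
      using m(1)[OF iN] by (simp add: good_def)
    ultimately have "good i \<gamma>"
      using AB(3) by (auto simp: good_def)
    then have "h i (m i) \<le> h i \<gamma>"
      by (rule m(2)[OF iN])
    moreover have "h i \<gamma> < h i (m i)"
      using half pos by (intro h[OF iN AB(3) mE[OF iN]]) auto
    ultimately show False
      by simp
  qed
  show thesis
  proof (rule that)
    show "\<And>i. i < N \<Longrightarrow> m i \<in> E"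
      by (rule mE)
    fix A B \<gamma>
    assume AB: "A \<subseteq> {..<N}" "B \<subseteq> {..<N}" "\<gamma> \<in> E" "(\<Prod>i\<in>A. m i) = (\<Prod>i\<in>B. m i) * \<gamma>\<^sup>2"
    show "A = B"
    proof (rule ccontr)
      assume "A \<noteq> B"
      then have "\<exists>i. (i \<in> A) \<noteq> (i \<in> B)"
        by blast
      define i where "i = (LEAST i. (i \<in> A) \<noteq> (i \<in> B))"
      have i: "(i \<in> A) \<noteq> (i \<in> B)"
        unfolding i_def by (rule LeastI_ex) fact
      have below: "j \<in> A \<longleftrightarrow> j \<in> B" if "j < i" for j
        using not_less_Least[OF that[unfolded i_def]] by blast
      show False
      proof (cases "i \<in> A")
        case True
        then show ?thesis
          using key[OF AB] i below by blast
      next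
        case False
        have "\<gamma> \<noteq> 0"
          using AB(3) E(4) by auto
        then have "(\<Prod>i\<in>B. m i) = (\<Prod>i\<in>A. m i) * (inverse \<gamma>)\<^sup>2"
          using AB(4) by (simp add: field_simps)
        then show ?thesis
          using key[OF AB(2,1) E(3)[OF AB(3)]] False i below by blast
      qed
    qed
  qed
qed

section \<open>Characters and automorphisms of the multiquadratic field\<close>

text \<open>For finite S this is \<open>(-1) ^ card (S \<inter> T)\<close>. Here T stands for the
  automorphism negating the roots with index in T, and S for the product of the roots with index in
  S; the value is the sign by which T acts on that product.\<close>

definition sign_char :: "nat set \<Rightarrow> nat set \<Rightarrow> int" where
  "sign_char S T = (\<Prod>i\<in>S. if i \<in> T then - 1 else 1)"

lemma sign_char_cases: "sign_char S T = 1 \<or> sign_char S T = - 1"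
  unfolding sign_char_def by (induction S rule: infinite_finite_induct) auto

lemma sign_char_sym_diff: "sign_char S (sym_diff T T') = sign_char S T * sign_char S T'"
  unfolding sign_char_def prod.distrib[symmetric] by (rule prod.cong) auto

lemma bij_sym_diff:
  assumes "T' \<subseteq> A" shows "bij_betw (\<lambda>T. sym_diff T T') (Pow A) (Pow A)"
  by (rule bij_betw_byWitness[where f' = "\<lambda>T. sym_diff T T'"]) (use assms in auto)

text \<open>Composing with the automorphism of a single index in exactly one of S and S' permutes
  the summands and changes every sign.\<close>

lemma sign_char_orthogonal:
  assumes "finite A" "S \<subseteq> A" "S' \<subseteq> A" "S \<noteq> S'"
  shows "(\<Sum>T\<in>Pow A. sign_char S T * sign_char S' T) = 0"
proof -
  obtain i where i: "i \<in> A" "(i \<in> S) \<noteq> (i \<in> S')"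
    using assms by blast
  have single: "sign_char X {i} = (if i \<in> X then - 1 else 1)" if "X \<subseteq> A" for X
  proof -
    have "finite X"
      using that assms(1) finite_subset by blast
    have "sign_char X {i} = (\<Prod>j\<in>X. if j = i then - 1 else 1)"
      unfolding sign_char_def by (rule prod.cong) auto
    then show ?thesis
      using \<open>finite X\<close> by simp
  qed
  have "(\<Sum>T\<in>Pow A. sign_char S T * sign_char S' T) =
      (\<Sum>T\<in>Pow A. sign_char S (sym_diff T {i}) * sign_char S' (sym_diff T {i}))"
    by (rule sum.reindex_bij_betw[OF bij_sym_diff, symmetric]) (use i in auto)
  also have "\<dots> = (\<Sum>T\<in>Pow A. - (sign_char S T * sign_char S' T))"
    using i(2) single[OF assms(2)] single[OF assms(3)] by (intro sum.cong) (auto simp: sign_char_sym_diff)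
  also have "\<dots> = - (\<Sum>T\<in>Pow A. sign_char S T * sign_char S' T)"
    by (rule sum_negf)
  finally show ?thesis
    by simp
qed

lemma embeddings_agree:
  assumes g: "field_embedding (multiquadratic_field k a) g" and h: "field_embedding (multiquadratic_field k a) h"
    and eq: "\<And>i. i \<in> {1..k} \<Longrightarrow> g (csqrt (of_int (a i))) = h (csqrt (of_int (a i)))"
    and x: "x \<in> multiquadratic_field k a"
  shows "g x = h x"
proof -
  let ?F = "multiquadratic_field k a"
  note F = subfieldD[OF subfield_multiquadratic[of k a]]
  note g = embeddingD[OF subfield_multiquadratic g] and h = embeddingD[OF subfield_multiquadratic h]
  have "is_subfield {x \<in> ?F. g x = h x}"
    unfolding is_subfield_def
  proof (intro conjI ballI impI)
    show "0 \<in> {x \<in> ?F. g x = h x}" "1 \<in> {x \<in> ?F. g x = h x}"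
      using F(1,2) g(1,2) h(1,2) by simp_all
  next
    fix x y assume "x \<in> {x \<in> ?F. g x = h x}" "y \<in> {x \<in> ?F. g x = h x}"
    then have xy: "x \<in> ?F" "y \<in> ?F" "g x = h x" "g y = h y"
      by auto
    show "x + y \<in> {x \<in> ?F. g x = h x}" "x - y \<in> {x \<in> ?F. g x = h x}" "x * y \<in> {x \<in> ?F. g x = h x}"
      using F(3-5)[OF xy(1,2)] g(3,4,6)[OF xy(1,2)] h(3,4,6)[OF xy(1,2)] xy(3,4) by simp_all
  next
    fix x assume "x \<in> {x \<in> ?F. g x = h x}"
    then have x: "x \<in> ?F" "g x = h x"
      by auto
    show "inverse x \<in> {x \<in> ?F. g x = h x}"
      using F(7)[OF x(1)] g(7)[OF x(1)] h(7)[OF x(1)] x(2) by simp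
  qed
  moreover have "(\<lambda>i. csqrt (of_int (a i))) ` {1..k} \<subseteq> {x \<in> ?F. g x = h x}"
    using eq csqrt_in_multiquadratic by auto
  ultimately have "?F \<subseteq> {x \<in> ?F. g x = h x}"
    unfolding multiquadratic_field_def[of k] by (rule field_generated_least)
  then show ?thesis
    using x by blast
qed

context multiquadratic_tower
begin

abbreviation "K \<equiv> F n"

lemmas subfield_K = subfield_multiquadratic[of n a]

definition sign_embedding :: "nat \<Rightarrow> nat set \<Rightarrow> (complex \<Rightarrow> complex) \<Rightarrow> bool" where
  "sign_embedding k T g \<longleftrightarrow> field_embedding (F k) g \<and> g ` F k \<subseteq> F k \<and>
     (\<forall>i\<in>{1..k}. g (rt i) = (if i \<in> T then - rt i else rt i))"

lemma sign_embedding_extend: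
  assumes k: "k < n" and g: "sign_embedding k T g"
  shows "sign_embedding (Suc k) T
    (extend_embedding (F k) (rt (Suc k)) g (if Suc k \<in> T then - rt (Suc k) else rt (Suc k)))"
    (is "sign_embedding _ _ ?e")
proof -
  interpret quadratic_extension "F k" "rt (Suc k)" "a (Suc k)"
    by (rule extension(1)[OF k])
  have L: "F (Suc k) = L"
    by (rule extension(2)[OF k])
  define t where "t = (if Suc k \<in> T then - rt (Suc k) else rt (Suc k))"
  have t: "t\<^sup>2 = of_int (a (Suc k))" "t \<in> L"
    using square s_in_L L_closed(6) by (auto simp: t_def)
  have g': "field_embedding (F k) g" "g ` F k \<subseteq> F k" "\<And>i. i \<in> {1..k} \<Longrightarrow> g (rt i) = (if i \<in> T then - rt i else rt i)"
    using g by (auto simp: sign_embedding_def)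
  note g0 = embeddingD(1,2)[OF subfield g'(1)]
  have "field_embedding L (extend_embedding (F k) (rt (Suc k)) g t)"
    by (rule embedding_extend[OF g'(1) t(1)])
  moreover have "extend_embedding (F k) (rt (Suc k)) g t ` L \<subseteq> L"
  proof (rule image_subsetI)
    fix z assume "z \<in> L"
    then obtain x y where xy: "z = x + y * rt (Suc k)" "x \<in> F k" "y \<in> F k"
      by (rule L_E)
    then have "g x \<in> L" "g y \<in> L"
      using g'(2) K_sub_L by auto
    then show "extend_embedding (F k) (rt (Suc k)) g t z \<in> L"
      unfolding xy(1) extend_eq[OF xy(2,3)] using t(2) by (intro L_closed)
  qed
  moreover have "extend_embedding (F k) (rt (Suc k)) g t (rt i) = (if i \<in> T then - rt i else rt i)"
    if "i \<in> {1..Suc k}" for i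
  proof (cases "i = Suc k")
    case True
    then show ?thesis
      using extend_s[of g t] g0 by (simp add: t_def)
  next
    case False
    then have i: "i \<in> {1..k}"
      using that by auto
    then show ?thesis
      using extend_on_K[OF csqrt_in_multiquadratic[OF i], of g t] g0(1) g'(3) by simp
  qed
  ultimately show ?thesis
    unfolding sign_embedding_def L t_def by blast
qed

lemma ex_sign_embedding:
  assumes "k \<le> n" shows "\<exists>g. sign_embedding k T g"
  using assms
proof (induction k)
  case 0
  show ?case
    by (intro exI[of _ id]) (auto simp: sign_embedding_def field_embedding_def)
next
  case (Suc k)
  then show ?case
    using sign_embedding_extend[of k T] by auto
qed

text \<open>The rationals are the fixed field of the Galois group. Each g on the lower field has two
  extensions; since both fix \<open>u + v * \<surd>a\<close>, comparing them gives
  \<open>g v = 0\<close> and \<open>g u = u\<close>, and induction applies to u.\<close>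

lemma fixed_by_sign_embeddings:
  assumes "k \<le> n" "x \<in> F k" "\<And>T g. sign_embedding k T g \<Longrightarrow> g x = x"
  shows "x \<in> \<rat>"
  using assms
proof (induction k arbitrary: x)
  case 0
  then show ?case
    by (simp add: multiquadratic_field_0)
next
  case (Suc k)
  then have k: "k < n" by simp
  interpret quadratic_extension "F k" "rt (Suc k)" "a (Suc k)"
    by (rule extension(1)[OF k])
  have L: "F (Suc k) = L"
    by (rule extension(2)[OF k])
  obtain u v where uv: "x = u + v * rt (Suc k)" "u \<in> F k" "v \<in> F k"
    using Suc.prems(2) unfolding L by (rule L_E)
  have fixed: "g u = u \<and> g v = 0" if g: "sign_embedding k T g" for T g
  proof -
    \<comment> \<open>At level k the index \<open>Suc k\<close> in T is irrelevant, so it may be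
      added or removed to select either extension.\<close>
    have restrict: "sign_embedding k T' g" if "T' \<inter> {1..k} = T \<inter> {1..k}" for T'
    proof -
      have "i \<in> T' \<longleftrightarrow> i \<in> T" if "i \<in> {1..k}" for i
        using that \<open>T' \<inter> {1..k} = T \<inter> {1..k}\<close> by blast
      then show ?thesis
        using g unfolding sign_embedding_def by auto
    qed
    have "sign_embedding (Suc k) (insert (Suc k) T) (extend_embedding (F k) (rt (Suc k)) g (- rt (Suc k)))"
      using sign_embedding_extend[OF k restrict[of "insert (Suc k) T"]] by simp
    from Suc.prems(3)[OF this] have 1: "g u - g v * rt (Suc k) = x"
      unfolding uv(1) extend_eq[OF uv(2,3)] by simp
    have "T \<inter> {1..k} = (T - {Suc k}) \<inter> {1..k}"
      by auto
    then have "sign_embedding (Suc k) (T - {Suc k}) (extend_embedding (F k) (rt (Suc k)) g (rt (Suc k)))"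
      using sign_embedding_extend[OF k restrict[of "T - {Suc k}"]] by simp
    from Suc.prems(3)[OF this] have 2: "g u + g v * rt (Suc k) = x"
      unfolding uv(1) extend_eq[OF uv(2,3)] by simp
    have "rt (Suc k) \<noteq> 0"
      using notin K_closed(1) by metis
    have "g v * rt (Suc k) + g v * rt (Suc k) = 0"
      using 1 2 by (simp add: algebra_simps)
    then have gv: "g v = 0"
      using \<open>rt (Suc k) \<noteq> 0\<close> by simp
    then have "v = 0"
      using embeddingD(10)[OF subfield _ uv(3)] g unfolding sign_embedding_def by blast
    then show ?thesis
      using gv 1 uv(1) by simp
  qed
  obtain g where g: "sign_embedding k {} g"
    using ex_sign_embedding[of k "{}"] k by auto
  then have "v = 0"
    using fixed[OF g] embeddingD(10)[OF subfield _ uv(3)] unfolding sign_embedding_def by blast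
  moreover have "u \<in> \<rat>"
    using fixed k uv(2) by (intro Suc.IH) auto
  ultimately show ?case
    using uv(1) by simp
qed

definition aut :: "nat set \<Rightarrow> complex \<Rightarrow> complex" where
  "aut T = (SOME g. sign_embedding n T g)"

lemma aut: "sign_embedding n T (aut T)"
  unfolding aut_def by (rule someI_ex[OF ex_sign_embedding]) simp

lemma aut_embedding: "field_embedding K (aut T)"
  using aut by (simp add: sign_embedding_def)

lemmas aut_simps = embeddingD[OF subfield_K aut_embedding]

lemma aut_K: "x \<in> K \<Longrightarrow> aut T x \<in> K"
  using aut by (auto simp: sign_embedding_def)

lemma aut_rt: "i \<in> {1..n} \<Longrightarrow> aut T (rt i) = (if i \<in> T then - rt i else rt i)"
  using aut by (auto simp: sign_embedding_def)

lemma aut_aut: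
  assumes "x \<in> K" shows "aut T' (aut T x) = aut (sym_diff T T') x"
proof -
  have "(aut T' \<circ> aut T) x = aut (sym_diff T T') x"
  proof (rule embeddings_agree[OF _ aut_embedding _ assms])
    show "field_embedding K (aut T' \<circ> aut T)"
      using aut_K unfolding field_embedding_def by (simp add: aut_simps)
    fix i assume i: "i \<in> {1..n}"
    then show "(aut T' \<circ> aut T) (rt i) = aut (sym_diff T T') (rt i)"
      using csqrt_in_multiquadratic[OF i, of a] by (auto simp: aut_rt aut_simps)
  qed
  then show ?thesis
    by simp
qed

lemma aut_fixed_rational:
  assumes "x \<in> K" "\<And>T. T \<subseteq> {1..n} \<Longrightarrow> aut T x = x" shows "x \<in> \<rat>"
proof (rule fixed_by_sign_embeddings[OF le_refl assms(1)])
  fix T g assume g: "sign_embedding n T g"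
  have "g x = aut (T \<inter> {1..n}) x"
    by (rule embeddings_agree[OF _ aut_embedding _ assms(1)])
      (use g in \<open>auto simp: sign_embedding_def aut_rt\<close>)
  then show "g x = x"
    using assms(2)[of "T \<inter> {1..n}"] by simp
qed

lemma aut_real: "x \<in> K \<Longrightarrow> aut T x \<in> \<real>"
  using aut_K field_real by blast

lemma aut_totally_positive:
  assumes "totally_positive K x" shows "Re (aut T x) > 0"
  using tposD(3)[OF assms aut_embedding] aut_real by blast

section \<open>Logarithms of totally positive units\<close>

definition units :: "complex set" where
  "units = {u. totally_positive K u \<and> algebraic_int u \<and> algebraic_int (inverse u)}"

lemma units_mult: "u \<in> units \<Longrightarrow> w \<in> units \<Longrightarrow> u * w \<in> units"
  unfolding units_def
  using totally_positive_mult[OF subfield_K] by (auto simp: algebraic_int_add_mult)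

lemma units_inverse: "u \<in> units \<Longrightarrow> inverse u \<in> units"
  unfolding units_def using totally_positive_inverse[OF subfield_K] by auto

lemma units_1: "1 \<in> units"
  unfolding units_def using totally_positive_1[OF subfield_K] by simp

lemma units_K: "u \<in> units \<Longrightarrow> u \<in> K"
  unfolding units_def using tposD(1) by auto

text \<open>The component of the logarithmic embedding along the character S; all conjugates of a
  totally positive unit are positive reals, so no absolute values are taken.\<close>

definition log_char :: "nat set \<Rightarrow> complex \<Rightarrow> real" where
  "log_char S u = (\<Sum>T\<in>Pow {1..n}. of_int (sign_char S T) * ln (Re (aut T u)))"

lemma log_char_mult:
  assumes "u \<in> units" "w \<in> units"
  shows "log_char S (u * w) = log_char S u + log_char S w"
proof -
  have "ln (Re (aut T (u * w))) = ln (Re (aut T u)) + ln (Re (aut T w))" for T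
  proof -
    have "Re (aut T (u * w)) = Re (aut T u) * Re (aut T w)"
      using aut_real units_K assms
      by (intro embedding_real_mult[OF subfield_K aut_embedding]) auto
    moreover have "Re (aut T u) > 0" "Re (aut T w) > 0"
      using assms aut_totally_positive by (auto simp: units_def)
    ultimately show ?thesis
      by (simp add: ln_mult)
  qed
  then show ?thesis
    unfolding log_char_def by (simp add: distrib_left sum.distrib)
qed

text \<open>The product of the conjugates of u with the values of the character S as exponents, that
  is, the multiplicative counterpart of \<open>log_char\<close>.\<close>

definition char_unit :: "nat set \<Rightarrow> complex \<Rightarrow> complex" where
  "char_unit S u = (\<Prod>T\<in>Pow {1..n}. if sign_char S T = 1 then aut T u else inverse (aut T u))"

lemma char_unit_eq_exp:
  assumes "u \<in> units" shows "char_unit S u = of_real (exp (log_char S u))"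
proof -
  have "(if sign_char S T = 1 then aut T u else inverse (aut T u)) =
      of_real (exp (of_int (sign_char S T) * ln (Re (aut T u))))" for T
  proof -
    have pos: "Re (aut T u) > 0"
      using assms aut_totally_positive by (auto simp: units_def)
    have "of_real (Re (aut T u)) = aut T u"
      using aut_real[OF units_K[OF assms]] by simp
    then show ?thesis
      using sign_char_cases[of S T] pos by (auto simp: exp_minus)
  qed
  then show ?thesis
    unfolding char_unit_def log_char_def by (simp add: exp_sum)
qed

text \<open>An automorphism shifts the index of the product by a symmetric difference; undoing the
  shift multiplies all exponents by one value of the character. So the unit is an eigenvector of the
  Galois group.\<close>

lemma aut_char_unit:
  assumes "u \<in> units" "T' \<subseteq> {1..n}"
  shows "aut T' (char_unit S u) = (if sign_char S T' = 1 then char_unit S u else inverse (char_unit S u))"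
proof -
  define c where "c \<epsilon> z = (if \<epsilon> = (1 :: int) then z else inverse (z :: complex))" for \<epsilon> z
  have uK: "u \<in> K"
    using assms(1) by (rule units_K)
  have mem: "c (sign_char S T) (aut T u) \<in> K" for T
    using aut_K[OF uK] subfieldD(7)[OF subfield_K] by (auto simp: c_def)
  have "aut T' (char_unit S u) = (\<Prod>T\<in>Pow {1..n}. aut T' (c (sign_char S T) (aut T u)))"
    unfolding char_unit_def c_def[symmetric]
    by (rule conjunct1[OF embedding_prod[OF subfield_K aut_embedding mem]])
  also have "\<dots> = (\<Prod>T\<in>Pow {1..n}. c (sign_char S T) (aut (sym_diff T T') u))"
    using aut_K[OF uK] aut_aut[OF uK] by (intro prod.cong) (auto simp: c_def aut_simps)
  also have "\<dots> = (\<Prod>T\<in>Pow {1..n}. c (sign_char S (sym_diff T T')) (aut (sym_diff (sym_diff T T') T') u))"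
    by (rule prod.reindex_bij_betw[OF bij_sym_diff[OF assms(2)], symmetric])
  also have "\<dots> = (\<Prod>T\<in>Pow {1..n}. c (sign_char S T') (c (sign_char S T) (aut T u)))"
  proof (rule prod.cong)
    fix T
    have "sym_diff (sym_diff T T') T' = T"
      by auto
    then show "c (sign_char S (sym_diff T T')) (aut (sym_diff (sym_diff T T') T') u) =
        c (sign_char S T') (c (sign_char S T) (aut T u))"
      using sign_char_cases[of S T] sign_char_cases[of S T'] by (auto simp: sign_char_sym_diff c_def)
  qed simp
  also have "\<dots> = c (sign_char S T') (char_unit S u)"
  proof (cases "sign_char S T' = 1")
    case True
    then show ?thesis
      by (simp add: c_def char_unit_def)
  next
    case False
    then have "(\<Prod>T\<in>Pow {1..n}. c (sign_char S T') (c (sign_char S T) (aut T u))) =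
        (\<Prod>T\<in>Pow {1..n}. inverse (c (sign_char S T) (aut T u)))"
      by (simp add: c_def[of "sign_char S T'"])
    also have "\<dots> = inverse (\<Prod>T\<in>Pow {1..n}. c (sign_char S T) (aut T u))"
      using prod_inversef[of "\<lambda>T. c (sign_char S T) (aut T u)"] by (simp add: comp_def)
    finally show ?thesis
      using False by (simp add: c_def char_unit_def)
  qed
  finally show ?thesis
    by (simp add: c_def)
qed

text \<open>This is the discreteness needed for minimal choices. With
  \<open>v = exp (log_char S u)\<close>, every automorphism maps v to v or to its inverse, so the
  algebraic integer \<open>v + inverse v\<close> is rational, hence an integer, and it equals
  \<open>2 * cosh (log_char S u)\<close>.\<close>

lemma two_cosh_log_char_int:
  assumes "u \<in> units"
  obtains k :: int where "2 * cosh (log_char S u) = of_int k"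
proof -
  define v where "v = char_unit S u"
  have uK: "u \<in> K"
    using assms by (rule units_K)
  note K = subfieldD[OF subfield_K]
  have vK: "v \<in> K"
    unfolding v_def char_unit_def
    using aut_K[OF uK] K(7) by (intro subfield_prod[OF subfield_K]) auto
  have alg: "algebraic_int (aut T u)" "algebraic_int (inverse (aut T u))" for T
  proof -
    show "algebraic_int (aut T u)"
      using assms by (intro embedding_algebraic_int[OF subfield_K aut_embedding uK]) (simp add: units_def)
    have "algebraic_int (aut T (inverse u))"
      using assms by (intro embedding_algebraic_int[OF subfield_K aut_embedding K(7)[OF uK]]) (simp add: units_def)
    then show "algebraic_int (inverse (aut T u))"
      using aut_simps(7)[OF uK] by simp
  qed
  have "algebraic_int v"
    unfolding v_def char_unit_def using alg by (intro algebraic_int_prod) auto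
  moreover have "inverse v = (\<Prod>T\<in>Pow {1..n}. if sign_char S T = 1 then inverse (aut T u) else aut T u)"
    unfolding v_def char_unit_def prod_inversef[symmetric] by (intro prod.cong) auto
  then have "algebraic_int (inverse v)"
    using alg by (auto intro: algebraic_int_prod)
  ultimately have int: "algebraic_int (v + inverse v)"
    by (rule algebraic_int_add_mult)
  have fixed: "aut T (v + inverse v) = v + inverse v" if "T \<subseteq> {1..n}" for T
    using aut_char_unit[OF assms that, of S] vK K(7)[OF vK]
    by (simp add: aut_simps v_def add.commute)
  have "v + inverse v \<in> \<rat>"
    by (rule aut_fixed_rational[OF K(3)[OF vK K(7)[OF vK]] fixed])
  from rational_algebraic_int_is_int[OF int this]
  obtain k where k: "v + inverse v = of_int k"
    by (rule Ints_cases)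
  have "complex_of_real (2 * cosh (log_char S u)) = v + inverse v"
    unfolding v_def char_unit_eq_exp[OF assms] by (simp add: cosh_field_def exp_minus)
  then have "2 * cosh (log_char S u) = of_int k"
    using k by (metis of_real_eq_iff of_real_of_int_eq)
  then show thesis
    using that by blast
qed

text \<open>A Pell solution for the product D of the \<open>a i\<close> over S gives
  \<open>\<eta> = x + y * \<surd>D\<close> above 1 whose only other conjugate is its inverse, again
  positive. Under T its logarithm is multiplied by \<open>sign_char S T\<close>, so orthogonality
  kills every other component.\<close>

lemma pell_unit:
  assumes S: "S \<subseteq> {1..n}" "S \<noteq> {}"
  obtains u where "u \<in> units" "log_char S u > 0"
    "\<And>S'. S' \<subseteq> {1..n} \<Longrightarrow> S' \<noteq> S \<Longrightarrow> log_char S' u = 0"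
proof -
  define D where "D = (\<Prod>i\<in>S. a i)"
  define r where "r = (\<Prod>i\<in>S. sqrt (of_int (a i)))"
  have D2: "D \<ge> 2"
    unfolding D_def by (rule prod_ge2[OF S])
  have pos: "a i > 0" if "i \<in> S" for i
    using ge2[of i] S(1) that by auto
  have r: "r > 0" "r\<^sup>2 = of_int D"
    unfolding r_def D_def using pos by (auto intro!: prod_pos simp: prod_power_distrib less_imp_le)
  have rt: "rt i = of_real (sqrt (of_int (a i)))" if "i \<in> S" for i
    using pos[OF that] by simp
  have rK: "(\<Prod>i\<in>S. rt i) = of_real r"
    unfolding r_def of_real_prod using rt by (rule prod.cong[OF refl])
  have memr: "of_real r \<in> K"
    unfolding rK[symmetric] using S(1) csqrt_in_multiquadratic
    by (intro subfield_prod[OF subfield_K]) auto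
  have autr: "aut T (of_real r) = of_real (of_int (sign_char S T) * r)" for T
  proof -
    have "aut T (of_real r) = (\<Prod>i\<in>S. aut T (rt i))"
      unfolding rK[symmetric]
      using embedding_prod[OF subfield_K aut_embedding, of S rt] S(1) csqrt_in_multiquadratic by blast
    also have "\<dots> = (\<Prod>i\<in>S. of_int (if i \<in> T then - 1 else 1) * rt i)"
      using S(1) aut_rt by (intro prod.cong) auto
    also have "\<dots> = of_int (sign_char S T) * of_real r"
      by (simp add: prod.distrib rK sign_char_def)
    finally show ?thesis
      by simp
  qed
  have "D \<noteq> z\<^sup>2" for z
    using prod_not_square[OF S, of "of_int z"] unfolding D_def[symmetric] by (metis Rats_of_int of_int_power)
  then obtain x y where xy: "x > 0" "y > 0" "x\<^sup>2 - D * y\<^sup>2 = 1"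
    using pell_equation_solvable[of D] D2 by auto
  define \<eta> where "\<eta> = of_int x + of_int y * r"
  define \<eta>' where "\<eta>' = of_int x - of_int y * r"
  have "\<eta> * \<eta>' = of_int (x\<^sup>2 - D * y\<^sup>2)"
    using r(2) by (simp add: \<eta>_def \<eta>'_def algebra_simps power2_eq_square)
  then have prod: "\<eta> * \<eta>' = 1"
    using xy(3) by simp
  have "of_int x \<ge> (1 :: real)" "of_int y * r > 0"
    using xy(1,2) r(1) by auto
  then have \<eta>1: "\<eta> > 1"
    by (simp add: \<eta>_def)
  then have \<eta>'0: "\<eta>' > 0" and inv: "\<eta>' = inverse \<eta>"
    using prod zero_less_mult_pos[of \<eta> \<eta>'] by (auto simp: inverse_unique)
  define u where "u = complex_of_real \<eta>"
  have u: "u = of_int x + of_int y * of_real r"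
    by (simp add: u_def \<eta>_def)
  have K: "of_int x \<in> K" "of_int y \<in> K" "of_int y * of_real r \<in> K"
    using subfield_of_int[OF subfield_K] memr subfieldD(5)[OF subfield_K] by blast+
  have uK: "u \<in> K"
    unfolding u by (rule subfieldD(3)[OF subfield_K K(1,3)])
  have emb: "\<tau> u = of_int x + of_int y * \<tau> (of_real r)" if "field_embedding K \<tau>" for \<tau>
    unfolding u using embeddingD(3,4)[OF subfield_K that] K memr
      embedding_of_int[OF subfield_K that] by simp
  have tp: "totally_positive K u"
    unfolding totally_positive_def
  proof (intro conjI allI impI)
    show "u \<in> K" by fact
    show "u \<noteq> 0"
      using \<eta>1 by (auto simp: u_def)
    fix \<tau> assume \<tau>: "field_embedding K \<tau> \<and> \<tau> ` K \<subseteq> \<real>"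
    have "(\<tau> (of_real r))\<^sup>2 = \<tau> ((of_real r)\<^sup>2)"
      using embeddingD(9)[OF subfield_K _ memr] \<tau> by simp
    also have "(of_real r)\<^sup>2 = (of_int D :: complex)"
      using r(2) by (metis of_real_of_int_eq of_real_power)
    also have "\<tau> (of_int D) = of_int D"
      using embedding_of_int[OF subfield_K] \<tau> by blast
    also have "of_int D = (of_real r :: complex)\<^sup>2"
      using r(2) by (metis of_real_of_int_eq of_real_power)
    \<comment> \<open>Total positivity concerns arbitrary real embeddings, not only the
      automorphisms constructed above; the value on \<open>\<surd>D\<close> is still determined up
      to sign by its square.\<close>
    finally have "\<tau> (of_real r) = of_real r \<or> \<tau> (of_real r) = - of_real r"
      by (simp add: power2_eq_iff)
    then have "\<tau> u = of_real \<eta> \<or> \<tau> u = of_real \<eta>'"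
      using emb[of \<tau>] \<tau> by (auto simp: \<eta>_def \<eta>'_def)
    then show "Re (\<tau> u) > 0"
      using \<eta>1 \<eta>'0 by auto
  qed
  have alg_r: "algebraic_int (complex_of_real r)"
    unfolding rK[symmetric] by (intro algebraic_int_prod algebraic_int_csqrt int_imp_algebraic_int) simp
  have alg_int: "algebraic_int (of_int k :: complex)" for k
    by (rule int_imp_algebraic_int) simp
  have "algebraic_int u"
    unfolding u by (intro algebraic_int_add_mult alg_r alg_int)
  moreover have "inverse u = of_int x + of_int (- y) * of_real r"
    unfolding u_def of_real_inverse[symmetric] inv[symmetric] by (simp add: \<eta>'_def)
  then have "algebraic_int (inverse u)"
    by (simp only:) (intro algebraic_int_add_mult alg_r alg_int)
  ultimately have unit: "u \<in> units"
    using tp by (simp add: units_def)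
  have "Re (aut T u) = (if sign_char S T = 1 then \<eta> else \<eta>')" for T
    using sign_char_cases[of S T] emb[OF aut_embedding] autr[of T] by (auto simp: \<eta>_def \<eta>'_def)
  then have ln_aut: "ln (Re (aut T u)) = of_int (sign_char S T) * ln \<eta>" for T
    using sign_char_cases[of S T] \<eta>1 by (auto simp: inv ln_inverse)
  have log: "log_char S' u = of_int (\<Sum>T\<in>Pow {1..n}. sign_char S' T * sign_char S T) * ln \<eta>" for S'
    unfolding log_char_def ln_aut by (simp add: sum_distrib_right mult.assoc)
  show thesis
  proof (rule that[OF unit])
    have "sign_char S T * sign_char S T = 1" for T
      using sign_char_cases[of S T] by auto
    then have "(\<Sum>T\<in>Pow {1..n}. sign_char S T * sign_char S T) > 0"
      by (simp add: card_Pow)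
    then have "real_of_int (\<Sum>T\<in>Pow {1..n}. sign_char S T * sign_char S T) > 0"
      by (simp only: of_int_0_less_iff)
    then show "log_char S u > 0"
      unfolding log using \<eta>1 by (intro mult_pos_pos) simp_all
    fix S' assume "S' \<subseteq> {1..n}" "S' \<noteq> S"
    then show "log_char S' u = 0"
      unfolding log using sign_char_orthogonal[of "{1..n}" S' S] S(1) by simp
  qed
qed

lemma independent_units:
  obtains m :: "nat \<Rightarrow> complex" where "\<And>i. i < 2 ^ n - 1 \<Longrightarrow> m i \<in> units"
    "\<And>A B \<gamma>. A \<subseteq> {..<2 ^ n - 1} \<Longrightarrow> B \<subseteq> {..<2 ^ n - 1} \<Longrightarrow> \<gamma> \<in> units \<Longrightarrow>
      (\<Prod>i\<in>A. m i) = (\<Prod>i\<in>B. m i) * \<gamma>\<^sup>2 \<Longrightarrow> A = B"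
proof -
  note result = that
  define \<S> where "\<S> = Pow {1..n} - {{}}"
  have "card \<S> = 2 ^ n - 1"
    by (simp add: \<S>_def card_Pow)
  then obtain \<sigma> where \<sigma>: "bij_betw \<sigma> {..<2 ^ n - (1 :: nat)} \<S>"
    using ex_bij_betw_nat_finite[of \<S>] by (auto simp: \<S>_def atLeast0LessThan)
  have \<sigma>S: "\<sigma> i \<subseteq> {1..n}" "\<sigma> i \<noteq> {}" if "i < 2 ^ n - 1" for i
    using bij_betwE[OF \<sigma>] that by (auto simp: \<S>_def)
  have inj: "\<sigma> j \<noteq> \<sigma> i" if "i < 2 ^ n - 1" "j < 2 ^ n - 1" "j \<noteq> i" for i j
    using bij_betw_imp_inj_on[OF \<sigma>] that by (auto dest: inj_onD)
  define f where "f i = log_char (\<sigma> i)" for i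
  \<comment> \<open>On units the rounded number is already an integer; rounding merely gives it the
    type of natural numbers.\<close>
  define h where "h i u = nat \<lfloor>2 * cosh (f i u)\<rfloor>" for i u
  have h: "h i u < h i w" if uw: "u \<in> units" "w \<in> units" "0 < f i u" "f i u < f i w" for i u w
  proof -
    obtain k where k: "2 * cosh (f i u) = of_int k"
      unfolding f_def using two_cosh_log_char_int[OF uw(1)] by blast
    obtain l where l: "2 * cosh (f i w) = of_int l"
      unfolding f_def using two_cosh_log_char_int[OF uw(2)] by blast
    have "2 * cosh (f i u) < 2 * cosh (f i w)"
      using cosh_real_strict_mono[of "f i u" "f i w"] uw(3,4) by simp
    moreover have "0 < 2 * cosh (f i u)"
      by simp
    ultimately have "0 < k" "k < l"
      unfolding k l by simp_all
    then show ?thesis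
      unfolding h_def k l by simp
  qed
  show thesis
  proof (rule independent_mod_squares[of units f "2 ^ n - 1" h])
    show "1 \<in> units" "0 \<notin> units"
      using units_1 tposD(2) by (auto simp: units_def)
    show "\<exists>e\<in>units. f i e > 0 \<and> (\<forall>j<i. f j e = 0)" if i: "i < 2 ^ n - 1" for i
    proof -
      obtain u where u: "u \<in> units" "log_char (\<sigma> i) u > 0"
        "\<And>S'. S' \<subseteq> {1..n} \<Longrightarrow> S' \<noteq> \<sigma> i \<Longrightarrow> log_char S' u = 0"
        using pell_unit[OF \<sigma>S[OF i]] by blast
      have "f j u = 0" if "j < i" for j
        unfolding f_def using that i by (intro u(3) \<sigma>S inj) auto
      then show ?thesis
        using u(1,2) by (auto simp: f_def)
    qed
    show thesis
      if "\<And>i. i < 2 ^ n - 1 \<Longrightarrow> m i \<in> units"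
        "\<And>A B \<gamma>. A \<subseteq> {..<2 ^ n - 1} \<Longrightarrow> B \<subseteq> {..<2 ^ n - 1} \<Longrightarrow> \<gamma> \<in> units \<Longrightarrow>
          (\<Prod>i\<in>A. m i) = (\<Prod>i\<in>B. m i) * \<gamma>\<^sup>2 \<Longrightarrow> A = B" for m :: "nat \<Rightarrow> complex"
      using that by (rule result)
  qed (use units_mult units_inverse log_char_mult h in \<open>auto simp: f_def\<close>)
qed

end

section \<open>The narrow class group\<close>

text \<open>The hypothesis on equal values says that \<phi> acts like a homomorphism onto a group of
  exponent 2, without any group structure on the target. Among multiplicatively closed subsets with
  image of 2-power order take one with largest image; a value outside this image would adjoin a
  disjoint coset of equal size and double it.\<close>

lemma card_image_elementary_2_group:
  fixes H :: "complex set" and \<phi> :: "complex \<Rightarrow> 'b"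
  assumes one: "1 \<in> H" and mult: "\<And>x y. x \<in> H \<Longrightarrow> y \<in> H \<Longrightarrow> x * y \<in> H"
    and fin: "finite (\<phi> ` H)"
    and ker: "\<And>x y. x \<in> H \<Longrightarrow> y \<in> H \<Longrightarrow> \<phi> x = \<phi> y \<longleftrightarrow> \<phi> (x * y) = \<phi> 1"
  shows "\<exists>d. card (\<phi> ` H) = 2 ^ d"
proof -
  have sq: "\<phi> (x * x) = \<phi> 1" if "x \<in> H" for x
    using ker[OF that that] by simp
  have cong: "\<phi> (x * z) = \<phi> (y * z)" if xyz: "x \<in> H" "y \<in> H" "z \<in> H" "\<phi> x = \<phi> y" for x y z
  proof -
    have "\<phi> (x * y) = \<phi> (z * z)"
      using xyz ker sq by simp
    then have "\<phi> ((x * y) * (z * z)) = \<phi> 1"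
      using ker[of "x * y" "z * z"] xyz mult by simp
    moreover have "(x * y) * (z * z) = (x * z) * (y * z)"
      by (simp add: mult_ac)
    ultimately show ?thesis
      using ker[of "x * z" "y * z"] xyz mult by simp
  qed
  define P where "P B \<longleftrightarrow> B \<subseteq> H \<and> 1 \<in> B \<and> (\<forall>x\<in>B. \<forall>y\<in>B. x * y \<in> B) \<and> (\<exists>d. card (\<phi> ` B) = 2 ^ d)" for B
  have "P {1}"
    using one by (auto simp: P_def intro!: exI[of _ 0])
  moreover have bound: "card (\<phi> ` B) < Suc (card (\<phi> ` H))" if "P B" for B
  proof -
    have "\<phi> ` B \<subseteq> \<phi> ` H"
      using that by (intro image_mono) (simp add: P_def)
    then show ?thesis
      using card_mono[OF fin] le_imp_less_Suc by blast
  qed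
  ultimately obtain B where B: "P B" and max: "\<And>B'. P B' \<Longrightarrow> card (\<phi> ` B') \<le> card (\<phi> ` B)"
    using ex_has_greatest_nat[of P "{1}" "\<lambda>B. card (\<phi> ` B)"] by blast
  have BH: "B \<subseteq> H" and B1: "1 \<in> B" and Bm: "\<And>x y. x \<in> B \<Longrightarrow> y \<in> B \<Longrightarrow> x * y \<in> B"
    using B by (auto simp: P_def)
  obtain d where d: "card (\<phi> ` B) = 2 ^ d"
    using B by (auto simp: P_def)
  have "\<phi> ` H \<subseteq> \<phi> ` B"
  proof (rule ccontr)
    assume "\<not> \<phi> ` H \<subseteq> \<phi> ` B"
    then obtain x where x: "x \<in> H" "\<phi> x \<notin> \<phi> ` B"
      by blast
    define \<psi> where "\<psi> b = \<phi> (x * b)" for b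
    define B' where "B' = {y \<in> H. \<phi> y \<in> \<phi> ` B \<or> \<phi> y \<in> \<psi> ` B}"
    have BH': "b \<in> H" if "b \<in> B" for b
      using BH that by blast
    have cancel: "\<phi> (x * b * (x * b')) = \<phi> (b * b')" if b: "b \<in> B" "b' \<in> B" for b b'
    proof -
      have "\<phi> ((x * x) * (b * b')) = \<phi> (1 * (b * b'))"
        using x b BH' mult sq one by (intro cong) auto
      then show ?thesis
        by (simp add: mult_ac)
    qed
    have inj: "\<phi> b = \<phi> b'" if b: "b \<in> B" "b' \<in> B" "\<psi> b = \<psi> b'" for b b'
    proof -
      have "\<phi> (x * b * (x * b')) = \<phi> 1"
        using b ker[of "x * b" "x * b'"] x BH' mult by (simp add: \<psi>_def)
      then show ?thesis
        using cancel[OF b(1,2)] ker[of b b'] BH' b by simp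
    qed
    \<comment> \<open>A transversal of the fibres of \<phi> on \<open>B\<close>. As \<phi> and
      \<psi> identify the same pairs in \<open>B\<close>, it is one for \<psi> too, so the coset has
      the same size.\<close>
    obtain U where U: "U \<subseteq> B" "inj_on \<phi> U" "\<phi> ` B = \<phi> ` U"
      using subset_image_inj[of "\<phi> ` B" \<phi> B] by auto
    have "inj_on \<psi> U"
    proof (rule inj_onI)
      fix b b' assume b: "b \<in> U" "b' \<in> U" "\<psi> b = \<psi> b'"
      then have "\<phi> b = \<phi> b'"
        using U(1) by (intro inj) auto
      then show "b = b'"
        by (rule inj_onD[OF U(2) _ b(1,2)])
    qed
    moreover have "\<psi> ` B = \<psi> ` U"
    proof
      show "\<psi> ` B \<subseteq> \<psi> ` U"
      proof (rule image_subsetI)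
        fix b assume b: "b \<in> B"
        then obtain c where c: "c \<in> U" "\<phi> b = \<phi> c"
          using U(3) by blast
        then have "\<phi> (b * x) = \<phi> (c * x)"
          using b x(1) BH' U(1) by (intro cong) auto
        then have "\<psi> b = \<psi> c"
          by (simp add: \<psi>_def mult.commute)
        then show "\<psi> b \<in> \<psi> ` U"
          using c(1) by blast
      qed
    qed (use U(1) in blast)
    ultimately have card_\<psi>: "card (\<psi> ` B) = card (\<phi> ` B)"
      using card_image[of \<psi> U] card_image[OF U(2)] U(3) by simp
    have disj: "\<phi> ` B \<inter> \<psi> ` B = {}"
    proof -
      have False if b: "b \<in> B" "b' \<in> B" "\<phi> b = \<psi> b'" for b b'
      proof -
        have "\<phi> (b * (x * b')) = \<phi> 1"
          using b ker[of b "x * b'"] x BH' mult by (simp add: \<psi>_def)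
        then have "\<phi> (x * (b * b')) = \<phi> 1"
          by (simp add: mult_ac)
        then have "\<phi> x = \<phi> (b * b')"
          using ker[of x "b * b'"] x BH' mult b by simp
        then show False
          using x(2) Bm b by blast
      qed
      then show ?thesis
        by blast
    qed
    have finB: "finite (\<phi> ` B)" "finite (\<psi> ` B)"
      using fin BH BH' x(1) mult by (auto intro!: finite_subset[OF _ fin] simp: \<psi>_def)
    have xB: "x * b \<in> H" if "b \<in> B" for b
      using mult x(1) BH' that by blast
    have "\<phi> ` B' = \<phi> ` B \<union> \<psi> ` B"
    proof
      show "\<phi> ` B' \<subseteq> \<phi> ` B \<union> \<psi> ` B"
        by (auto simp: B'_def)
      have "\<phi> b \<in> \<phi> ` B'" if "b \<in> B" for b
        using that BH' by (auto simp: B'_def)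
      moreover have "\<psi> b \<in> \<phi> ` B'" if "b \<in> B" for b
      proof -
        have "x * b \<in> B'"
          using that xB by (auto simp: B'_def \<psi>_def)
        then show ?thesis
          by (auto simp: \<psi>_def)
      qed
      ultimately show "\<phi> ` B \<union> \<psi> ` B \<subseteq> \<phi> ` B'"
        by blast
    qed
    then have card_B': "card (\<phi> ` B') = 2 ^ Suc d"
      using card_Un_disjoint[OF finB disj] card_\<psi> d by simp
    have "y * y' \<in> B'" if y: "y \<in> B'" "y' \<in> B'" for y y'
    proof -
      have yH: "y \<in> H" "y' \<in> H" "y * y' \<in> H"
        using y mult by (auto simp: B'_def)
      have reduce: "\<phi> (y * y') = \<phi> (c * c')" if "c \<in> H" "c' \<in> H" "\<phi> y = \<phi> c" "\<phi> y' = \<phi> c'" for c c'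
        using cong[of y c y'] cong[of y' c' c] that yH by (simp add: mult.commute)
      obtain e b where e: "e = 1 \<or> e = x" "b \<in> B" "\<phi> y = \<phi> (e * b)"
        using y(1) unfolding B'_def \<psi>_def by force
      obtain e' b' where e': "e' = 1 \<or> e' = x" "b' \<in> B" "\<phi> y' = \<phi> (e' * b')"
        using y(2) unfolding B'_def \<psi>_def by force
      have "\<phi> (y * y') = \<phi> (e * b * (e' * b'))"
        using e e' BH' xB by (intro reduce) auto
      moreover have "e * b * (e' * b') = (e * e') * (b * b')"
        by (simp add: mult_ac)
      ultimately have "\<phi> (y * y') \<in> \<phi> ` B \<or> \<phi> (y * y') \<in> \<psi> ` B"
        using e(1) e'(1) imageI[OF Bm[OF e(2) e'(2)], of \<phi>] imageI[OF Bm[OF e(2) e'(2)], of \<psi>]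
          cancel[OF e(2) e'(2)] by (auto simp: \<psi>_def mult_ac)
      then show ?thesis
        using yH by (simp add: B'_def)
    qed
    then have "P B'"
      unfolding P_def using card_B' one B1 by (auto simp: B'_def simp del: power_Suc)
    then show False
      using max[of B'] card_B' d by simp
  qed
  then have "\<phi> ` H = \<phi> ` B"
    using BH by blast
  then show ?thesis
    using d by auto
qed

section \<open>Products of ideals and square roots of principal ideals\<close>

lemma frac_ideal_prod_add_term:
  assumes "z \<in> frac_ideal_prod I J" "u \<in> I" "w \<in> J"
  shows "z + u * w \<in> frac_ideal_prod I J"
proof -
  obtain k f g where *: "\<And>i. i < k \<Longrightarrow> f i \<in> I \<and> g i \<in> J" "z = (\<Sum>i<(k :: nat). f i * g i)"
    using assms(1) unfolding frac_ideal_prod_def by blast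
  have "(\<Sum>i<Suc k. (f(k := u)) i * (g(k := w)) i) = (\<Sum>i<k. f i * g i) + u * w"
    by simp
  then show ?thesis
    unfolding frac_ideal_prod_def using * assms(2,3)
    by (intro CollectI exI[of _ "Suc k"] exI[of _ "f(k := u)"] exI[of _ "g(k := w)"]) (auto simp: less_Suc_eq)
qed

lemma frac_ideal_prod_0: "0 \<in> frac_ideal_prod I J"
  unfolding frac_ideal_prod_def by (intro CollectI exI[of _ 0]) auto

lemma frac_ideal_prod_base: "u \<in> I \<Longrightarrow> w \<in> J \<Longrightarrow> u * w \<in> frac_ideal_prod I J"
  using frac_ideal_prod_add_term[OF frac_ideal_prod_0] by simp

lemma frac_ideal_prod_add:
  assumes "z \<in> frac_ideal_prod I J" "z' \<in> frac_ideal_prod I J"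
  shows "z + z' \<in> frac_ideal_prod I J"
proof -
  obtain k f g where *: "\<And>i. i < k \<Longrightarrow> f i \<in> I \<and> g i \<in> J" "z' = (\<Sum>i<(k :: nat). f i * g i)"
    using assms(2) unfolding frac_ideal_prod_def by blast
  have "z + (\<Sum>i<j. f i * g i) \<in> frac_ideal_prod I J" if "j \<le> k" for j
    using that
  proof (induction j)
    case 0
    then show ?case using assms(1) by simp
  next
    case (Suc j)
    then have "(z + (\<Sum>i<j. f i * g i)) + f j * g j \<in> frac_ideal_prod I J"
      using *(1)[of j] by (intro frac_ideal_prod_add_term) auto
    then show ?case
      by (simp add: add.assoc)
  qed
  then show ?thesis
    using *(2) by blast
qed

lemma frac_ideal_prod_scale:
  assumes "z \<in> frac_ideal_prod I J" "\<And>x. x \<in> I \<Longrightarrow> r * x \<in> I"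
  shows "r * z \<in> frac_ideal_prod I J"
proof -
  obtain k f g where *: "\<And>i. i < k \<Longrightarrow> f i \<in> I \<and> g i \<in> J" "z = (\<Sum>i<(k :: nat). f i * g i)"
    using assms(1) unfolding frac_ideal_prod_def by blast
  have "r * z = (\<Sum>i<k. (r * f i) * g i)"
    unfolding *(2) by (simp add: sum_distrib_left mult.assoc)
  then show ?thesis
    unfolding frac_ideal_prod_def using *(1) assms(2)
    by (intro CollectI exI[of _ k] exI[of _ "\<lambda>i. r * f i"] exI[of _ g]) auto
qed

definition root_ideal :: "complex set \<Rightarrow> complex \<Rightarrow> complex set" where
  "root_ideal K \<alpha> = {x \<in> K. algebraic_int (x\<^sup>2 / \<alpha>)}"

text \<open>A square root of a principal ideal is determined by the generator. Write
  \<open>\<alpha>\<close> as a sum of products \<open>f i * g i\<close> from I. If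
  \<open>x\<^sup>2 / \<alpha>\<close> is integral, then
  \<open>x = (\<Sum>i<k. (x * f i / \<alpha>) * g i)\<close> has integral coefficients and lies in
  I. Moreover the terms \<open>f i * g i / \<alpha>\<close> sum to 1, so some term avoids a given
  prime, and then so does \<open>(f i)\<^sup>2 / \<alpha>\<close>.\<close>

lemma root_ideal_of_square:
  assumes K: "is_subfield K" and I: "fractional_ideal K I" and \<alpha>: "\<alpha> \<in> K" "\<alpha> \<noteq> 0"
    and eq: "frac_ideal_prod I I = (\<lambda>x. \<alpha> * x) ` ring_of_integers K"
  shows "I = root_ideal K \<alpha>" "locally_square K \<alpha>"
proof -
  have IK: "x \<in> K" if "x \<in> I" for x
    using I that by (auto simp: fractional_ideal_def)
  have int: "x * y / \<alpha> \<in> ring_of_integers K" if xy: "x \<in> I" "y \<in> I" for x y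
  proof -
    obtain r where "r \<in> ring_of_integers K" "x * y = \<alpha> * r"
      using frac_ideal_prod_base[OF xy] unfolding eq by blast
    then show ?thesis
      using \<alpha>(2) by simp
  qed
  have "\<alpha> * 1 \<in> frac_ideal_prod I I"
    unfolding eq using subringD(2)[OF ring_of_integers_subring[OF K]] by blast
  then obtain k f g where fg: "\<And>i. i < k \<Longrightarrow> f i \<in> I \<and> g i \<in> I" "\<alpha> = (\<Sum>i<(k :: nat). f i * g i)"
    unfolding frac_ideal_prod_def by auto
  show "I = root_ideal K \<alpha>"
  proof
    show "I \<subseteq> root_ideal K \<alpha>"
      using IK int by (auto simp: root_ideal_def ring_of_integers_def power2_eq_square)
    show "root_ideal K \<alpha> \<subseteq> I"
    proof
      fix x assume "x \<in> root_ideal K \<alpha>"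
      then have x: "x \<in> K" "algebraic_int (x\<^sup>2 / \<alpha>)"
        by (auto simp: root_ideal_def)
      have mem: "(x * f i / \<alpha>) * g i \<in> I" if "i < k" for i
      proof -
        have "algebraic_int ((f i)\<^sup>2 / \<alpha>)"
          using int[of "f i" "f i"] fg(1)[OF that] by (simp add: ring_of_integers_def power2_eq_square)
        then have "x * f i / \<alpha> \<in> ring_of_integers K"
          using algebraic_int_mult_over[OF x(2)] x(1) \<alpha>(1) IK fg(1)[OF that] subfieldD(5,8)[OF K]
          by (simp add: ring_of_integers_def)
        then show ?thesis
          using I fg(1)[OF that] unfolding fractional_ideal_def by blast
      qed
      have "(\<Sum>i<j. (x * f i / \<alpha>) * g i) \<in> I" if "j \<le> k" for j
        using that
      proof (induction j)
        case 0
        then show ?case using I by (simp add: fractional_ideal_def)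
      next
        case (Suc j)
        then show ?case using I mem[of j] by (simp add: fractional_ideal_def)
      qed
      then have "(\<Sum>i<k. (x * f i / \<alpha>) * g i) \<in> I"
        by blast
      moreover have "(\<Sum>i<k. (x * f i / \<alpha>) * g i) = x * (\<Sum>i<k. f i * g i) / \<alpha>"
        by (simp add: sum_distrib_left sum_divide_distrib mult.assoc)
      ultimately show "x \<in> I"
        using fg(2)[symmetric] \<alpha>(2) by simp
    qed
  qed
  show "locally_square K \<alpha>"
    unfolding locally_square_def
  proof (intro allI impI)
    fix P assume P: "is_prime_ideal (ring_of_integers K) P"
    have "\<exists>i<k. f i * g i / \<alpha> \<notin> P"
    proof (rule ccontr)
      assume "\<not> ?thesis"
      then have "(\<Sum>i<k. f i * g i / \<alpha>) \<in> P"
        by (intro ideal_sum[OF prime_idealD(1)[OF P]]) auto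
      moreover have "(\<Sum>i<k. f i * g i / \<alpha>) = 1"
        using fg(2) \<alpha>(2) by (simp flip: sum_divide_distrib)
      ultimately show False
        using prime_idealD(2)[OF P] by simp
    qed
    then obtain i where i: "i < k" "f i * g i / \<alpha> \<notin> P"
      by blast
    have fi: "f i \<in> I" "g i \<in> I"
      using fg(1)[OF i(1)] by auto
    have "(f i)\<^sup>2 / \<alpha> \<notin> P"
      using prime_ideal_mult_over[OF K P IK[OF fi(1)] IK[OF fi(2)] \<alpha>(1)] i(2) int[OF fi(2,2)]
      by (auto simp: power2_eq_square)
    then show "\<exists>x\<in>K. x\<^sup>2 / \<alpha> \<in> ring_of_integers K - P"
      using IK[OF fi(1)] int[OF fi(1,1)] by (intro bexI[of _ "f i"]) (auto simp: power2_eq_square)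
  qed
qed

text \<open>Conversely the local condition glues: the ideal obtained by dividing the square of the
  root module by \<alpha> lies in no prime, because a local witness x contributes
  \<open>x\<^sup>2 / \<alpha>\<close>. Hence it is the whole ring. The integer d supplies the common
  denominator.\<close>

lemma root_ideal_square:
  assumes K: "is_subfield K" and \<alpha>: "\<alpha> \<in> K" "\<alpha> \<noteq> 0" and ls: "locally_square K \<alpha>"
    and d: "d \<noteq> 0" "algebraic_int (of_int d * \<alpha>)"
  shows "fractional_ideal K (root_ideal K \<alpha>)"
    and "frac_ideal_prod (root_ideal K \<alpha>) (root_ideal K \<alpha>) = (\<lambda>x. \<alpha> * x) ` ring_of_integers K"
proof -
  let ?I = "root_ideal K \<alpha>" and ?O = "ring_of_integers K"
  note KD = subfieldD[OF K] and OD = subringD[OF ring_of_integers_subring[OF K]]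
  have I_add: "x + y \<in> ?I" if "x \<in> ?I" "y \<in> ?I" for x y
    using that KD(3) algebraic_int_add_over by (auto simp: root_ideal_def)
  have I_scale: "r * x \<in> ?I" if "r \<in> ?O" "x \<in> ?I" for r x
  proof -
    have "algebraic_int r" "algebraic_int (x\<^sup>2 / \<alpha>)"
      using that by (auto simp: root_ideal_def ring_of_integers_def)
    then have "algebraic_int (r\<^sup>2 * (x\<^sup>2 / \<alpha>))"
      unfolding power2_eq_square[of r] by (intro algebraic_int_add_mult(2))
    then show ?thesis
      using that KD(5) by (simp add: root_ideal_def ring_of_integers_def power_mult_distrib)
  qed
  have I_0: "0 \<in> ?I"
    using KD(1) by (simp add: root_ideal_def)
  \<comment> \<open>Local squareness at the zero ideal yields a nonzero element of the
    module.\<close>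
  have "is_prime_ideal ?O {0}"
    using OD(1) by (auto simp: is_prime_ideal_def is_ideal_def)
  then obtain x0 where "x0 \<in> K" "x0\<^sup>2 / \<alpha> \<in> ?O - {0}"
    using ls unfolding locally_square_def by blast
  then have x0: "x0 \<in> ?I" "x0 \<noteq> 0"
    by (auto simp: root_ideal_def ring_of_integers_def)
  have denom: "of_int d * x \<in> ?O" if "x \<in> ?I" for x
  proof -
    have "(of_int d * x)\<^sup>2 = of_int d * ((of_int d * \<alpha>) * (x\<^sup>2 / \<alpha>))"
      using \<alpha>(2) by (simp add: power2_eq_square)
    moreover have "algebraic_int (of_int d * ((of_int d * \<alpha>) * (x\<^sup>2 / \<alpha>)))"
    proof -
      have "algebraic_int (x\<^sup>2 / \<alpha>)"
        using that by (simp add: root_ideal_def)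
      moreover have "algebraic_int (of_int d :: complex)"
        by (rule int_imp_algebraic_int) simp
      ultimately show ?thesis
        using algebraic_int_add_mult(2) d(2) by blast
    qed
    ultimately have "algebraic_int ((of_int d * x)\<^sup>2)"
      by (simp only:)
    then have "algebraic_int (of_int d * x)"
      by (rule algebraic_int_sqrt_of_power2)
    then show ?thesis
      using that KD(5) subfield_of_int[OF K] by (simp add: root_ideal_def ring_of_integers_def)
  qed
  show "fractional_ideal K ?I"
    unfolding fractional_ideal_def
  proof (intro conjI)
    show "?I \<subseteq> K"
      by (auto simp: root_ideal_def)
    show "\<exists>d\<in>?O. d \<noteq> 0 \<and> (\<forall>x\<in>?I. d * x \<in> ?O)"
      using denom d(1) of_int_in_ring_of_integers[OF K] by (intro bexI[of _ "of_int d"]) auto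
  qed (use I_0 x0 I_add I_scale in auto)
  define \<aa> where "\<aa> = {z. \<alpha> * z \<in> frac_ideal_prod ?I ?I}"
  have sub: "\<aa> \<subseteq> ?O"
  proof
    fix z assume "z \<in> \<aa>"
    then obtain k f g where fg: "\<And>i. i < k \<Longrightarrow> f i \<in> ?I \<and> g i \<in> ?I" "\<alpha> * z = (\<Sum>i<(k :: nat). f i * g i)"
      unfolding \<aa>_def frac_ideal_prod_def by blast
    have "f i * g i / \<alpha> \<in> ?O" if "i < k" for i
      using fg(1)[OF that] algebraic_int_mult_over KD(5,8) \<alpha>(1) by (auto simp: root_ideal_def ring_of_integers_def)
    then have "(\<Sum>i<k. f i * g i / \<alpha>) \<in> ?O"
      by (intro subring_sum[OF ring_of_integers_subring[OF K]]) auto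
    moreover have "(\<Sum>i<k. f i * g i / \<alpha>) = z"
      using fg(2)[symmetric] \<alpha>(2) by (simp flip: sum_divide_distrib)
    ultimately show "z \<in> ?O"
      by simp
  qed
  have ideal: "is_ideal ?O \<aa>"
    unfolding is_ideal_def
  proof (intro conjI ballI sub)
    show "0 \<in> \<aa>"
      by (simp add: \<aa>_def frac_ideal_prod_0)
    show "x + y \<in> \<aa>" if "x \<in> \<aa>" "y \<in> \<aa>" for x y
      using that frac_ideal_prod_add by (auto simp: \<aa>_def distrib_left)
    show "r * x \<in> \<aa>" if "r \<in> ?O" "x \<in> \<aa>" for r x
    proof -
      have "r * (\<alpha> * x) \<in> frac_ideal_prod ?I ?I"
        using that I_scale by (auto simp: \<aa>_def intro: frac_ideal_prod_scale[of "\<alpha> * x"])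
      then show ?thesis
        by (simp add: \<aa>_def mult_ac)
    qed
  qed
  have "1 \<in> \<aa>"
  proof (rule ccontr)
    assume "1 \<notin> \<aa>"
    then have disj: "\<aa> \<inter> {1} = {}"
      by simp
    obtain P where P: "is_prime_ideal ?O P" "\<aa> \<subseteq> P"
      by (rule ex_prime_ideal_disjoint[OF ring_of_integers_subring[OF K] ideal _ _ disj]) auto
    obtain x where x: "x \<in> K" "x\<^sup>2 / \<alpha> \<in> ?O - P"
      using ls P(1) unfolding locally_square_def by blast
    then have "x \<in> ?I"
      by (auto simp: root_ideal_def ring_of_integers_def)
    then have "x * x \<in> frac_ideal_prod ?I ?I"
      by (intro frac_ideal_prod_base)
    then have "x\<^sup>2 / \<alpha> \<in> \<aa>"
      using \<alpha>(2) by (simp add: \<aa>_def power2_eq_square)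
    then show False
      using x(2) P(2) by blast
  qed
  show "frac_ideal_prod ?I ?I = (\<lambda>x. \<alpha> * x) ` ?O"
  proof
    show "frac_ideal_prod ?I ?I \<subseteq> (\<lambda>x. \<alpha> * x) ` ?O"
    proof
      fix z assume "z \<in> frac_ideal_prod ?I ?I"
      then have "z / \<alpha> \<in> ?O"
        using sub \<alpha>(2) by (auto simp: \<aa>_def)
      then show "z \<in> (\<lambda>x. \<alpha> * x) ` ?O"
        using \<alpha>(2) by (intro image_eqI[of _ _ "z / \<alpha>"]) auto
    qed
    show "(\<lambda>x. \<alpha> * x) ` ?O \<subseteq> frac_ideal_prod ?I ?I"
    proof (rule image_subsetI)
      fix r assume "r \<in> ?O"
      then have "r * 1 \<in> \<aa>"
        using \<open>1 \<in> \<aa>\<close> by (rule idealD(4)[OF ideal])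
      then show "\<alpha> * r \<in> frac_ideal_prod ?I ?I"
        by (simp add: \<aa>_def)
    qed
  qed
qed

lemma root_ideal_scale:
  assumes "is_subfield K" "\<gamma> \<in> K" "\<gamma> \<noteq> 0"
  shows "(\<lambda>x. \<gamma> * x) ` root_ideal K \<beta> = root_ideal K (\<gamma>\<^sup>2 * \<beta>)"
proof
  show "(\<lambda>x. \<gamma> * x) ` root_ideal K \<beta> \<subseteq> root_ideal K (\<gamma>\<^sup>2 * \<beta>)"
    using assms subfieldD(5)[OF assms(1)] by (auto simp: root_ideal_def power_mult_distrib)
  show "root_ideal K (\<gamma>\<^sup>2 * \<beta>) \<subseteq> (\<lambda>x. \<gamma> * x) ` root_ideal K \<beta>"
  proof
    fix x assume x: "x \<in> root_ideal K (\<gamma>\<^sup>2 * \<beta>)"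
    then have "x / \<gamma> \<in> root_ideal K \<beta>"
      using assms(2) subfieldD(8)[OF assms(1)] by (auto simp: root_ideal_def power_divide)
    then show "x \<in> (\<lambda>x. \<gamma> * x) ` root_ideal K \<beta>"
      using assms(3) by (intro image_eqI[of _ _ "x / \<gamma>"]) auto
  qed
qed

lemma equiv_narrow_rel:
  assumes K: "is_subfield K" shows "equiv {I. fractional_ideal K I} (narrow_rel K)"
proof (rule equivI)
  show "narrow_rel K \<subseteq> {I. fractional_ideal K I} \<times> {I. fractional_ideal K I}"
    by (auto simp: narrow_rel_def)
  show "refl_on {I. fractional_ideal K I} (narrow_rel K)"
    unfolding refl_on_def narrow_rel_def narrow_equiv_def
    using totally_positive_1[OF K] by (auto intro!: exI[of _ 1])
  have "narrow_equiv K J I" if IJ: "narrow_equiv K I J" for I J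
  proof -
    obtain \<alpha> where \<alpha>: "totally_positive K \<alpha>" "I = (\<lambda>x. \<alpha> * x) ` J"
      using IJ unfolding narrow_equiv_def by blast
    have "(\<lambda>x. inverse \<alpha> * x) ` I = J"
      unfolding \<alpha>(2) image_image using tposD(2)[OF \<alpha>(1)]
      by (simp flip: mult.assoc)
    then show ?thesis
      unfolding narrow_equiv_def using totally_positive_inverse[OF K \<alpha>(1)] by blast
  qed
  then show "sym (narrow_rel K)"
    by (auto simp: sym_def narrow_rel_def)
  have "narrow_equiv K I M" if IJ: "narrow_equiv K I J" and JM: "narrow_equiv K J M" for I J M
  proof -
    obtain \<alpha> where \<alpha>: "totally_positive K \<alpha>" "I = (\<lambda>x. \<alpha> * x) ` J"
      using IJ unfolding narrow_equiv_def by blast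
    obtain \<beta> where \<beta>: "totally_positive K \<beta>" "J = (\<lambda>x. \<beta> * x) ` M"
      using JM unfolding narrow_equiv_def by blast
    have "I = (\<lambda>x. (\<alpha> * \<beta>) * x) ` M"
      unfolding \<alpha>(2) \<beta>(2) image_image by (simp add: mult.assoc)
    then show ?thesis
      unfolding narrow_equiv_def using totally_positive_mult[OF K \<alpha>(1) \<beta>(1)] by blast
  qed
  then show "trans (narrow_rel K)"
    unfolding trans_def narrow_rel_def by blast
qed

section \<open>The 2-torsion of the narrow class group\<close>

context multiquadratic_tower
begin

lemma integral_multiple:
  assumes "k \<le> n" "x \<in> F k" shows "\<exists>d::int. d \<noteq> 0 \<and> algebraic_int (of_int d * x)"
  using assms
proof (induction k arbitrary: x)
  case 0
  then obtain p q where pq: "q > 0" "x = of_int p / of_int q"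
    by (auto simp: multiquadratic_field_0 elim: Rats_cases')
  then have "of_int q * x = of_int p"
    by simp
  then show ?case
    using pq(1) by (intro exI[of _ q]) (auto intro: int_imp_algebraic_int)
next
  case (Suc k)
  interpret quadratic_extension "F k" "rt (Suc k)" "a (Suc k)"
    using extension(1) Suc.prems by simp
  have "x \<in> L"
    using extension(2)[of k] Suc.prems by simp
  then obtain u v where uv: "x = u + v * rt (Suc k)" "u \<in> F k" "v \<in> F k"
    by (rule L_E)
  obtain d where d: "d \<noteq> 0" "algebraic_int (of_int d * u)"
    using Suc.IH[OF _ uv(2)] Suc.prems by auto
  obtain e where e: "e \<noteq> 0" "algebraic_int (of_int e * v)"
    using Suc.IH[OF _ uv(3)] Suc.prems by auto
  have int: "algebraic_int (of_int j :: complex)" for j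
    by (rule int_imp_algebraic_int) simp
  have "of_int (d * e) * x = of_int e * (of_int d * u) + of_int d * ((of_int e * v) * rt (Suc k))"
    unfolding uv(1) by (simp add: algebra_simps)
  moreover have "algebraic_int (of_int e * (of_int d * u) + of_int d * ((of_int e * v) * rt (Suc k)))"
    using algebraic_int_add_mult(2)[OF int d(2)]
      algebraic_int_add_mult(2)[OF int algebraic_int_add_mult(2)[OF e(2) algebraic_int_csqrt[OF int]]]
    by (rule algebraic_int_add_mult(1))
  ultimately show ?case
    using d(1) e(1) by (intro exI[of _ "d * e"]) (simp only: mult_eq_0_iff, simp)
qed

abbreviation "Int_K \<equiv> ring_of_integers K"

definition square_gens :: "complex set" where
  "square_gens = {\<alpha>. totally_positive K \<alpha> \<and> locally_square K \<alpha>}"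

lemma square_gensD:
  assumes "\<alpha> \<in> square_gens"
  shows "totally_positive K \<alpha>" "locally_square K \<alpha>" "\<alpha> \<in> K" "\<alpha> \<noteq> 0"
    "fractional_ideal K (root_ideal K \<alpha>)"
    "frac_ideal_prod (root_ideal K \<alpha>) (root_ideal K \<alpha>) = (\<lambda>x. \<alpha> * x) ` Int_K"
proof -
  show *: "totally_positive K \<alpha>" "locally_square K \<alpha>"
    using assms by (auto simp: square_gens_def)
  show "\<alpha> \<in> K" "\<alpha> \<noteq> 0"
    using tposD(1,2)[OF *(1)] .
  obtain d :: int where d: "d \<noteq> 0" "algebraic_int (of_int d * \<alpha>)"
    using integral_multiple[OF le_refl \<open>\<alpha> \<in> K\<close>] by blast
  show "fractional_ideal K (root_ideal K \<alpha>)"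
    "frac_ideal_prod (root_ideal K \<alpha>) (root_ideal K \<alpha>) = (\<lambda>x. \<alpha> * x) ` Int_K"
    using root_ideal_square[OF subfield_K \<open>\<alpha> \<in> K\<close> \<open>\<alpha> \<noteq> 0\<close> *(2) d] .
qed

lemma square_gens_mult: "\<alpha> \<in> square_gens \<Longrightarrow> \<beta> \<in> square_gens \<Longrightarrow> \<alpha> * \<beta> \<in> square_gens"
  unfolding square_gens_def
  using totally_positive_mult[OF subfield_K] locally_square_mult[OF subfield_K] by blast

lemma units_square_gens:
  assumes "u \<in> units" shows "u \<in> square_gens"
proof -
  have u: "totally_positive K u" "algebraic_int u" "algebraic_int (inverse u)"
    using assms by (auto simp: units_def)
  have "u \<noteq> 0"
    using tposD(2)[OF u(1)] .
  have O: "u \<in> Int_K" "inverse u \<in> Int_K"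
    using u units_K assms units_inverse by (auto simp: ring_of_integers_def)
  have "1\<^sup>2 / u \<in> Int_K - P" if P: "is_prime_ideal Int_K P" for P
  proof -
    have "inverse u \<notin> P"
    proof
      assume "inverse u \<in> P"
      from idealD(4)[OF prime_idealD(1)[OF P] O(1) this] show False
        using prime_idealD(2)[OF P] \<open>u \<noteq> 0\<close> by simp
    qed
    then show ?thesis
      using O(2) by (simp add: divide_inverse)
  qed
  then have "locally_square K u"
    unfolding locally_square_def using subfieldD(2)[OF subfield_K] by blast
  then show ?thesis
    using u(1) by (simp add: square_gens_def)
qed

definition narrow_class :: "complex \<Rightarrow> complex set set" where
  "narrow_class \<alpha> = narrow_rel K `` {root_ideal K \<alpha>}"

text \<open>Surjectivity in the exact sequence: an ideal with narrowly principal square is the root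
  ideal of any totally positive generator of that square.\<close>

lemma narrow_class_group_2tors_eq: "narrow_class_group_2tors K = narrow_class ` square_gens"
proof -
  have "{I. fractional_ideal K I \<and> narrow_equiv K (frac_ideal_prod I I) Int_K} = root_ideal K ` square_gens"
  proof (intro subset_antisym subsetI)
    fix I assume "I \<in> {I. fractional_ideal K I \<and> narrow_equiv K (frac_ideal_prod I I) Int_K}"
    then obtain \<alpha> where \<alpha>: "fractional_ideal K I" "totally_positive K \<alpha>"
        "frac_ideal_prod I I = (\<lambda>x. \<alpha> * x) ` Int_K"
      unfolding narrow_equiv_def by blast
    note * = root_ideal_of_square[OF subfield_K \<alpha>(1) tposD(1,2)[OF \<alpha>(2)] \<alpha>(3)]
    show "I \<in> root_ideal K ` square_gens"
      using *(1) by (rule image_eqI) (use *(2) \<alpha>(2) in \<open>simp add: square_gens_def\<close>)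
  next
    fix I assume "I \<in> root_ideal K ` square_gens"
    then obtain \<alpha> where \<alpha>: "\<alpha> \<in> square_gens" "I = root_ideal K \<alpha>"
      by blast
    show "I \<in> {I. fractional_ideal K I \<and> narrow_equiv K (frac_ideal_prod I I) Int_K}"
      unfolding \<alpha>(2) narrow_equiv_def using square_gensD[OF \<alpha>(1)] by blast
  qed
  then show ?thesis
    unfolding narrow_class_group_2tors_def quotient_def narrow_class_def by auto
qed

text \<open>Exactness in the middle. If the root ideals differ by the factor \<gamma>, then squaring
  shows that \<alpha> and \<open>\<gamma>\<^sup>2 * \<beta>\<close> generate the same ideal. Their
  quotient is a unit, and it is totally positive because both generators are.\<close>

lemma narrow_class_eq_iff:
  assumes \<alpha>: "\<alpha> \<in> square_gens" and \<beta>: "\<beta> \<in> square_gens"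
  shows "narrow_class \<alpha> = narrow_class \<beta> \<longleftrightarrow> (\<exists>u\<in>units. \<exists>\<gamma>. totally_positive K \<gamma> \<and> \<alpha> = u * \<gamma>\<^sup>2 * \<beta>)"
proof -
  note A = square_gensD[OF \<alpha>] and B = square_gensD[OF \<beta>]
  note K = subfieldD[OF subfield_K]
  have "narrow_class \<alpha> = narrow_class \<beta> \<longleftrightarrow> (root_ideal K \<alpha>, root_ideal K \<beta>) \<in> narrow_rel K"
    unfolding narrow_class_def
    using eq_equiv_class_iff[OF equiv_narrow_rel[OF subfield_K]] A(5) B(5) by simp
  also have "\<dots> \<longleftrightarrow> narrow_equiv K (root_ideal K \<alpha>) (root_ideal K \<beta>)"
    using A(5) B(5) by (simp add: narrow_rel_def)
  also have "\<dots> \<longleftrightarrow> (\<exists>u\<in>units. \<exists>\<gamma>. totally_positive K \<gamma> \<and> \<alpha> = u * \<gamma>\<^sup>2 * \<beta>)"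
  proof
    assume "narrow_equiv K (root_ideal K \<alpha>) (root_ideal K \<beta>)"
    then obtain \<gamma> where \<gamma>: "totally_positive K \<gamma>" "root_ideal K \<alpha> = (\<lambda>x. \<gamma> * x) ` root_ideal K \<beta>"
      unfolding narrow_equiv_def by blast
    note g = tposD(1,2)[OF \<gamma>(1)]
    define \<beta>' where "\<beta>' = \<gamma>\<^sup>2 * \<beta>"
    have eq: "root_ideal K \<alpha> = root_ideal K \<beta>'"
      unfolding \<gamma>(2) \<beta>'_def by (rule root_ideal_scale[OF subfield_K g])
    have \<beta>': "\<beta>' \<in> square_gens"
      unfolding \<beta>'_def square_gens_def
      using B(1,2) g \<gamma>(1) totally_positive_power2[OF subfield_K]
      by (auto intro!: totally_positive_mult locally_square_mult locally_square_power2 subfield_K)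
    note B' = square_gensD[OF \<beta>']
    have img: "(\<lambda>x. \<alpha> * x) ` Int_K = (\<lambda>x. \<beta>' * x) ` Int_K"
      using A(6) B'(6) eq by simp
    have one: "1 \<in> Int_K"
      using subringD(2)[OF ring_of_integers_subring[OF subfield_K]] .
    have "\<alpha> * 1 \<in> (\<lambda>x. \<beta>' * x) ` Int_K"
      unfolding img[symmetric] using one by blast
    then obtain r where r: "r \<in> Int_K" "\<alpha> = \<beta>' * r"
      by auto
    have "\<beta>' * 1 \<in> (\<lambda>x. \<alpha> * x) ` Int_K"
      unfolding img using one by blast
    then obtain t where t: "t \<in> Int_K" "\<beta>' = \<alpha> * t"
      by auto
    have "r * t = 1"
      using r(2) t(2) A(4) by (metis mult.assoc mult.commute mult_cancel_left1)
    then have ru: "r = \<alpha> / \<beta>'" "inverse r = t"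
      using r(2) B'(4) by (auto simp: inverse_unique)
    have "r \<in> units"
      unfolding units_def using totally_positive_divide[OF subfield_K A(1) B'(1)] r(1) t(1) ru
      by (auto simp: ring_of_integers_def)
    moreover have "\<alpha> = r * \<gamma>\<^sup>2 * \<beta>"
      using r(2) by (simp add: \<beta>'_def)
    ultimately show "\<exists>u\<in>units. \<exists>\<gamma>. totally_positive K \<gamma> \<and> \<alpha> = u * \<gamma>\<^sup>2 * \<beta>"
      using \<gamma>(1) by blast
  next
    assume "\<exists>u\<in>units. \<exists>\<gamma>. totally_positive K \<gamma> \<and> \<alpha> = u * \<gamma>\<^sup>2 * \<beta>"
    then obtain u \<gamma> where u: "u \<in> units" "totally_positive K \<gamma>" "\<alpha> = u * \<gamma>\<^sup>2 * \<beta>"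
      by blast
    note g = tposD(1,2)[OF u(2)]
    have u': "algebraic_int u" "algebraic_int (inverse u)" "u \<noteq> 0"
      using u(1) tposD(2) by (auto simp: units_def)
    have "algebraic_int (x\<^sup>2 / \<alpha>) \<longleftrightarrow> algebraic_int (x\<^sup>2 / (\<gamma>\<^sup>2 * \<beta>))" for x
    proof -
      have "x\<^sup>2 / \<alpha> = inverse u * (x\<^sup>2 / (\<gamma>\<^sup>2 * \<beta>))" "x\<^sup>2 / (\<gamma>\<^sup>2 * \<beta>) = u * (x\<^sup>2 / \<alpha>)"
        unfolding u(3) using u'(3) by (auto simp: field_simps)
      then show ?thesis
        using algebraic_int_add_mult(2)[OF u'(1)] algebraic_int_add_mult(2)[OF u'(2)] by metis
    qed
    then have "root_ideal K \<alpha> = root_ideal K (\<gamma>\<^sup>2 * \<beta>)"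
      by (simp add: root_ideal_def)
    also have "\<dots> = (\<lambda>x. \<gamma> * x) ` root_ideal K \<beta>"
      by (rule root_ideal_scale[OF subfield_K g, symmetric])
    finally show "narrow_equiv K (root_ideal K \<alpha>) (root_ideal K \<beta>)"
      unfolding narrow_equiv_def using u(2) by blast
  qed
  finally show ?thesis .
qed

lemma narrow_class_kernel:
  assumes \<alpha>: "\<alpha> \<in> square_gens" and \<beta>: "\<beta> \<in> square_gens"
  shows "narrow_class \<alpha> = narrow_class \<beta> \<longleftrightarrow> narrow_class (\<alpha> * \<beta>) = narrow_class 1"
proof -
  have 1: "1 \<in> square_gens"
    by (rule units_square_gens[OF units_1])
  have \<beta>': "totally_positive K \<beta>" "\<beta> \<noteq> 0"
    using square_gensD[OF \<beta>] by auto
  show ?thesis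
    unfolding narrow_class_eq_iff[OF \<alpha> \<beta>] narrow_class_eq_iff[OF square_gens_mult[OF \<alpha> \<beta>] 1]
  proof
    assume "\<exists>u\<in>units. \<exists>\<gamma>. totally_positive K \<gamma> \<and> \<alpha> = u * \<gamma>\<^sup>2 * \<beta>"
    then obtain u \<gamma> where u: "u \<in> units" "totally_positive K \<gamma>" "\<alpha> = u * \<gamma>\<^sup>2 * \<beta>"
      by blast
    have "\<alpha> * \<beta> = u * (\<gamma> * \<beta>)\<^sup>2 * 1"
      unfolding u(3) by (simp add: power2_eq_square)
    then show "\<exists>u\<in>units. \<exists>\<gamma>. totally_positive K \<gamma> \<and> \<alpha> * \<beta> = u * \<gamma>\<^sup>2 * 1"
      using u(1) totally_positive_mult[OF subfield_K u(2) \<beta>'(1)] by blast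
  next
    assume "\<exists>u\<in>units. \<exists>\<gamma>. totally_positive K \<gamma> \<and> \<alpha> * \<beta> = u * \<gamma>\<^sup>2 * 1"
    then obtain u \<gamma> where u: "u \<in> units" "totally_positive K \<gamma>" "\<alpha> * \<beta> = u * \<gamma>\<^sup>2"
      by auto
    have "\<alpha> = u * (\<gamma> / \<beta>)\<^sup>2 * \<beta>"
      using u(3) \<beta>'(2) by (simp add: field_simps power2_eq_square)
    then show "\<exists>u\<in>units. \<exists>\<gamma>. totally_positive K \<gamma> \<and> \<alpha> = u * \<gamma>\<^sup>2 * \<beta>"
      using u(1) totally_positive_divide[OF subfield_K u(2) \<beta>'(1)] by blast
  qed
qed

lemma units_of_square:
  assumes "totally_positive K \<gamma>" "\<gamma>\<^sup>2 \<in> units" shows "\<gamma> \<in> units"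
  using assms algebraic_int_sqrt_of_power2[of \<gamma>] algebraic_int_sqrt_of_power2[of "inverse \<gamma>"]
  by (simp add: units_def power_inverse)

text \<open>The exact sequence as a count: a class c and a set A of independent units determine
  \<open>rep c * u A\<close>, whose representative in R determines c and A. Equal representatives
  differ by a square, so the classes agree; what remains is a relation between two products of units
  modulo squares, which independence excludes unless A = A'.\<close>

lemma narrow_class_group_2tors_bound:
  assumes R: "square_cover K R"
  shows "finite (narrow_class_group_2tors K)"
    and "card (narrow_class_group_2tors K) * 2 ^ (2 ^ n - 1) \<le> card R"
proof -
  obtain m :: "nat \<Rightarrow> complex" where m: "\<And>i. i < 2 ^ n - 1 \<Longrightarrow> m i \<in> units"
    "\<And>A B \<gamma>. A \<subseteq> {..<2 ^ n - 1} \<Longrightarrow> B \<subseteq> {..<2 ^ n - 1} \<Longrightarrow> \<gamma> \<in> units \<Longrightarrow>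
      (\<Prod>i\<in>A. m i) = (\<Prod>i\<in>B. m i) * \<gamma>\<^sup>2 \<Longrightarrow> A = B"
    using independent_units by blast
  define N where "N = 2 ^ n - (1 :: nat)"
  define u where "u A = (\<Prod>i\<in>A. m i)" for A
  have u: "u A \<in> units" if "A \<subseteq> {..<N}" for A
  proof -
    have "finite A"
      using that finite_subset by blast
    then show ?thesis
      using that unfolding u_def
      by (induction A) (auto simp: units_1 N_def intro!: units_mult m(1))
  qed
  have u_indep: "A = B" if "A \<subseteq> {..<N}" "B \<subseteq> {..<N}" "\<gamma> \<in> units" "u A = u B * \<gamma>\<^sup>2" for A B \<gamma>
    using m(2)[of A B \<gamma>] that by (simp add: u_def N_def)
  define C where "C = narrow_class ` square_gens"
  define rep where "rep c = (SOME \<alpha>. \<alpha> \<in> square_gens \<and> narrow_class \<alpha> = c)" for c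
  have rep: "rep c \<in> square_gens" "narrow_class (rep c) = c" if "c \<in> C" for c
  proof -
    have "\<exists>\<alpha>. \<alpha> \<in> square_gens \<and> narrow_class \<alpha> = c"
      using that by (auto simp: C_def)
    then have "rep c \<in> square_gens \<and> narrow_class (rep c) = c"
      unfolding rep_def by (rule someI_ex)
    then show "rep c \<in> square_gens" "narrow_class (rep c) = c"
      by auto
  qed
  have ex: "\<exists>r\<in>R. \<exists>\<gamma>. totally_positive K \<gamma> \<and> rep c * u A = r * \<gamma>\<^sup>2" if "c \<in> C" "A \<subseteq> {..<N}" for c A
    using R square_gens_mult[OF rep(1)[OF that(1)] units_square_gens[OF u[OF that(2)]]]
    unfolding square_cover_def square_gens_def by blast
  define \<rho> where "\<rho> = (\<lambda>(c, A). SOME r. r \<in> R \<and> (\<exists>\<gamma>. totally_positive K \<gamma> \<and> rep c * u A = r * \<gamma>\<^sup>2))"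
  have \<rho>: "\<rho> (c, A) \<in> R \<and> (\<exists>\<gamma>. totally_positive K \<gamma> \<and> rep c * u A = \<rho> (c, A) * \<gamma>\<^sup>2)"
    if "c \<in> C" "A \<subseteq> {..<N}" for c A
  proof -
    have "\<exists>r. r \<in> R \<and> (\<exists>\<gamma>. totally_positive K \<gamma> \<and> rep c * u A = r * \<gamma>\<^sup>2)"
      using ex[OF that] by blast
    then show ?thesis
      unfolding \<rho>_def prod.case by (rule someI_ex)
  qed
  have "inj_on \<rho> (C \<times> Pow {..<N})"
  proof (rule inj_onI)
    fix p p' assume "p \<in> C \<times> Pow {..<N}" "p' \<in> C \<times> Pow {..<N}" and eq: "\<rho> p = \<rho> p'"
    then obtain c A c' A' where p: "p = (c, A)" "p' = (c', A')" "c \<in> C" "c' \<in> C" "A \<subseteq> {..<N}" "A' \<subseteq> {..<N}"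
      by auto
    obtain \<gamma> where \<gamma>: "totally_positive K \<gamma>" "rep c * u A = \<rho> p * \<gamma>\<^sup>2"
      using \<rho>[OF p(3,5)] p(1) by blast
    obtain \<gamma>' where \<gamma>': "totally_positive K \<gamma>'" "rep c' * u A' = \<rho> p * \<gamma>'\<^sup>2"
      using \<rho>[OF p(4,6)] p(2) eq by auto
    define \<delta> where "\<delta> = \<gamma> / \<gamma>'"
    have \<delta>: "totally_positive K \<delta>"
      unfolding \<delta>_def by (rule totally_positive_divide[OF subfield_K \<gamma>(1) \<gamma>'(1)])
    have nz: "\<gamma> \<noteq> 0" "\<gamma>' \<noteq> 0" "u A \<noteq> 0" "u A' \<noteq> 0" "rep c \<noteq> 0" "rep c' \<noteq> 0"
      using tposD(2)[OF \<gamma>(1)] tposD(2)[OF \<gamma>'(1)]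
        square_gensD(4)[OF units_square_gens[OF u]] p(5,6) square_gensD(4)[OF rep(1)] p(3,4) by auto
    have rel: "rep c * u A = rep c' * u A' * \<delta>\<^sup>2"
      unfolding \<gamma>(2) \<gamma>'(2) \<delta>_def using nz(2) by (simp add: power_divide)
    have "rep c = (u A' * inverse (u A)) * \<delta>\<^sup>2 * rep c'"
      using rel nz(3) by (simp add: field_simps)
    moreover have "u A' * inverse (u A) \<in> units"
      using units_mult[OF u[OF p(6)] units_inverse[OF u[OF p(5)]]] .
    ultimately have "narrow_class (rep c) = narrow_class (rep c')"
      using narrow_class_eq_iff[OF rep(1)[OF p(3)] rep(1)[OF p(4)]] \<delta> by blast
    then have c: "c = c'"
      using rep(2) p(3,4) by simp
    then have uu: "u A = u A' * \<delta>\<^sup>2"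
      using rel nz(6) by simp
    then have "\<delta>\<^sup>2 = u A * inverse (u A')"
      using nz(4) by (simp add: field_simps)
    then have "\<delta>\<^sup>2 \<in> units"
      using units_mult[OF u[OF p(5)] units_inverse[OF u[OF p(6)]]] by simp
    \<comment> \<open>Independence holds modulo squares of units, whereas the cover gives squares of
      arbitrary totally positive elements; an element whose square is a unit is integral with
      integral inverse.\<close>
    then have "\<delta> \<in> units"
      by (rule units_of_square[OF \<delta>])
    then have "A = A'"
      using u_indep[OF p(5,6) _ uu] by blast
    then show "p = p'"
      using c p(1,2) by simp
  qed
  moreover have "\<rho> ` (C \<times> Pow {..<N}) \<subseteq> R"
    using \<rho> by auto
  moreover have "finite R"
    using R by (simp add: square_cover_def)
  ultimately have fin: "finite (C \<times> Pow {..<N})" and card: "card (C \<times> Pow {..<N}) \<le> card R"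
    using inj_on_finite card_inj_on_le by blast+
  have "finite C"
    using finite_cartesian_productD1[OF fin] by blast
  then show "finite (narrow_class_group_2tors K)"
    by (simp add: narrow_class_group_2tors_eq C_def)
  show "card (narrow_class_group_2tors K) * 2 ^ (2 ^ n - 1) \<le> card R"
    using card by (simp add: card_cartesian_product card_Pow narrow_class_group_2tors_eq C_def N_def)
qed

lemma narrow_2rank_bound:
  "finite (narrow_class_group_2tors K) \<and>
    2 * (narrow_2rank K + (2 ^ n - 1)) \<le> 2 ^ n * (\<Sum>i\<in>{1..n}. card (prime_factors (a i)))"
proof -
  obtain R e where R: "square_cover K R" "card R \<le> 2 ^ e"
    "2 * e = 2 ^ n * (\<Sum>i\<in>{1..n}. card (prime_factors (a i)))"
    using square_cover_multiquadratic[OF le_refl] by blast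
  note fin = narrow_class_group_2tors_bound(1)[OF R(1)]
  have "\<exists>d. card (narrow_class ` square_gens) = 2 ^ d"
  proof (rule card_image_elementary_2_group)
    show "1 \<in> square_gens"
      by (rule units_square_gens[OF units_1])
    show "finite (narrow_class ` square_gens)"
      using fin by (simp add: narrow_class_group_2tors_eq)
  qed (use square_gens_mult narrow_class_kernel in auto)
  then obtain d where d: "card (narrow_class_group_2tors K) = 2 ^ d"
    by (auto simp: narrow_class_group_2tors_eq)
  \<comment> \<open>The definite description is meaningful only now that the order is known to be a
    power of 2; its exponent is unique.\<close>
  then have rank: "narrow_2rank K = d"
    unfolding narrow_2rank_def by (intro the_equality) auto
  have "2 ^ (d + (2 ^ n - 1)) = card (narrow_class_group_2tors K) * 2 ^ (2 ^ n - 1)"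
    unfolding d by (rule power_add)
  also have "\<dots> \<le> card R"
    by (rule narrow_class_group_2tors_bound(2)[OF R(1)])
  also have "\<dots> \<le> 2 ^ e"
    by (rule R(2))
  finally have "d + (2 ^ n - 1) \<le> e"
    by simp
  then show ?thesis
    using fin rank R(3) by simp
qed

end

lemma mod4_of_prime_factors:
  fixes m :: int
  assumes "m > 0" "\<And>p. p \<in> prime_factors m \<Longrightarrow> p mod 4 = 1"
  shows "m mod 4 = 1"
proof -
  have "prod_mset M mod 4 = 1" if "\<And>p. p \<in># M \<Longrightarrow> p mod 4 = 1" for M :: "int multiset"
    using that
  proof (induction M)
    case (add p M)
    then show ?case
      using mod_mult_eq[of p 4 "prod_mset M"] by simp
  qed simp
  then show ?thesis
    using assms(2) prod_mset_prime_factorization_int[OF assms(1)] by metis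
qed

theorem theorem1p1:
  fixes n :: nat and a :: "nat \<Rightarrow> int"
  assumes "n \<ge> 1"
    and "\<forall>i\<in>{1..n}. squarefree (a i) \<and> a i \<ge> 2"
    and "\<forall>i\<in>{1..n}. \<forall>j\<in>{1..n}. i \<noteq> j \<longrightarrow> coprime (a i) (a j)"
    and "\<forall>i\<in>{1..n}. \<forall>p\<in>prime_factors (a i). p mod 4 = 1"
  shows "finite (narrow_class_group_2tors (multiquadratic_field n a)) \<and>
         int (narrow_2rank (multiquadratic_field n a))
           \<le> int (card (prime_factors (\<Prod>i\<in>{1..n}. a i))) * 2 ^ (n - 1) - 2 ^ n + 1"
proof -
  have pos: "a i > 0" if "i \<in> {1..n}" for i
    using assms(2) that by force
  interpret multiquadratic_tower n a
  proof unfold_locales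
    fix i assume i: "i \<in> {1..n}"
    show "squarefree (a i)" "a i \<ge> 2"
      using assms(2) i by auto
    show "a i mod 4 = 1"
      using assms(4) i by (intro mod4_of_prime_factors[OF pos]) auto
    show "coprime (a i) (a j)" if "j \<in> {1..n}" "i \<noteq> j" for j
      using assms(3) i that by blast
  qed
  define w where "w = card (prime_factors (\<Prod>i\<in>{1..n}. a i))"
  have "prime_factors (\<Prod>i\<in>{1..n}. a i) = (\<Union>i\<in>{1..n}. prime_factors (a i))"
    using pos by (subst prime_factors_prod) force+
  moreover have "prime_factors (a i) \<inter> prime_factors (a j) = {}"
    if "i \<in> {1..n}" "j \<in> {1..n}" "i \<noteq> j" for i j
  proof (rule equals0I)
    fix p assume p: "p \<in> prime_factors (a i) \<inter> prime_factors (a j)"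
    then have "is_unit p"
      by (intro coprime_common_divisor[OF cop[OF that]]) auto
    then show False
      using p not_prime_unit[of p] by auto
  qed
  \<comment> \<open>Coprimality makes the sets of prime factors disjoint, so the number of primes is
    additive over the generators.\<close>
  ultimately have "w = (\<Sum>i\<in>{1..n}. card (prime_factors (a i)))"
    unfolding w_def by (simp add: card_UN_disjoint)
  then have fin: "finite (narrow_class_group_2tors K)"
    and bound: "2 * (narrow_2rank K + (2 ^ n - 1)) \<le> 2 ^ n * w"
    using narrow_2rank_bound by auto
  \<comment> \<open>With truncated subtraction this needs n to be positive.\<close>
  have "(2 :: nat) ^ n = 2 * 2 ^ (n - 1)"
    using assms(1) by (simp flip: power_Suc)
  then have "2 ^ n * w = 2 * (2 ^ (n - 1) * w)"
    by simp
  then have "2 * (narrow_2rank K + (2 ^ n - 1)) \<le> 2 * (2 ^ (n - 1) * w)"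
    using bound by (simp only:)
  then have "narrow_2rank K + (2 ^ n - 1) \<le> 2 ^ (n - 1) * w"
    by (rule mult_left_le_imp_le) simp
  \<comment> \<open>Guards the natural number subtraction \<open>2 ^ n - 1\<close> before passing to
    the integers.\<close>
  moreover have "(1 :: nat) \<le> 2 ^ n"
    by simp
  ultimately have "narrow_2rank K + 2 ^ n \<le> 2 ^ (n - 1) * w + 1"
    by linarith
  then have "int (narrow_2rank K + 2 ^ n) \<le> int (2 ^ (n - 1) * w + 1)"
    by (simp only: of_nat_le_iff)
  then show ?thesis
    using fin by (simp add: w_def mult.commute)
qed

end
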